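(* There exists a constant $C>0$, depending only on the fixed parameters $\Lambda, K, \tilde a, a_1$ (in particular independent of $h$, $t$, $\ell_0$, $\ell_{0,h}$), such that the following holds. Let $\ell_0\in H^2((0,\Lambda))$, let $\ell$ be the weak solution of the continuous problem (P) with initial data $\ell_0$, let $N\ge 1$, $h=\Lambda/N$, $\ell_{0,h}\in\mathcal V_h$, and let $\ell_h$ be the solution of the discrete problem (P$_h$) with initial data $\ell_{0,h}$ (both problems are defined in the context). Then for all $t\ge 0$, $$\Vert \ell_h(t)-\ell(t)\Vert \le C\Vert \ell_{0,h}-\ell_0\Vert + C h^2\big(\Vert \partial_{yy}\ell_0\Vert+\Vert\partial_{yy}\ell(t)\Vert\big) + C h\left(\int_0^t \Vert \partial_{yt}\ell(s)\Vert^2\,ds\right)^{1/2}.$$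
   Context: Fix constants $\Lambda,K,\tilde a,a_1>0$, and $L>0$, $\omega>0$, $\tilde\varepsilon\in[0,1)$, and let $L_0(t)=L(1+\tilde\varepsilon\cos(\omega t))$, with $\dot L_0$ its time derivative. $\Vert\cdot\Vert$ denotes the norm of $L^2((0,\Lambda))$. Let $\mathcal V=\{u\in H^1((0,\Lambda)) : u(\Lambda)=0\}$ with scalar product $(u,v)_{\mathcal V}=\int_0^\Lambda \partial_y u\,\partial_y v\,dy$, and let $$\kappa(u,v)=\Lambda^2K\int_0^\Lambda \partial_y u\,\partial_y v\,dy+\frac{\Lambda K\tilde a}{2a_1}u(0)v(0),\qquad u,v\in\mathcal V.$$ Continuous problem (P): given $\ell_0\in L^2((0,\Lambda))$, $\ell=\ell(y,t)$ is the unique function which for every $T>0$ belongs to $L^\infty(0,T;L^2((0,\Lambda)))\cap L^2(0,T;\mathcal V)$ and satisfies $\ell(\cdot,0)=\ell_0$ and, for all $v\in\mathcal V$ and $t\in(0,T)$ (in the usual weak sense in time), $$\frac{d}{dt}\int_0^\Lambda \ell(y,t) v(y)\,dy+\kappa(\ell(\cdot,t),v)=-\frac{\Lambda}{2}\dot L_0(t)\,v(0).$$ This is the weak form of the heat equation $\partial_t\ell=\Lambda^2K\partial_{yy}\ell$ on $(0,\Lambda)$ with $\Lambda^2K\partial_y\ell(0,t)-\Lambda K\frac{\tilde a}{2a_1}\ell(0,t)=\frac\Lambda2\dot L_0(t)$ and $\ell(\Lambda,t)=0$. For $t\ge0$, $\ell(t)=\ell(\cdot,t)$ denotes the value at $t$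 of the representative of $\ell$ that is continuous in time with values in $L^2((0,\Lambda))$. Discretization: for an integer $N\ge1$, let $h=\Lambda/N$ and $y_j=(j-1)h$ for $1\le j\le N+1$. Let $\mathcal V_h\subset\mathcal V$ be the space of continuous functions on $[0,\Lambda]$ that are affine on each $[y_j,y_{j+1}]$ and vanish at $\Lambda$. For $u_h,v_h\in\mathcal V_h$ let $(u_h,v_h)_h=h\sum_{j=1}^N u_h(y_j)v_h(y_j)$. Discrete problem (P$_h$): given $\ell_{0,h}\in\mathcal V_h$, $\ell_h:[0,\infty)\to\mathcal V_h$ is the unique $C^1$ function with $\ell_h(0)=\ell_{0,h}$ and $$(\partial_t\ell_h(t),\chi_h)_h+\kappa(\ell_h(t),\chi_h)=-\frac\Lambda2\dot L_0(t)\chi_h(0)\qquad\text{for all }\chi_h\in\mathcal V_h,\ t\ge0.$$ Equivalently, the nodal vector $L_h(t)=(\ell_h(y_1,t),\dots,\ell_h(y_N,t))^T$ solves $\frac{d}{dt}(\widetilde M_hL_h)+K_hL_h=\tilde f$, where $\widetilde M_h=h\,\mathrm{Id}$, $(K_h)_{ij}=\kappa(\Phi_i,\Phi_j)$, with $\Phi_j\in\mathcal V_h$ the hat functions $\Phi_j(y_k)=\delta_{jk}$ ($1\le j,k\le N$), and $\tilde f=(-\frac\Lambda2\dot L_0,0,\dots,0)^T$. Convention: derivatives of $\ell$ and $\ell_0$ in the estimate are in the sense of distributions, and an $L^2$ norm (or time integral) on the right-hand side is understood to be $+\infty$ if the corresponding function is not square integrable. *)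

theory Defs
  imports "HOL-Analysis.Analysis"
begin

section \<open>Square-integrable functions and weak derivatives\<close>

definition L2 :: "'a::euclidean_space set \<Rightarrow> ('a \<Rightarrow> real) \<Rightarrow> bool" where
  "L2 U f \<longleftrightarrow> set_borel_measurable lborel U f \<and> set_integrable lborel U (\<lambda>x. (f x)\<^sup>2)"

definition L2_inner :: "'a::euclidean_space set \<Rightarrow> ('a \<Rightarrow> real) \<Rightarrow> ('a \<Rightarrow> real) \<Rightarrow> real" where
  "L2_inner U f g = (LINT x:U|lborel. f x * g x)"

definition L2_norm :: "'a::euclidean_space set \<Rightarrow> ('a \<Rightarrow> real) \<Rightarrow> real" where
  "L2_norm U f = sqrt (L2_inner U f f)"

definition L1_loc :: "'a::euclidean_space set \<Rightarrow> ('a \<Rightarrow> real) \<Rightarrow> bool" where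
  "L1_loc U f \<longleftrightarrow> (\<forall>S. compact S \<and> S \<subseteq> U \<longrightarrow> set_integrable lborel S f)"

text \<open>
  Mixed partial derivatives are indexed by the list of coordinate directions (elements of
  \<^term>\<open>Basis\<close>) in which one differentiates: \<^term>\<open>[1, 1 :: real]\<close> stands for the second
  derivative on the line, and \<^term>\<open>[(1, 0), (0, 1) :: real \<times> real]\<close> for the derivative
  $\partial_{yt}$ of a function of $(y, t)$.
\<close>

primrec partials :: "'a::euclidean_space list \<Rightarrow> ('a \<Rightarrow> real) \<Rightarrow> 'a \<Rightarrow> real" where
  "partials [] f = f"
| "partials (b # bs) f = partials bs (\<lambda>x. frechet_derivative f (at x) b)"

definition smooth :: "('a::euclidean_space \<Rightarrow> real) \<Rightarrow> bool" where
  "smooth f \<longleftrightarrow> (\<forall>bs \<in> lists Basis. partials bs f differentiable_on UNIV)"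

definition test_function :: "'a::euclidean_space set \<Rightarrow> ('a \<Rightarrow> real) \<Rightarrow> bool" where
  "test_function U \<phi> \<longleftrightarrow>
     smooth \<phi> \<and> compact (closure {x. \<phi> x \<noteq> 0}) \<and> closure {x. \<phi> x \<noteq> 0} \<subseteq> U"

text \<open>Here \<open>g\<close> is the derivative of \<open>f\<close> in the sense of distributions on the open set \<open>U\<close>.\<close>

definition has_weak_deriv ::
    "'a::euclidean_space set \<Rightarrow> 'a list \<Rightarrow> ('a \<Rightarrow> real) \<Rightarrow> ('a \<Rightarrow> real) \<Rightarrow> bool" where
  "has_weak_deriv U bs f g \<longleftrightarrow>
     L1_loc U f \<and> L1_loc U g \<and>
     (\<forall>\<phi>. test_function U \<phi> \<longrightarrow>
        (LINT x:U|lborel. f x * partials bs \<phi> x)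
          = (- 1) ^ length bs * (LINT x:U|lborel. g x * \<phi> x))"

definition has_L2_deriv :: "'a::euclidean_space set \<Rightarrow> 'a list \<Rightarrow> ('a \<Rightarrow> real) \<Rightarrow> bool" where
  "has_L2_deriv U bs f \<longleftrightarrow> (\<exists>g. L2 U g \<and> has_weak_deriv U bs f g)"

text \<open>A square-integrable distributional derivative is unique up to null sets; this picks a
  representative of it.\<close>

definition L2_deriv :: "'a::euclidean_space set \<Rightarrow> 'a list \<Rightarrow> ('a \<Rightarrow> real) \<Rightarrow> 'a \<Rightarrow> real" where
  "L2_deriv U bs f = (SOME g. L2 U g \<and> has_weak_deriv U bs f g)"

text \<open>The $L^2$ norm of a distributional derivative, with value $+\infty$ if the derivative is not
  a square-integrable function.  For \<open>U = (0, \<Lambda>) \<times> (0, t)\<close> it is, by Tonelli's theorem,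
  $(\int_0^t \Vert g(\cdot, s) \Vert^2 \, ds)^{1/2}$ with \<open>g\<close> the derivative.\<close>

definition deriv_norm :: "'a::euclidean_space set \<Rightarrow> 'a list \<Rightarrow> ('a \<Rightarrow> real) \<Rightarrow> ennreal" where
  "deriv_norm U bs f =
     (if has_L2_deriv U bs f then ennreal (L2_norm U (L2_deriv U bs f)) else \<infinity>)"

text \<open>The Sobolev space $H^k(U)$.\<close>

definition sobolev :: "nat \<Rightarrow> 'a::euclidean_space set \<Rightarrow> ('a \<Rightarrow> real) \<Rightarrow> bool" where
  "sobolev k U f \<longleftrightarrow>
     L2 U f \<and> (\<forall>bs \<in> lists Basis. length bs \<le> k \<longrightarrow> has_L2_deriv U bs f)"


section \<open>The continuous problem\<close>

text \<open>Elements of $H^1((0, \Lambda))$ are represented by their continuous representative on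
  $[0, \Lambda]$, so that the traces at \<open>0\<close> and \<open>\<Lambda>\<close> are point values.\<close>

definition V_space :: "real \<Rightarrow> (real \<Rightarrow> real) set" where
  "V_space \<Lambda> = {u. sobolev 1 {0<..<\<Lambda>} u \<and> continuous_on {0..\<Lambda>} u \<and> u \<Lambda> = 0}"

definition V_inner :: "real \<Rightarrow> (real \<Rightarrow> real) \<Rightarrow> (real \<Rightarrow> real) \<Rightarrow> real" where
  "V_inner \<Lambda> u v =
     (LINT y:{0<..<\<Lambda>}|lborel. L2_deriv {0<..<\<Lambda>} [1] u y * L2_deriv {0<..<\<Lambda>} [1] v y)"

definition kappa ::
    "real \<Rightarrow> real \<Rightarrow> real \<Rightarrow> real \<Rightarrow> (real \<Rightarrow> real) \<Rightarrow> (real \<Rightarrow> real) \<Rightarrow> real" where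
  "kappa \<Lambda> K atilde a1 u v =
     \<Lambda>\<^sup>2 * K * V_inner \<Lambda> u v + \<Lambda> * K * atilde / (2 * a1) * u 0 * v 0"

definition L0 :: "real \<Rightarrow> real \<Rightarrow> real \<Rightarrow> real \<Rightarrow> real" where
  "L0 L \<omega> \<epsilon> t = L * (1 + \<epsilon> * cos (\<omega> * t))"

text \<open>
  A function $\ell(y, t)$ is written \<open>l t y\<close>.  The predicate describes the representative of the
  weak solution that is jointly measurable and continuous in time with values in
  $L^2((0, \Lambda))$.  Its clauses are: measurability, membership in
  $L^\infty(0, T; L^2((0, \Lambda)))$, membership in $L^2(0, T; \mathcal V)$, the weak equation
  (tested with every $v \in \mathcal V$, as an identity of distributions in $t \in (0, T)$),
  continuity in time, and the initial condition.
\<close>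

definition weak_solution ::
    "real \<Rightarrow> real \<Rightarrow> real \<Rightarrow> real \<Rightarrow> real \<Rightarrow> real \<Rightarrow> real \<Rightarrow>
      (real \<Rightarrow> real) \<Rightarrow> (real \<Rightarrow> real \<Rightarrow> real) \<Rightarrow> bool" where
  "weak_solution \<Lambda> K atilde a1 L \<omega> \<epsilon> l0 l \<longleftrightarrow>
     set_borel_measurable lborel ({0<..<\<Lambda>} \<times> {0..}) (\<lambda>(y, t). l t y) \<and>
     (\<forall>T>0.
        (\<exists>M. AE t in lborel. t \<in> {0<..<T} \<longrightarrow>
               L2 {0<..<\<Lambda>} (l t) \<and> L2_norm {0<..<\<Lambda>} (l t) \<le> M) \<and>
        (AE t in lborel. t \<in> {0<..<T} \<longrightarrow> l t \<in> V_space \<Lambda>) \<and>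
        set_integrable lborel {0<..<T} (\<lambda>t. V_inner \<Lambda> (l t) (l t)) \<and>
        (\<forall>v \<in> V_space \<Lambda>.
           has_weak_deriv {0<..<T} [1]
             (\<lambda>t. L2_inner {0<..<\<Lambda>} (l t) v)
             (\<lambda>t. - (\<Lambda> / 2) * deriv (L0 L \<omega> \<epsilon>) t * v 0 - kappa \<Lambda> K atilde a1 (l t) v))) \<and>
     (\<forall>t\<ge>0. L2 {0<..<\<Lambda>} (l t)) \<and>
     (\<forall>t\<ge>0. ((\<lambda>s. L2_norm {0<..<\<Lambda>} (\<lambda>y. l s y - l t y)) \<longlongrightarrow> 0) (at t within {0..})) \<and>
     (AE y in lborel. y \<in> {0<..<\<Lambda>} \<longrightarrow> l 0 y = l0 y)"


section \<open>The discrete problem\<close>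

definition node :: "real \<Rightarrow> nat \<Rightarrow> nat \<Rightarrow> real" where
  "node \<Lambda> N j = (real j - 1) * (\<Lambda> / real N)"

definition Vh_space :: "real \<Rightarrow> nat \<Rightarrow> (real \<Rightarrow> real) set" where
  "Vh_space \<Lambda> N =
     {u. continuous_on {0..\<Lambda>} u \<and>
         (\<forall>j\<in>{1..N}. \<exists>a b. \<forall>y\<in>{node \<Lambda> N j..node \<Lambda> N (j + 1)}. u y = a * y + b) \<and>
         u \<Lambda> = 0}"

definition h_inner :: "real \<Rightarrow> nat \<Rightarrow> (real \<Rightarrow> real) \<Rightarrow> (real \<Rightarrow> real) \<Rightarrow> real" where
  "h_inner \<Lambda> N u v = \<Lambda> / real N * (\<Sum>j = 1..N. u (node \<Lambda> N j) * v (node \<Lambda> N j))"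

text \<open>
  As $\mathcal V_h$ is finite dimensional, and only the values on $[0, \Lambda]$ of its elements
  matter, a curve in it is $C^1$ on $[0, \infty)$ iff its value at each $y \in [0, \Lambda]$ is.
  The time derivative, one-sided at \<open>t = 0\<close>, is \<open>dl\<close>.
\<close>

definition discrete_solution ::
    "real \<Rightarrow> real \<Rightarrow> real \<Rightarrow> real \<Rightarrow> real \<Rightarrow> real \<Rightarrow> real \<Rightarrow>
      nat \<Rightarrow> (real \<Rightarrow> real) \<Rightarrow> (real \<Rightarrow> real \<Rightarrow> real) \<Rightarrow> bool" where
  "discrete_solution \<Lambda> K atilde a1 L \<omega> \<epsilon> N l0h lh \<longleftrightarrow>
     (\<forall>t\<ge>0. lh t \<in> Vh_space \<Lambda> N) \<and>
     (\<forall>y\<in>{0..\<Lambda>}. lh 0 y = l0h y) \<and>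
     (\<exists>dl.
        (\<forall>y\<in>{0..\<Lambda>}. \<forall>t\<ge>0.
           ((\<lambda>s. lh s y) has_real_derivative dl t y) (at t within {0..})) \<and>
        (\<forall>y\<in>{0..\<Lambda>}. continuous_on {0..} (\<lambda>t. dl t y)) \<and>
        (\<forall>w \<in> Vh_space \<Lambda> N. \<forall>t\<ge>0.
           h_inner \<Lambda> N (dl t) w + kappa \<Lambda> K atilde a1 (lh t) w
             = - (\<Lambda> / 2) * deriv (L0 L \<omega> \<epsilon>) t * w 0))"

end

theory Submission
  imports Defs
begin


text \<open>In one space dimension the nodal interpolant \<open>I u\<close> of a function \<open>u\<close> is its elliptic projection:
\<open>u - I u\<close> vanishes at the mesh points, so \<open>\<integral> (u - I u)' v' = 0\<close> for every \<open>v\<close> with piecewise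
constant derivative, and the boundary term at \<open>0\<close> sees only the value there.  Hence
\<open>kappa u v = kappa (I u) v\<close> for \<open>v\<close> in the discrete space (lemma \<open>kappa_eq_mesh_kappa\<close>), and the
difference \<open>\<theta> = l_h - I l\<close> solves the discrete equation with the right-hand side
\<open>(\<partial>_t l, v) - (\<partial>_t l, v)_h\<close>, which is the quadrature error of the lumped scalar product.  As
\<open>\<partial>_t l\<close> vanishes at \<open>\<Lambda>\<close> and has the space derivative \<open>g = \<partial>_yt l\<close>, this error is at most a
constant times \<open>h \<parallel>g\<parallel> \<parallel>v'\<parallel>\<close> (lemma \<open>quadrature_error\<close>).  Testing with \<open>v = \<theta>\<close>, the form \<open>kappa\<close>
absorbs \<open>\<parallel>v'\<parallel>\<close> and leaves \<open>|\<theta> t|_h^2 \<le> |\<theta> 0|_h^2 + 2 h^2 / K \<integral> \<parallel>g\<parallel>^2\<close> (lemma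
\<open>energy_estimate\<close>).  The equivalence of \<open>|.|_h\<close> with the \<open>L^2\<close> norm on the discrete space and the
interpolation estimate \<open>\<parallel>u - I u\<parallel> \<le> h^2 \<parallel>u''\<parallel>\<close>, used at the times \<open>0\<close> and \<open>t\<close>, give the theorem.

The regularity that this argument needs has to be extracted from the weak formulation.  If \<open>g\<close> is
square integrable on \<open>(0, \<Lambda>) \<times> (0, t)\<close>, products of one-dimensional test functions and the lemma of
du Bois-Reymond, in time and then in space, show that
\<open>l s y = l 0 y + c s - \<integral>_y^\<Lambda> \<integral>_0^s g\<close>.  For almost every \<open>s\<close> the left-hand side has trace \<open>0\<close> at
\<open>\<Lambda>\<close>; so \<open>c\<close> is constant, and by continuity in time it is \<open>c 0 = 0\<close> (lemma
\<open>evolution_representation\<close>).  Thus every nodal value of \<open>l\<close> is a primitive in time of an integrable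
function, and the energy identity for such functions follows from integration by parts for
primitives, which is Fubini's theorem on a square cut along its diagonal.\<close>

section \<open>Square-integrable functions\<close>

lemma quadratic_nonneg_imp_discriminant:
  fixes a b c :: real
  assumes "\<And>x. 0 \<le> a + 2 * x * c + x\<^sup>2 * b" and "0 \<le> b"
  shows "c\<^sup>2 \<le> a * b"
proof (cases "b = 0")
  case True
  have "c = 0"
  proof (rule ccontr)
    assume "c \<noteq> 0"
    then show False using assms(1)[of "- (a + 1) / (2 * c)"] True by (simp add: field_simps)
  qed
  then show ?thesis using True by simp
next
  case False
  then have b: "b > 0" using assms(2) by simp
  have "0 \<le> a + 2 * (- c / b) * c + (- c / b)\<^sup>2 * b" by (rule assms(1))
  also have "\<dots> = a - c\<^sup>2 / b" using b by (simp add: field_simps power2_eq_square)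
  finally show ?thesis using b by (simp add: field_simps)
qed

lemma L2_measurable: "L2 U f \<Longrightarrow> (\<lambda>x. indicator U x * f x) \<in> borel_measurable lborel"
  by (simp add: L2_def set_borel_measurable_def)

lemma L2_mult_integrable:
  assumes "L2 U f" "L2 U g"
  shows "set_integrable lborel U (\<lambda>x. f x * g x)"
proof -
  have i: "integrable lborel (\<lambda>x. indicat_real U x * (f x)\<^sup>2 + indicat_real U x * (g x)\<^sup>2)"
    using assms unfolding L2_def set_integrable_def by (auto intro!: Bochner_Integration.integrable_add)
  have m: "(\<lambda>x. (indicat_real U x * f x) * (indicat_real U x * g x)) \<in> borel_measurable lborel"
    using L2_measurable[OF assms(1)] L2_measurable[OF assms(2)] by (rule borel_measurable_times)
  have e: "(indicat_real U x * f x) * (indicat_real U x * g x) = indicator U x *\<^sub>R (f x * g x)" for x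
    by (auto simp: indicator_def)
  show ?thesis unfolding set_integrable_def
  proof (rule Bochner_Integration.integrable_bound[OF i])
    show "(\<lambda>x. indicat_real U x *\<^sub>R (f x * g x)) \<in> borel_measurable lborel" using m unfolding e .
    have "\<bar>a * b\<bar> \<le> a\<^sup>2 + b\<^sup>2" for a b :: real
      using sum_squares_bound[of "\<bar>a\<bar>" "\<bar>b\<bar>"] mult_nonneg_nonneg[OF abs_ge_zero[of a] abs_ge_zero[of b]]
      unfolding abs_mult power2_abs by linarith
    then show "AE x in lborel. norm (indicat_real U x *\<^sub>R (f x * g x))
        \<le> norm (indicat_real U x * (f x)\<^sup>2 + indicat_real U x * (g x)\<^sup>2)"
      by (intro AE_I2) (auto simp: indicator_def)
  qed
qed

lemma L2_add:
  assumes "L2 U f" "L2 U g" shows "L2 U (\<lambda>x. f x + g x)"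
proof -
  have "set_integrable lborel U (\<lambda>x. (f x)\<^sup>2 + 2 * (f x * g x) + (g x)\<^sup>2)"
    using assms L2_mult_integrable[OF assms] by (intro set_integral_add(1) set_integrable_mult_right) (auto simp: L2_def)
  moreover have "(\<lambda>x. indicat_real U x * f x + indicat_real U x * g x) \<in> borel_measurable lborel"
    using assms by (intro borel_measurable_add L2_measurable)
  ultimately show ?thesis
    unfolding L2_def set_borel_measurable_def by (simp add: power2_sum algebra_simps)
qed

lemma L2_cmult:
  assumes "L2 U f" shows "L2 U (\<lambda>x. c * f x)"
proof -
  have "(\<lambda>x. c * (indicat_real U x * f x)) \<in> borel_measurable lborel"
    using L2_measurable[OF assms] by simp
  then show ?thesis using assms
    unfolding L2_def set_borel_measurable_def by (simp add: power_mult_distrib algebra_simps)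
qed

lemma L2_diff:
  assumes "L2 U f" "L2 U g" shows "L2 U (\<lambda>x. f x - g x)"
  using L2_add[OF assms(1) L2_cmult[OF assms(2), of "-1"]] by simp

lemma L2_const:
  assumes "U \<in> sets lborel" "emeasure lborel U < \<infinity>" shows "L2 U (\<lambda>x. c)"
  using assms unfolding L2_def set_borel_measurable_def set_integrable_def
  by (auto intro!: integrable_mult_left)

lemma L2_imp_integrable:
  assumes "L2 U f" "U \<in> sets lborel" "emeasure lborel U < \<infinity>"
  shows "set_integrable lborel U f"
  using L2_mult_integrable[OF assms(1) L2_const[OF assms(2,3), of 1]] by simp

lemma L2_abs:
  assumes "L2 U f" shows "L2 U (\<lambda>x. \<bar>f x\<bar>)"
proof -
  have "(\<lambda>x. \<bar>indicat_real U x * f x\<bar>) \<in> borel_measurable lborel"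
    using L2_measurable[OF assms] by simp
  then show ?thesis using assms
    unfolding L2_def set_borel_measurable_def by (simp add: abs_mult)
qed

lemma set_lebesgue_integral_nonneg:
  fixes f :: "'a \<Rightarrow> real"
  assumes "\<And>x. x \<in> U \<Longrightarrow> 0 \<le> f x" shows "0 \<le> (LINT x:U|M. f x)"
  unfolding set_lebesgue_integral_def using assms
  by (intro Bochner_Integration.integral_nonneg) (auto simp: indicator_def)

lemma L2_inner_self_nonneg: "0 \<le> L2_inner U f f"
  unfolding L2_inner_def by (intro set_lebesgue_integral_nonneg) simp

lemma L2_norm_nonneg: "0 \<le> L2_norm U f"
  by (simp add: L2_norm_def L2_inner_self_nonneg)

lemma L2_norm_squared: "(L2_norm U f)\<^sup>2 = (LINT x:U|lborel. (f x)\<^sup>2)"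
  using L2_inner_self_nonneg[of U f] by (simp add: L2_norm_def L2_inner_def power2_eq_square)

lemma L2_Cauchy_Schwarz:
  assumes "L2 U f" "L2 U g"
  shows "(LINT x:U|lborel. f x * g x)\<^sup>2 \<le> (LINT x:U|lborel. (f x)\<^sup>2) * (LINT x:U|lborel. (g x)\<^sup>2)"
proof (rule quadratic_nonneg_imp_discriminant)
  have fg: "set_integrable lborel U (\<lambda>x. f x * g x)" by (rule L2_mult_integrable[OF assms])
  have ff: "set_integrable lborel U (\<lambda>x. (f x)\<^sup>2)" "set_integrable lborel U (\<lambda>x. (g x)\<^sup>2)"
    using assms by (auto simp: L2_def)
  fix r :: real
  have "0 \<le> (LINT x:U|lborel. (f x + r * g x)\<^sup>2)" by (rule set_lebesgue_integral_nonneg) simp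
  also have "\<dots> = (LINT x:U|lborel. (f x)\<^sup>2 + (2 * r) * (f x * g x) + r\<^sup>2 * (g x)\<^sup>2)"
    by (simp add: power2_sum power_mult_distrib algebra_simps)
  also have "\<dots> = (LINT x:U|lborel. (f x)\<^sup>2) + 2 * r * (LINT x:U|lborel. f x * g x)
      + r\<^sup>2 * (LINT x:U|lborel. (g x)\<^sup>2)"
    using fg ff by (simp add: set_integral_add)
  finally show "0 \<le> (LINT x:U|lborel. (f x)\<^sup>2) + 2 * r * (LINT x:U|lborel. f x * g x)
      + r\<^sup>2 * (LINT x:U|lborel. (g x)\<^sup>2)" .
  show "0 \<le> (LINT x:U|lborel. (g x)\<^sup>2)" by (rule set_lebesgue_integral_nonneg) simp
qed

lemma L2_inner_abs_le:
  assumes "L2 U f" "L2 U g"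
  shows "\<bar>L2_inner U f g\<bar> \<le> L2_norm U f * L2_norm U g"
proof (rule power2_le_imp_le)
  show "\<bar>L2_inner U f g\<bar>\<^sup>2 \<le> (L2_norm U f * L2_norm U g)\<^sup>2"
    using L2_Cauchy_Schwarz[OF assms] by (simp add: power_mult_distrib L2_norm_squared L2_inner_def)
qed (simp add: L2_norm_nonneg)

lemma L2_integral_abs_squared_le:
  assumes "L2 U f" "U \<in> sets lborel" "emeasure lborel U < \<infinity>"
  shows "(LINT x:U|lborel. \<bar>f x\<bar>)\<^sup>2 \<le> measure lborel U * (LINT x:U|lborel. (f x)\<^sup>2)"
  using L2_Cauchy_Schwarz[OF L2_abs[OF assms(1)] L2_const[OF assms(2,3), of 1]] assms(2,3)
  by (simp add: set_lebesgue_integral_def mult.commute)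


section \<open>Smooth functions\<close>

text \<open>Smoothness speaks of all iterated partial derivatives.  A family of differentiable functions that is
closed under partial derivatives settles them all at once; each smoothness proof below exhibits such
a family.\<close>

lemma smooth_coinduct:
  assumes "f \<in> S"
    and "\<And>h. h \<in> S \<Longrightarrow> h differentiable_on UNIV"
    and "\<And>h b. h \<in> S \<Longrightarrow> b \<in> Basis \<Longrightarrow> (\<lambda>x. frechet_derivative h (at x) b) \<in> S"
  shows "smooth f"
proof -
  have "\<forall>h\<in>S. partials bs h \<in> S" if "bs \<in> lists Basis" for bs
    using that by (induction bs) (auto intro: assms(3))
  then show ?thesis unfolding smooth_def using assms by blast
qed

lemma smooth_differentiable: "smooth f \<Longrightarrow> f differentiable (at x)"
  unfolding smooth_def using differentiable_on_def
  by (metis lists.Nil partials.simps(1) UNIV_I)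

lemma smooth_frechet_derivative:
  assumes "smooth f" "b \<in> Basis" shows "smooth (\<lambda>x. frechet_derivative f (at x) b)"
  unfolding smooth_def
proof
  fix bs :: "'a list" assume "bs \<in> lists Basis"
  then have "b # bs \<in> lists Basis" using assms(2) by simp
  then have "partials (b # bs) f differentiable_on UNIV" using assms(1) unfolding smooth_def by blast
  then show "partials bs (\<lambda>x. frechet_derivative f (at x) b) differentiable_on UNIV" by simp
qed

text \<open>By the product rule a derivative of a product of smooth functions is a sum of products of smooth
functions, but no longer a single product; the closure under both operations is stable.\<close>

inductive_set smooth_algebra :: "('a::euclidean_space \<Rightarrow> real) set" where
  base: "smooth f \<Longrightarrow> f \<in> smooth_algebra"
| add: "f \<in> smooth_algebra \<Longrightarrow> g \<in> smooth_algebra \<Longrightarrow> (\<lambda>x. f x + g x) \<in> smooth_algebra"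
| mult: "f \<in> smooth_algebra \<Longrightarrow> g \<in> smooth_algebra \<Longrightarrow> (\<lambda>x. f x * g x) \<in> smooth_algebra"

lemma smooth_algebra_closed:
  assumes "f \<in> smooth_algebra"
  shows "(\<forall>x. f differentiable (at x)) \<and>
    (\<forall>b\<in>Basis. (\<lambda>x. frechet_derivative f (at x) b) \<in> smooth_algebra)"
  using assms
proof induction
  case (base f)
  then show ?case
    by (auto intro: smooth_differentiable smooth_frechet_derivative smooth_algebra.base)
next
  case (add f g)
  have "((\<lambda>x. f x + g x) has_derivative
      (\<lambda>v. frechet_derivative f (at x) v + frechet_derivative g (at x) v)) (at x)" for x
    using add by (intro has_derivative_add) (auto simp: frechet_derivative_works)
  then have d: "frechet_derivative (\<lambda>x. f x + g x) (at x)
      = (\<lambda>v. frechet_derivative f (at x) v + frechet_derivative g (at x) v)"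
    and "(\<lambda>x. f x + g x) differentiable (at x)" for x
    using frechet_derivative_at[symmetric] by (auto simp: differentiable_def)
  then show ?case using add by (auto intro!: smooth_algebra.add simp: d)
next
  case (mult f g)
  have "((\<lambda>x. f x * g x) has_derivative
      (\<lambda>v. f x * frechet_derivative g (at x) v + frechet_derivative f (at x) v * g x)) (at x)" for x
    using mult by (intro has_derivative_mult) (auto simp: frechet_derivative_works)
  then have d: "frechet_derivative (\<lambda>x. f x * g x) (at x)
      = (\<lambda>v. f x * frechet_derivative g (at x) v + frechet_derivative f (at x) v * g x)"
    and "(\<lambda>x. f x * g x) differentiable (at x)" for x
    using frechet_derivative_at[symmetric] by (auto simp: differentiable_def)
  then show ?case using mult by (auto intro!: smooth_algebra.add smooth_algebra.mult simp: d)
qed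

lemma smooth_algebra_smooth: "f \<in> smooth_algebra \<Longrightarrow> smooth f"
  by (rule smooth_coinduct[where S = smooth_algebra])
     (auto simp: differentiable_on_def dest: smooth_algebra_closed)

lemma smooth_add: "smooth f \<Longrightarrow> smooth g \<Longrightarrow> smooth (\<lambda>x. f x + g x)"
  and smooth_mult: "smooth f \<Longrightarrow> smooth g \<Longrightarrow> smooth (\<lambda>x. f x * g x)"
  by (rule smooth_algebra_smooth, rule smooth_algebra.add; erule smooth_algebra.base)
     (rule smooth_algebra_smooth, rule smooth_algebra.mult; erule smooth_algebra.base)

lemma smooth_const: "smooth (\<lambda>x. c)"
proof (rule smooth_coinduct[where S = "{\<lambda>x. d | d. True}"])
  fix h :: "'a \<Rightarrow> real" and b assume "h \<in> {\<lambda>x. d | d. True}"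
  then obtain d where "h = (\<lambda>x. d)" by blast
  then show "(\<lambda>x. frechet_derivative h (at x) b) \<in> {\<lambda>x. d | d. True}" by (auto simp: frechet_derivative_const)
qed (auto simp: differentiable_on_def)

lemma smooth_real_coinduct:
  fixes f :: "real \<Rightarrow> real"
  assumes "f \<in> S"
    and "\<And>h. h \<in> S \<Longrightarrow> \<exists>h'\<in>S. \<forall>x. (h has_real_derivative h' x) (at x)"
  shows "smooth f"
proof (rule smooth_coinduct[OF assms(1)])
  fix h assume "h \<in> S"
  then obtain h' where h': "h' \<in> S" "\<And>x. (h has_real_derivative h' x) (at x)" using assms(2) by blast
  then show "h differentiable_on UNIV"
    unfolding differentiable_on_def differentiable_def has_field_derivative_def by blast
  have "frechet_derivative h (at x) = (*) (h' x)" for x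
    using h'(2)[of x] by (metis frechet_derivative_at has_field_derivative_def)
  then show "(\<lambda>x. frechet_derivative h (at x) b) \<in> S" if "b \<in> Basis" for b
    using h' that by simp
qed

lemma smooth_has_real_derivative:
  "smooth f \<Longrightarrow> (f has_real_derivative deriv f x) (at x)"
  using smooth_differentiable DERIV_deriv_iff_real_differentiable by blast

lemma smooth_partial_real:
  fixes f :: "real \<Rightarrow> real"
  assumes "smooth f" shows "(\<lambda>x. frechet_derivative f (at x) 1) = deriv f"
proof
  fix x show "frechet_derivative f (at x) 1 = deriv f x"
    using smooth_has_real_derivative[OF assms, of x] frechet_derivative_at
    by (metis has_field_derivative_def mult.right_neutral)
qed

lemma smooth_deriv: "smooth f \<Longrightarrow> smooth (deriv f)"
  using smooth_frechet_derivative[of f 1] by (simp add: smooth_partial_real)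

lemma smooth_antiderivative:
  assumes "smooth f" "\<And>x. (F has_real_derivative f x) (at x)" shows "smooth F"
  by (rule smooth_real_coinduct[where S = "insert F {h. smooth h}"])
     (use assms smooth_has_real_derivative smooth_deriv in blast)+

lemma smooth_continuous: "smooth f \<Longrightarrow> continuous_on S (f :: real \<Rightarrow> real)"
  by (meson DERIV_continuous continuous_at_imp_continuous_on smooth_has_real_derivative)

lemma has_derivative_compose_affine:
  fixes \<alpha> :: "real \<Rightarrow> real" and A :: "'a::euclidean_space \<Rightarrow> real"
  assumes "smooth \<alpha>" "bounded_linear A"
  shows "((\<lambda>p. k * \<alpha> (A p + d)) has_derivative (\<lambda>v. (k * A v) * deriv \<alpha> (A p + d))) (at p)"
proof -
  have "((\<lambda>p. A p + d) has_derivative A) (at p)"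
    using bounded_linear_imp_has_derivative[OF assms(2)] has_derivative_add_const by blast
  moreover have "(\<alpha> has_derivative (*) (deriv \<alpha> (A p + d))) (at (A p + d))"
    using smooth_has_real_derivative[OF assms(1)] by (simp add: has_field_derivative_def)
  ultimately have "((\<lambda>p. \<alpha> (A p + d)) has_derivative (\<lambda>v. deriv \<alpha> (A p + d) * A v)) (at p)"
    using has_derivative_compose by blast
  from has_derivative_mult_right[OF this, of k] show ?thesis by (simp add: mult_ac)
qed

lemma smooth_compose_affine:
  fixes \<alpha> :: "real \<Rightarrow> real" and A :: "'a::euclidean_space \<Rightarrow> real"
  assumes "smooth \<alpha>" "bounded_linear A"
  shows "smooth (\<lambda>p. \<alpha> (A p + d))"
\<comment> \<open>The factor \<open>k\<close> absorbs the constant \<open>A b\<close> that the chain rule produces.\<close>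
proof (rule smooth_coinduct[where S = "{\<lambda>p. k * \<beta> (A p + d) | k \<beta>. smooth \<beta>}"])
  show "(\<lambda>p. \<alpha> (A p + d)) \<in> {\<lambda>p. k * \<beta> (A p + d) | k \<beta>. smooth \<beta>}"
    using assms(1) by (intro CollectI exI[of _ 1] exI[of _ \<alpha>]) auto
next
  fix h assume "h \<in> {\<lambda>p. k * \<beta> (A p + d) | k \<beta>. smooth \<beta>}"
  then obtain k \<beta> where h: "h = (\<lambda>p. k * \<beta> (A p + d))" "smooth \<beta>" by blast
  note D = has_derivative_compose_affine[OF h(2) assms(2), of k d]
  show "h differentiable_on UNIV"
    using D unfolding h(1) differentiable_on_def differentiable_def by blast
  have "frechet_derivative h (at p) v = k * A v * deriv \<beta> (A p + d)" for p v
    unfolding h(1) using frechet_derivative_at[OF D] by metis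
  then show "(\<lambda>x. frechet_derivative h (at x) b) \<in> {\<lambda>p. k * \<beta> (A p + d) | k \<beta>. smooth \<beta>}" for b
    using smooth_deriv[OF h(2)] by blast
qed

text \<open>For \<open>p = 1\<close> this is the classical smooth function that vanishes exactly on the left half line.
Polynomials in \<open>1 / x\<close> are the factors that its derivatives acquire.\<close>

definition exp_bump :: "real poly \<Rightarrow> real \<Rightarrow> real" where
  "exp_bump p x = (if 0 < x then poly p (1 / x) * exp (- (1 / x)) else 0)"

lemma poly_times_exp_minus_tendsto_0:
  "((\<lambda>u. poly p u * exp (- u)) \<longlongrightarrow> (0::real)) at_top"
proof -
  have "((\<lambda>u. \<Sum>i\<le>degree p. coeff p i * (u ^ i / exp u)) \<longlongrightarrow> (\<Sum>i\<le>degree p. coeff p i * 0)) at_top"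
    by (intro tendsto_sum tendsto_mult tendsto_const tendsto_power_div_exp_0)
  then show ?thesis
    by (simp add: poly_altdef sum_distrib_right exp_minus field_class.field_divide_inverse mult.assoc)
qed

text \<open>For \<open>x > 0\<close> the chain rule turns the factor \<open>p\<close> into \<open>X^2 (p - p')\<close>.  At \<open>0\<close> the difference quotient
is of the same form with \<open>X p\<close> in place of \<open>p\<close>, and it tends to \<open>0\<close> because the exponential
function dominates polynomials.\<close>

lemma exp_bump_has_derivative:
  "(exp_bump p has_real_derivative exp_bump ([:0, 0, 1:] * (p - pderiv p)) x) (at x)"
proof -
  consider "x > 0" | "x < 0" | "x = 0" by linarith
  then show ?thesis
  proof cases
    case 1
    have "((\<lambda>x. poly p (1 / x) * exp (- (1 / x))) has_real_derivative
        exp_bump ([:0, 0, 1:] * (p - pderiv p)) x) (at x)"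
      using 1 by (auto intro!: derivative_eq_intros poly_DERIV[THEN DERIV_chain2] simp: exp_bump_def power2_eq_square field_simps)
    then show ?thesis
    proof (rule has_field_derivative_transform_within_open[where S = "{0<..}"])
    qed (use 1 in \<open>auto simp: exp_bump_def\<close>)
  next
    case 2
    have "((\<lambda>x. 0::real) has_real_derivative exp_bump ([:0, 0, 1:] * (p - pderiv p)) x) (at x)"
      using 2 by (auto simp: exp_bump_def)
    then show ?thesis
      by (rule has_field_derivative_transform_within_open[where S = "{..<0}"])
         (use 2 in \<open>auto simp: exp_bump_def\<close>)
  next
    case 3
    have "((\<lambda>x. exp_bump p x / x) \<longlongrightarrow> 0) (at_right 0)"
    proof -
      have "((\<lambda>x. poly (pCons 0 p) (inverse x) * exp (- inverse x)) \<longlongrightarrow> 0) (at_right (0::real))"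
        by (rule filterlim_compose[OF poly_times_exp_minus_tendsto_0 filterlim_inverse_at_top_right])
      then show ?thesis
        by (rule tendsto_cong[THEN iffD1, rotated])
           (auto simp: eventually_at_filter exp_bump_def field_simps)
    qed
    moreover have "((\<lambda>x. exp_bump p x / x) \<longlongrightarrow> 0) (at_left 0)"
      by (rule tendsto_cong[THEN iffD1, OF _ tendsto_const])
         (auto simp: eventually_at_filter exp_bump_def)
    ultimately have "((\<lambda>x. exp_bump p x / x) \<longlongrightarrow> 0) (at 0)"
      by (simp add: filterlim_at_split)
    then show ?thesis using 3 by (simp add: has_field_derivative_iff exp_bump_def)
  qed
qed

lemma smooth_exp_bump: "smooth (exp_bump p)"
  by (rule smooth_real_coinduct[where S = "range exp_bump"])
     (use exp_bump_has_derivative in blast)+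


section \<open>Integrals on intervals and rectangles\<close>

text \<open>The integrals below are with respect to the Borel-Lebesgue measure, which is not complete; so an
equality almost everywhere may be integrated only if both sides are known to be measurable on \<open>A\<close>.\<close>

lemma set_integral_cong_AE_restricted:
  assumes "set_borel_measurable M A f" "set_borel_measurable M A g" "AE x in M. x \<in> A \<longrightarrow> f x = g x"
  shows "(LINT x:A|M. f x) = (LINT x:A|M. g x)"
  unfolding set_lebesgue_integral_def
  by (rule integral_cong_AE)
     (use assms in \<open>auto simp: set_borel_measurable_def indicator_def elim!: eventually_mono\<close>)

lemma set_integrable_imp_measurable: "set_integrable M A f \<Longrightarrow> set_borel_measurable M A f"
  by (simp add: set_integrable_def set_borel_measurable_def)

lemma set_integrable_mult_bounded:
  fixes f g :: "'a \<Rightarrow> real"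
  assumes "set_integrable M A f" "set_borel_measurable M A g" "\<And>x. x \<in> A \<Longrightarrow> \<bar>g x\<bar> \<le> C"
  shows "set_integrable M A (\<lambda>x. f x * g x)"
proof (rule set_integrable_bound[where f = "\<lambda>x. C * f x"])
  show "set_integrable M A (\<lambda>x. C * f x)" using assms(1) by simp
  have "(\<lambda>x. (indicat_real A x * f x) * (indicat_real A x * g x)) \<in> borel_measurable M"
    using borel_measurable_integrable[OF assms(1)[unfolded set_integrable_def]]
      assms(2)[unfolded set_borel_measurable_def]
    by (simp add: borel_measurable_times)
  moreover have "(indicat_real A x * f x) * (indicat_real A x * g x) = indicator A x *\<^sub>R (f x * g x)" for x
    by (auto simp: indicator_def)
  ultimately show "set_borel_measurable M A (\<lambda>x. f x * g x)"
    unfolding set_borel_measurable_def by simp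
  have "\<bar>f x * g x\<bar> \<le> \<bar>C * f x\<bar>" if "x \<in> A" for x
  proof -
    have "\<bar>g x\<bar> \<le> \<bar>C\<bar>" using assms(3)[OF that] by linarith
    then show ?thesis using mult_left_mono[of "\<bar>g x\<bar>" "\<bar>C\<bar>" "\<bar>f x\<bar>"] by (simp add: abs_mult mult.commute)
  qed
  then show "AE x in M. x \<in> A \<longrightarrow> norm (f x * g x) \<le> norm (C * f x)" by simp
qed

lemma set_borel_measurable_continuous:
  fixes \<phi> :: "real \<Rightarrow> real"
  assumes "continuous_on {a..b} \<phi>"
  shows "set_borel_measurable lborel {a<..<b} \<phi>"
  by (rule set_borel_measurable_subset[OF set_integrable_imp_measurable[OF borel_integrable_atLeastAtMost'[OF assms]]])
     auto

lemma continuous_interval_bounded: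
  fixes \<phi> :: "real \<Rightarrow> real"
  assumes "continuous_on {a..b} \<phi>"
  shows "\<exists>C. \<forall>x\<in>{a..b}. \<bar>\<phi> x\<bar> \<le> C"
  using compact_imp_bounded[OF compact_continuous_image[OF assms compact_Icc]]
  by (simp add: bounded_iff)

lemma set_integrable_mult_continuous:
  fixes f \<phi> :: "real \<Rightarrow> real"
  assumes "set_integrable lborel {a<..<b} f" "continuous_on {a..b} \<phi>"
  shows "set_integrable lborel {a<..<b} (\<lambda>x. f x * \<phi> x)"
proof -
  obtain C where "\<And>x. x \<in> {a..b} \<Longrightarrow> \<bar>\<phi> x\<bar> \<le> C"
    using continuous_interval_bounded[OF assms(2)] by blast
  then show ?thesis
    by (intro set_integrable_mult_bounded[OF assms(1) set_borel_measurable_continuous[OF assms(2)], where C = C]) auto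
qed

lemma set_integrable_continuous:
  fixes \<phi> :: "real \<Rightarrow> real"
  assumes "continuous_on {a..b} \<phi>"
  shows "set_integrable lborel {a<..<b} \<phi>"
  by (rule set_integrable_subset[OF borel_integrable_atLeastAtMost'[OF assms]]) auto

lemma continuous_imp_L2:
  fixes f :: "real \<Rightarrow> real"
  assumes "continuous_on {a..b} f" shows "L2 {a<..<b} f"
  unfolding L2_def using assms
  by (auto intro!: set_borel_measurable_continuous set_integrable_continuous continuous_intros)

lemma set_integral_open_interval:
  fixes f :: "real \<Rightarrow> real"
  shows "(LBINT x:{a<..<b}. f x) = (LBINT x:{a..b}. f x)"
  by (rule set_integral_discrete_difference[where X = "{a, b}"]) auto

lemma set_integrable_open_interval:
  fixes f :: "real \<Rightarrow> real"
  shows "set_integrable lborel {a<..<b} f \<longleftrightarrow> set_integrable lborel {a..b} f"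
  by (rule set_integrable_discrete_difference[where X = "{a, b}"]) auto

lemma set_integral_FTC:
  fixes F f :: "real \<Rightarrow> real"
  assumes "a \<le> b" "\<And>x. x \<in> {a..b} \<Longrightarrow> (F has_real_derivative f x) (at x within {a..b})" "continuous_on {a..b} f"
  shows "(LBINT x:{a<..<b}. f x) = F b - F a"
  unfolding set_integral_open_interval
  using integral_FTC_atLeastAtMost[OF assms(1) _ assms(3), of F] assms(2)
  by (simp add: set_lebesgue_integral_def has_real_derivative_iff_has_vector_derivative)

lemma set_integral_split:
  fixes f :: "real \<Rightarrow> real"
  assumes "set_integrable lborel {a<..<c} f" "a \<le> b" "b \<le> c"
  shows "(LBINT x:{a<..<c}. f x) = (LBINT x:{a<..<b}. f x) + (LBINT x:{b<..<c}. f x)"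
proof -
  have i: "set_integrable lborel {a..c} f" using assms(1) by (simp add: set_integrable_open_interval)
  have "(LBINT x:{a<..<c}. f x) = (LBINT x:{a<..<b} \<union> {b<..<c}. f x)"
    by (rule set_integral_discrete_difference[where X = "{b}"]) (use assms in auto)
  also have "\<dots> = (LBINT x:{a<..<b}. f x) + (LBINT x:{b<..<c}. f x)"
    by (rule set_integral_Un) (use assms in \<open>auto intro: set_integrable_subset[OF assms(1)]\<close>)
  finally show ?thesis .
qed

lemma primitive_continuous:
  fixes f :: "real \<Rightarrow> real"
  assumes "set_integrable lborel {a<..<b} f"
  shows "continuous_on {a..b} (\<lambda>x. LBINT z:{a<..<x}. f z)"
proof -
  have i: "set_integrable lborel {a..b} f" using assms by (simp add: set_integrable_open_interval)
  have "(LBINT z:{a<..<x}. f z) = integral {a..x} f" if "x \<in> {a..b}" for x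
    unfolding set_integral_open_interval
    by (rule set_borel_integral_eq_integral(2)[OF set_integrable_subset[OF i]]) (use that in auto)
  moreover have "continuous_on {a..b} (\<lambda>x. integral {a..x} f)"
    by (rule indefinite_integral_continuous_1[OF set_borel_integral_eq_integral(1)[OF i]])
  ultimately show ?thesis using continuous_on_cong[OF refl] by (metis (mono_tags, lifting))
qed

lemma set_integral_abs_le:
  fixes f :: "'a \<Rightarrow> real"
  shows "\<bar>LINT x:A|M. f x\<bar> \<le> (LINT x:A|M. \<bar>f x\<bar>)"
proof -
  have "(LINT x:A|M. \<bar>f x\<bar>) = (LINT x|M. norm (indicator A x *\<^sub>R f x))"
    unfolding set_lebesgue_integral_def by (intro Bochner_Integration.integral_cong) (auto simp: indicator_def)
  then show ?thesis using integral_norm_bound[of M "\<lambda>x. indicator A x *\<^sub>R f x"]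
    by (simp add: set_lebesgue_integral_def)
qed

lemma rectangle_Fubini:
  fixes F :: "real \<Rightarrow> real \<Rightarrow> real"
  assumes "set_integrable lborel (A \<times> B) (\<lambda>(x, y). F x y)"
  shows "AE x in lborel. x \<in> A \<longrightarrow> set_integrable lborel B (F x)"
    and "set_integrable lborel A (\<lambda>x. LBINT y:B. F x y)"
    and "AE y in lborel. y \<in> B \<longrightarrow> set_integrable lborel A (\<lambda>x. F x y)"
    and "set_integrable lborel B (\<lambda>y. LBINT x:A. F x y)"
    and "(LBINT x:A. (LBINT y:B. F x y)) = (LINT p:A \<times> B|lborel. (\<lambda>(x, y). F x y) p)"
    and "(LBINT y:B. (LBINT x:A. F x y)) = (LINT p:A \<times> B|lborel. (\<lambda>(x, y). F x y) p)"
proof -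
  define G where "G = (\<lambda>x y. indicator A x * (indicator B y * F x y))"
  have e: "indicator (A \<times> B) p *\<^sub>R (case p of (x, y) \<Rightarrow> F x y) = (case p of (x, y) \<Rightarrow> G x y)" for p
    by (cases p) (auto simp: G_def indicator_def)
  have G: "integrable (lborel \<Otimes>\<^sub>M lborel) (\<lambda>(x, y). G x y)"
    using assms unfolding set_integrable_def e lborel_prod .
  show "AE x in lborel. x \<in> A \<longrightarrow> set_integrable lborel B (F x)"
    using lborel_pair.AE_integrable_fst[OF G]
    by (rule eventually_mono) (auto simp: G_def set_integrable_def)
  show "AE y in lborel. y \<in> B \<longrightarrow> set_integrable lborel A (\<lambda>x. F x y)"
    using lborel_pair.AE_integrable_snd[OF G]
    by (rule eventually_mono) (auto simp: G_def set_integrable_def)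
  have e1: "(LINT y|lborel. G x y) = indicator A x *\<^sub>R (LBINT y:B. F x y)" for x
    by (simp add: G_def set_lebesgue_integral_def)
  have e2: "(LINT x|lborel. G x y) = indicator B y *\<^sub>R (LBINT x:A. F x y)" for y
    by (simp add: G_def set_lebesgue_integral_def mult.left_commute[of _ "indicat_real B y"])
  show "set_integrable lborel A (\<lambda>x. LBINT y:B. F x y)"
    using lborel_pair.integrable_fst[OF G] by (simp add: e1 set_integrable_def)
  show "set_integrable lborel B (\<lambda>y. LBINT x:A. F x y)"
    using lborel_pair.integrable_snd[OF G] by (simp add: e2 set_integrable_def)
  have t: "(LINT p:A \<times> B|lborel. (\<lambda>(x, y). F x y) p) = integral\<^sup>L (lborel \<Otimes>\<^sub>M lborel) (\<lambda>(x, y). G x y)"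
    unfolding set_lebesgue_integral_def e lborel_prod ..
  show "(LBINT x:A. (LBINT y:B. F x y)) = (LINT p:A \<times> B|lborel. (\<lambda>(x, y). F x y) p)"
    unfolding t lborel_pair.integral_fst[OF G, symmetric] e1 by (simp add: set_lebesgue_integral_def)
  show "(LBINT y:B. (LBINT x:A. F x y)) = (LINT p:A \<times> B|lborel. (\<lambda>(x, y). F x y) p)"
    unfolding t lborel_pair.integral_snd[OF G, symmetric] e2 by (simp add: set_lebesgue_integral_def)
qed

lemma set_integrable_product:
  fixes f g :: "real \<Rightarrow> real"
  assumes "set_integrable lborel A f" "set_integrable lborel B g"
  shows "set_integrable lborel (A \<times> B) (\<lambda>(x, y). f x * g y)"
proof -
  define f1 g1 where "f1 = (\<lambda>x. indicator A x * f x)" and "g1 = (\<lambda>y. indicator B y * g y)"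
  have [measurable]: "f1 \<in> borel_measurable borel" "g1 \<in> borel_measurable borel"
    and i: "integrable lborel f1" "integrable lborel g1"
    using assms unfolding f1_def g1_def set_integrable_def by (auto dest: borel_measurable_integrable)
  have "integrable (lborel \<Otimes>\<^sub>M lborel) (\<lambda>(x, y). f1 x * g1 y)"
  proof (rule lborel_pair.Fubini_integrable)
    show "(\<lambda>(x, y). f1 x * g1 y) \<in> borel_measurable (lborel \<Otimes>\<^sub>M lborel)" by measurable
    show "integrable lborel (\<lambda>x. LINT y|lborel. norm (case (x, y) of (x, y) \<Rightarrow> f1 x * g1 y))"
      using i by (simp add: abs_mult)
    show "AE x in lborel. integrable lborel (\<lambda>y. case (x, y) of (x, y) \<Rightarrow> f1 x * g1 y)"
      using i by simp
  qed
  moreover have "indicator (A \<times> B) p *\<^sub>R (case p of (x, y) \<Rightarrow> f x * g y) = (case p of (x, y) \<Rightarrow> f1 x * g1 y)" for p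
    by (cases p) (auto simp: f1_def g1_def indicator_def)
  ultimately show ?thesis unfolding set_integrable_def lborel_prod by simp
qed

text \<open>The primitives \<open>P\<close> and \<open>Q\<close> of integrable functions are differentiable only almost everywhere, so the
product rule is not at hand.  Instead, \<open>P b * Q b\<close> is the integral of \<open>p x * q y\<close> over the square, and
the triangles \<open>y < x\<close> and \<open>x \<le> y\<close> contribute the two summands.\<close>

lemma primitive_integration_by_parts:
  fixes p q :: "real \<Rightarrow> real"
  assumes p: "set_integrable lborel {a<..<b} p" and q: "set_integrable lborel {a<..<b} q"
  defines "P \<equiv> \<lambda>x. LBINT z:{a<..<x}. p z" and "Q \<equiv> \<lambda>x. LBINT z:{a<..<x}. q z"
  shows "P b * Q b = (LBINT x:{a<..<b}. p x * Q x) + (LBINT x:{a<..<b}. q x * P x)"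
proof -
  let ?I = "{a<..<b}"
  define F1 F2 where "F1 = (\<lambda>x y. p x * q y * (if y < x then 1 else 0))"
    and "F2 = (\<lambda>x y. p x * q y * (if y < x then 0 else 1))"
  have pq: "set_integrable lborel (?I \<times> ?I) (\<lambda>(x, y). p x * q y)" by (rule set_integrable_product[OF p q])
  have m: "set_borel_measurable lborel (?I \<times> ?I) (\<lambda>z. if snd z < fst z then c else (d::real))" for c d
    unfolding set_borel_measurable_def lborel_prod[symmetric] by measurable
  have F1: "set_integrable lborel (?I \<times> ?I) (\<lambda>(x, y). F1 x y)"
    using set_integrable_mult_bounded[OF pq m[of 1 0], of 1] by (simp add: F1_def case_prod_unfold)
  have F2: "set_integrable lborel (?I \<times> ?I) (\<lambda>(x, y). F2 x y)"
    using set_integrable_mult_bounded[OF pq m[of 0 1], of 1] by (simp add: F2_def case_prod_unfold)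
  have 1: "(LBINT y:?I. F1 x y) = p x * Q x" if "x \<in> ?I" for x
  proof -
    have "(LBINT y:?I. F1 x y) = (LBINT y:{a<..<x}. p x * q y)"
      unfolding set_lebesgue_integral_def F1_def
      by (rule Bochner_Integration.integral_cong) (use that in \<open>auto simp: indicator_def\<close>)
    then show ?thesis by (simp add: Q_def)
  qed
  have 2: "(LBINT x:?I. F2 x y) = q y * P y" if "y \<in> ?I" for y
  proof -
    have "(LBINT x:?I. F2 x y) = (LBINT x:{a<..y}. q y * p x)"
      unfolding set_lebesgue_integral_def F2_def
      by (rule Bochner_Integration.integral_cong) (use that in \<open>auto simp: indicator_def\<close>)
    also have "\<dots> = (LBINT x:{a<..<y}. q y * p x)"
      by (rule set_integral_discrete_difference[where X = "{y}"]) auto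
    finally show ?thesis by (simp add: P_def)
  qed
  have "P b * Q b = (LBINT x:?I. (LBINT y:?I. p x * q y))"
    by (simp add: P_def Q_def mult.commute)
  also have "\<dots> = (LINT z:?I \<times> ?I|lborel. (\<lambda>(x, y). p x * q y) z)" by (rule rectangle_Fubini(5)[OF pq])
  also have "\<dots> = (LINT z:?I \<times> ?I|lborel. (\<lambda>(x, y). F1 x y) z + (\<lambda>(x, y). F2 x y) z)"
    by (rule set_lebesgue_integral_cong) (auto simp: F1_def F2_def borel_Times)
  also have "\<dots> = (LINT z:?I \<times> ?I|lborel. (\<lambda>(x, y). F1 x y) z) + (LINT z:?I \<times> ?I|lborel. (\<lambda>(x, y). F2 x y) z)"
    by (rule set_integral_add[OF F1 F2])
  also have "\<dots> = (LBINT x:?I. (LBINT y:?I. F1 x y)) + (LBINT y:?I. (LBINT x:?I. F2 x y))"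
    using rectangle_Fubini(5)[OF F1] rectangle_Fubini(6)[OF F2] by simp
  also have "\<dots> = (LBINT x:?I. p x * Q x) + (LBINT x:?I. q x * P x)"
    using 1 2 by (intro arg_cong2[where f = "(+)"] set_lebesgue_integral_cong) auto
  finally show ?thesis .
qed

section \<open>Distributions on an interval\<close>

lemma interval_test_functionI:
  fixes \<phi> :: "real \<Rightarrow> real"
  assumes "smooth \<phi>" "0 < a" "b < T" "\<And>x. x \<notin> {a..b} \<Longrightarrow> \<phi> x = 0"
  shows "test_function {0<..<T} \<phi>"
proof -
  have "closure {x. \<phi> x \<noteq> 0} \<subseteq> {a..b}"
    by (rule closure_minimal[OF _ closed_atLeastAtMost]) (use assms(4) in blast)
  moreover from this have "compact (closure {x. \<phi> x \<noteq> 0})"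
    using bounded_subset[OF compact_imp_bounded[OF compact_Icc]] by (simp add: compact_eq_bounded_closed)
  ultimately show ?thesis unfolding test_function_def using assms(1-3) by auto
qed

lemma interval_test_functionE:
  fixes T :: real
  assumes "test_function {0<..<T} \<phi>" "0 < T"
  obtains a b where "0 < a" "b < T" "a \<le> b" "\<And>x. x \<notin> {a..b} \<Longrightarrow> \<phi> x = 0"
proof (cases "closure {x. \<phi> x \<noteq> 0} = {}")
  case True
  then have "\<phi> x = 0" for x using closure_subset by blast
  then show ?thesis using that[of "T/2" "T/2"] assms(2) by auto
next
  case False
  let ?S = "closure {x. \<phi> x \<noteq> 0}"
  have S: "compact ?S" "?S \<subseteq> {0<..<T}" using assms(1) by (auto simp: test_function_def)
  obtain a where a: "a \<in> ?S" "\<forall>x\<in>?S. a \<le> x" using compact_attains_inf[OF S(1) False] by blast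
  obtain b where b: "b \<in> ?S" "\<forall>x\<in>?S. x \<le> b" using compact_attains_sup[OF S(1) False] by blast
  have "\<phi> x = 0" if "x \<notin> {a..b}" for x
  proof (rule ccontr)
    assume "\<phi> x \<noteq> 0"
    then have "x \<in> ?S" by (intro subsetD[OF closure_subset]) simp
    then show False using that a(2) b(2) by simp
  qed
  moreover have "0 < a" "b < T" "a \<le> b" using a b S(2) by auto
  ultimately show ?thesis using that by blast
qed

lemma test_function_lincomb:
  fixes T :: real
  assumes "test_function {0<..<T} \<phi>" "test_function {0<..<T} \<psi>" "0 < T"
  shows "test_function {0<..<T} (\<lambda>x. \<phi> x + c * \<psi> x)"
proof -
  obtain a b where ab: "0 < a" "b < T" "a \<le> b" "\<And>x. x \<notin> {a..b} \<Longrightarrow> \<phi> x = 0"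
    using interval_test_functionE[OF assms(1,3)] by blast
  obtain a' b' where ab': "0 < a'" "b' < T" "a' \<le> b'" "\<And>x. x \<notin> {a'..b'} \<Longrightarrow> \<psi> x = 0"
    using interval_test_functionE[OF assms(2,3)] by blast
  have "smooth (\<lambda>x. \<phi> x + c * \<psi> x)"
    using assms unfolding test_function_def by (auto intro!: smooth_add smooth_mult smooth_const)
  moreover have "\<phi> x + c * \<psi> x = 0" if "x \<notin> {min a a'..max b b'}" for x
  proof -
    have "x \<notin> {a..b}" "x \<notin> {a'..b'}" using that by auto
    then show ?thesis using ab(4) ab'(4) by simp
  qed
  moreover have "0 < min a a'" "max b b' < T" using ab ab' by auto
  ultimately show ?thesis by (intro interval_test_functionI)
qed

lemma test_function_smooth: "test_function U \<phi> \<Longrightarrow> smooth \<phi>"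
  by (simp add: test_function_def)

lemma test_function_outside:
  assumes "test_function U \<phi>" "x \<notin> U" shows "\<phi> x = 0"
proof (rule ccontr)
  assume "\<phi> x \<noteq> 0"
  then have "x \<in> closure {x. \<phi> x \<noteq> 0}" using closure_subset[of "{x. \<phi> x \<noteq> 0}"] by auto
  then show False using assms by (auto simp: test_function_def)
qed

lemma test_function_deriv:
  assumes "test_function {0<..<T} \<phi>" "0 < T"
  shows "test_function {0<..<T} (deriv \<phi>)"
proof -
  obtain a b where ab: "0 < a" "b < T" "a \<le> b" "\<And>x. x \<notin> {a..b} \<Longrightarrow> \<phi> x = 0"
    using interval_test_functionE[OF assms] by blast
  show ?thesis
  proof (rule interval_test_functionI[OF _ ab(1,2)])
    show "smooth (deriv \<phi>)" using assms(1) by (simp add: smooth_deriv test_function_smooth)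
    fix x assume x: "x \<notin> {a..b}"
    have "((\<lambda>x. 0) has_real_derivative 0) (at x)" by simp
    then have "(\<phi> has_real_derivative 0) (at x)"
      by (rule has_field_derivative_transform_within_open[where S = "- {a..b}"]) (use x ab(4) in auto)
    then show "deriv \<phi> x = 0" by (rule DERIV_imp_deriv)
  qed
qed

text \<open>The primitive of \<open>\<psi>\<close> that vanishes at the left end is constant to the right of the support of \<open>\<psi>\<close>,
and this constant is the integral of \<open>\<psi>\<close>.\<close>

lemma test_function_primitive:
  assumes \<psi>: "test_function {0<..<T} \<psi>" and T: "0 < T" and m: "(LBINT x:{0<..<T}. \<psi> x) = 0"
  obtains \<phi> where "test_function {0<..<T} \<phi>" "deriv \<phi> = \<psi>"
proof -
  obtain a b where ab: "0 < a" "b < T" "a \<le> b" "\<And>x. x \<notin> {a..b} \<Longrightarrow> \<psi> x = 0"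
    using interval_test_functionE[OF \<psi> T] by blast
  have c: "continuous_on S \<psi>" for S using smooth_continuous[OF test_function_smooth[OF \<psi>]] .
  obtain F where F0: "\<And>x. (F has_real_derivative \<psi> x) (at x)"
    using einterval_antiderivative[of "-\<infinity>" "\<infinity>" \<psi>] c[of UNIV]
    by (auto simp: has_real_derivative_iff_has_vector_derivative continuous_on_eq_continuous_at)
  define \<phi> where "\<phi> = (\<lambda>x. F x - F 0)"
  have D: "(\<phi> has_real_derivative \<psi> x) (at x)" for x
    unfolding \<phi>_def by (auto intro!: derivative_eq_intros F0)
  have const: "\<phi> x = \<phi> y" if "x \<le> y" "\<And>z. x < z \<Longrightarrow> z < y \<Longrightarrow> \<psi> z = 0" for x y
  proof (cases "x = y")
    case False
    then have "x < y" using that by simp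
    then obtain z where "x < z" "z < y" "\<phi> y - \<phi> x = (y - x) * \<psi> z" using MVT2[of x y \<phi> \<psi>] D by blast
    then show ?thesis using that by simp
  qed simp
  have "(LBINT x:{0<..<T}. \<psi> x) = \<phi> T - \<phi> 0"
    by (rule set_integral_FTC) (use T c D in \<open>auto intro: DERIV_subset\<close>)
  then have z: "\<phi> T = 0" "\<phi> 0 = 0" using m by (auto simp: \<phi>_def)
  have "\<phi> x = 0" if "x \<notin> {a..b}" for x
  proof (cases "x < a")
    case True
    have "\<phi> (min x 0) = \<phi> x" "\<phi> (min x 0) = \<phi> 0" by (rule const; use True ab in auto)+
    then show ?thesis using z by simp
  next
    case False
    then have "x > b" using that by auto
    have "\<phi> x = \<phi> (max x T)" "\<phi> T = \<phi> (max x T)" by (rule const; use \<open>x > b\<close> ab in auto)+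
    then show ?thesis using z by simp
  qed
  then have "test_function {0<..<T} \<phi>"
    using smooth_antiderivative[OF test_function_smooth[OF \<psi>] D] ab by (auto intro: interval_test_functionI)
  moreover have "deriv \<phi> = \<psi>" using D by (intro ext DERIV_imp_deriv)
  ultimately show ?thesis by (rule that)
qed

text \<open>A test function supported in \<open>[a, b]\<close>.  As \<open>k\<close> grows it tends to the indicator function of
\<open>(a, b)\<close>, and it stays between \<open>0\<close> and \<open>1\<close>.\<close>

definition interval_bump :: "real \<Rightarrow> real \<Rightarrow> real \<Rightarrow> real \<Rightarrow> real" where
  "interval_bump k a b x = exp_bump 1 (k * (x - a)) * exp_bump 1 (k * (b - x))"

lemma exp_bump_1_bounds: "0 \<le> exp_bump 1 x" "exp_bump 1 x \<le> 1"
  by (auto simp: exp_bump_def)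

lemma interval_bump_bounds: "0 \<le> interval_bump k a b x" "interval_bump k a b x \<le> 1"
  unfolding interval_bump_def by (auto intro!: mult_le_one mult_nonneg_nonneg exp_bump_1_bounds)

lemma smooth_interval_bump: "smooth (interval_bump k a b)"
proof -
  have "smooth (\<lambda>x. exp_bump 1 (k * x + (- (k * a))) * exp_bump 1 ((- k) * x + k * b))"
    by (intro smooth_mult smooth_compose_affine smooth_exp_bump bounded_linear_mult_right)
  moreover have "(\<lambda>x. exp_bump 1 (k * x + (- (k * a))) * exp_bump 1 ((- k) * x + k * b)) = interval_bump k a b"
    by (auto simp: interval_bump_def algebra_simps)
  ultimately show ?thesis by simp
qed

lemma interval_bump_eq_0: "0 \<le> k \<Longrightarrow> x \<notin> {a<..<b} \<Longrightarrow> interval_bump k a b x = 0"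
  by (auto simp: interval_bump_def exp_bump_def zero_less_mult_iff)

lemma test_function_interval_bump:
  assumes "0 \<le> k" "0 < a" "b < T"
  shows "test_function {0<..<T} (interval_bump k a b)"
  by (rule interval_test_functionI[OF smooth_interval_bump assms(2,3)])
     (use interval_bump_eq_0[OF assms(1)] in auto)

lemma interval_bump_tendsto_indicator:
  "(\<lambda>n. interval_bump (real n) a b x) \<longlonglongrightarrow> indicator {a<..<b} x"
proof (cases "x \<in> {a<..<b}")
  case True
  have L: "(\<lambda>n. exp_bump 1 (real n * c)) \<longlonglongrightarrow> 1" if "c > 0" for c
  proof -
    have "(\<lambda>n. exp (- ((1 / c) * (1 / real n)))) \<longlonglongrightarrow> exp (- ((1 / c) * 0))"
      by (intro tendsto_intros lim_1_over_n)
    then have "(\<lambda>n. exp (- (1 / (real n * c)))) \<longlonglongrightarrow> 1" by (simp add: mult.commute)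
    then show ?thesis
      by (rule Lim_transform_eventually)
         (use that in \<open>auto intro!: eventually_mono[OF eventually_gt_at_top[of 0]] simp: exp_bump_def\<close>)
  qed
  show ?thesis unfolding interval_bump_def using tendsto_mult[OF L[of "x - a"] L[of "b - x"]] True by simp
next
  case False
  then show ?thesis by (simp add: interval_bump_eq_0)
qed

lemma set_integrable_mult_smooth:
  fixes f :: "real \<Rightarrow> real"
  assumes "set_integrable lborel {0<..<T} f" "smooth \<phi>"
  shows "set_integrable lborel {0<..<T} (\<lambda>x. f x * \<phi> x)"
  by (rule set_integrable_mult_continuous[OF assms(1) smooth_continuous[OF assms(2)]])

text \<open>Dominated convergence along the bumps that approximate the indicator function of \<open>(a, b)\<close>.\<close>

lemma zero_distribution_imp_integral_eq_0:
  fixes f :: "real \<Rightarrow> real"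
  assumes f: "set_integrable lborel {0<..<T} f"
    and z: "\<And>\<phi>. test_function {0<..<T} \<phi> \<Longrightarrow> (LBINT x:{0<..<T}. f x * \<phi> x) = 0"
    and ab: "0 < a" "b < T"
  shows "(LBINT x:{a<..<b}. f x) = 0"
proof -
  let ?g = "\<lambda>n x. indicator {0<..<T} x *\<^sub>R (f x * interval_bump (real n) a b x)"
  have "(\<lambda>n. LINT x|lborel. ?g n x) \<longlonglongrightarrow> (LINT x|lborel. indicator {a<..<b} x *\<^sub>R f x)"
  proof (rule integral_dominated_convergence[where w = "\<lambda>x. \<bar>indicator {0<..<T} x *\<^sub>R f x\<bar>"])
    show "(\<lambda>x. indicator {a<..<b} x *\<^sub>R f x) \<in> borel_measurable lborel"
    proof -
      have "set_integrable lborel {a<..<b} f" by (rule set_integrable_subset[OF f]) (use ab in auto)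
      then show ?thesis by (rule borel_measurable_integrable[OF iffD1[OF meta_eq_to_obj_eq[OF set_integrable_def]]])
    qed
    show "?g n \<in> borel_measurable lborel" for n
      using set_integrable_imp_measurable[OF set_integrable_mult_smooth[OF f smooth_interval_bump]]
      by (simp add: set_borel_measurable_def)
    show "integrable lborel (\<lambda>x. \<bar>indicator {0<..<T} x *\<^sub>R f x\<bar>)" using f unfolding set_integrable_def by auto
    show "AE x in lborel. norm (?g n x) \<le> \<bar>indicator {0<..<T} x *\<^sub>R f x\<bar>" for n
    proof (rule AE_I2)
      fix x
      have "\<bar>f x\<bar> * \<bar>interval_bump (real n) a b x\<bar> \<le> \<bar>f x\<bar> * 1"
        using interval_bump_bounds by (intro mult_left_mono) (auto simp: abs_le_iff intro: order_trans[OF _ interval_bump_bounds(1)])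
      then show "norm (?g n x) \<le> \<bar>indicator {0<..<T} x *\<^sub>R f x\<bar>" by (auto simp: indicator_def abs_mult)
    qed
    show "AE x in lborel. (\<lambda>n. ?g n x) \<longlonglongrightarrow> indicator {a<..<b} x *\<^sub>R f x"
    proof (rule AE_I2)
      fix x
      have "(\<lambda>n. ?g n x) \<longlonglongrightarrow> indicator {0<..<T} x *\<^sub>R (f x * indicator {a<..<b} x)"
        by (intro tendsto_scaleR tendsto_mult tendsto_const interval_bump_tendsto_indicator)
      moreover have "indicator {0<..<T} x *\<^sub>R (f x * indicator {a<..<b} x) = indicator {a<..<b} x *\<^sub>R f x"
        using ab by (auto simp: indicator_def)
      ultimately show "(\<lambda>n. ?g n x) \<longlonglongrightarrow> indicator {a<..<b} x *\<^sub>R f x" by (simp only:)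
    qed
  qed
  moreover have "(LINT x|lborel. ?g n x) = 0" for n
    using z[OF test_function_interval_bump[of "real n", OF _ ab]] by (simp add: set_lebesgue_integral_def)
  ultimately show ?thesis by (simp add: set_lebesgue_integral_def LIMSEQ_const_iff)
qed

text \<open>The positive and the negative part of \<open>f\<close> are densities of two finite measures that agree on all
half lines, hence are equal.\<close>

lemma integrals_eq_0_imp_AE_eq_0:
  fixes f :: "real \<Rightarrow> real"
  assumes f: "integrable lborel f" and z: "\<And>a. (LBINT x:{a<..}. f x) = 0"
  shows "AE x in lborel. f x = 0"
proof -
  have [measurable]: "f \<in> borel_measurable borel" using f by (auto dest: borel_measurable_integrable)
  let ?p = "\<lambda>x. max 0 (f x)" and ?n = "\<lambda>x. max 0 (- f x)"
  have i: "integrable lborel ?p" "integrable lborel ?n" using f by auto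
  have e: "emeasure (density lborel (\<lambda>x. ennreal (g x))) {a<..} = ennreal (LBINT x:{a<..}. g x)"
    if "integrable lborel g" "\<And>x. 0 \<le> g x" for g :: "real \<Rightarrow> real" and a
  proof -
    have [measurable]: "g \<in> borel_measurable borel" using that(1) by (auto dest: borel_measurable_integrable)
    have "set_integrable lborel {a<..} g"
      using that(1) unfolding set_integrable_def by (intro integrable_mult_indicator) auto
    have "emeasure (density lborel (\<lambda>x. ennreal (g x))) {a<..} = (\<integral>\<^sup>+x. ennreal (g x) * indicator {a<..} x \<partial>lborel)"
      by (rule emeasure_density) auto
    also have "\<dots> = (\<integral>\<^sup>+x. ennreal (indicator {a<..} x *\<^sub>R g x) \<partial>lborel)"
      by (intro nn_integral_cong) (auto simp: indicator_def)
    also have "\<dots> = ennreal (LBINT x:{a<..}. g x)"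
      unfolding set_lebesgue_integral_def
      by (rule nn_integral_eq_integral)
         (use \<open>set_integrable lborel {a<..} g\<close> that(2) in \<open>auto simp: set_integrable_def\<close>)
    finally show ?thesis .
  qed
  have s: "set_integrable lborel {a<..} g" if "integrable lborel g" for g :: "real \<Rightarrow> real" and a
    using that unfolding set_integrable_def by (intro integrable_mult_indicator) auto
  have pn: "(LBINT x:{a<..}. ?p x) = (LBINT x:{a<..}. ?n x)" for a
  proof -
    have "(LBINT x:{a<..}. ?p x) - (LBINT x:{a<..}. ?n x) = (LBINT x:{a<..}. ?p x - ?n x)"
      using s[OF i(1)] s[OF i(2)] by (simp add: set_integral_diff)
    also have "(\<lambda>x. ?p x - ?n x) = f" by (auto simp: max_def)
    finally show ?thesis using z by simp
  qed
  have "density lborel (\<lambda>x. ennreal (?p x)) = density lborel (\<lambda>x. ennreal (?n x))"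
    by (rule measure_eqI_lessThan) (use e[OF i(1)] e[OF i(2)] pn in auto)
  then have "AE x in lborel. ennreal (?p x) = ennreal (?n x)"
    by (subst (asm) sigma_finite_measure.density_unique_iff[OF lborel.sigma_finite_measure_axioms]) auto
  then show ?thesis by (rule eventually_mono) (auto simp: max_def split: if_splits)
qed

text \<open>The primitive of \<open>f\<close> is constant inside the interval since \<open>f\<close> has mean zero on compact
subintervals, and by continuity up to the end points, where it is \<open>0\<close>.\<close>

lemma zero_distribution_imp_AE_eq_0:
  fixes f :: "real \<Rightarrow> real"
  assumes f: "set_integrable lborel {0<..<T} f" and T: "0 < T"
    and z: "\<And>\<phi>. test_function {0<..<T} \<phi> \<Longrightarrow> (LBINT x:{0<..<T}. f x * \<phi> x) = 0"
  shows "AE x\<in>{0<..<T} in lborel. f x = 0"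
proof -
  let ?F = "\<lambda>x. LBINT z:{0<..<x}. f z"
  have cont: "continuous_on {0..T} ?F" by (rule primitive_continuous[OF f])
  have c0: "?F x = ?F (T/2)" if x: "x \<in> {0<..<T}" for x
  proof -
    have "?F (max x (T/2)) = ?F (min x (T/2)) + (LBINT z:{min x (T/2)<..<max x (T/2)}. f z)"
      by (rule set_integral_split[OF set_integrable_subset[OF f]]) (use x T in auto)
    also have "(LBINT z:{min x (T/2)<..<max x (T/2)}. f z) = 0"
      by (rule zero_distribution_imp_integral_eq_0[OF f z]) (use x T in auto)
    finally show ?thesis by (auto simp: max_def min_def split: if_splits)
  qed
  have "?F x = ?F (T/2)" if "x \<in> {0..T}" for x
  proof -
    have "closure {0<..<T} = {0..T}" using T by (simp add: closure_greaterThanLessThan)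
    then show ?thesis
      using continuous_constant_on_closure[where S = "{0<..<T}" and f = ?F and a = "?F (T/2)" and x = x]
        cont c0 that by metis
  qed
  from this[of 0] this T have c: "?F x = ?F 0" if "x \<in> {0..T}" for x
    using that by (metis atLeastAtMost_iff order_refl less_imp_le)
  have "?F 0 = 0" by (simp add: set_lebesgue_integral_def)
  then have c: "?F x = 0" if "x \<in> {0..T}" for x using c[OF that] by simp
  have "AE x in lborel. indicator {0<..<T} x *\<^sub>R f x = 0"
  proof (rule integrals_eq_0_imp_AE_eq_0)
    show "integrable lborel (\<lambda>x. indicator {0<..<T} x *\<^sub>R f x)" using f by (simp add: set_integrable_def)
    fix a
    have "(LBINT x:{a<..}. indicator {0<..<T} x *\<^sub>R f x) = (LBINT x:{max 0 a<..<T}. f x)"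
      unfolding set_lebesgue_integral_def
      by (rule Bochner_Integration.integral_cong) (auto simp: indicator_def)
    also have "\<dots> = 0"
    proof (cases "max 0 a < T")
      case True
      have "?F T = ?F (max 0 a) + (LBINT x:{max 0 a<..<T}. f x)"
        by (rule set_integral_split[OF f]) (use True in auto)
      then show ?thesis using c[of T] c[of "max 0 a"] T True by auto
    next
      case False
      then have "{max 0 a<..<T} = {}" by auto
      then show ?thesis by (simp only:) (simp add: set_lebesgue_integral_def)
    qed
    finally show "(LBINT x:{a<..}. indicator {0<..<T} x *\<^sub>R f x) = 0" .
  qed
  then show ?thesis by (rule eventually_mono) auto
qed


lemma interval_emeasure_finite: "emeasure lborel {a<..<b::real} < \<infinity>"
  by (cases "a \<le> b") auto

lemma test_function_integral_deriv_primitive: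
  fixes p :: "real \<Rightarrow> real"
  assumes p: "set_integrable lborel {0<..<T} p" and T: "0 < T" and \<phi>: "test_function {0<..<T} \<phi>"
  shows "(LBINT x:{0<..<T}. (LBINT z:{0<..<x}. p z) * deriv \<phi> x) = - (LBINT x:{0<..<T}. p x * \<phi> x)"
proof -
  note sm = test_function_smooth[OF \<phi>]
  have c: "continuous_on S (deriv \<phi>)" for S by (rule smooth_continuous[OF smooth_deriv[OF sm]])
  have z: "\<phi> 0 = 0" "\<phi> T = 0" using test_function_outside[OF \<phi>] by auto
  have Q: "(LBINT z:{0<..<x}. deriv \<phi> z) = \<phi> x" if "0 \<le> x" for x
  proof -
    have "(LBINT z:{0<..<x}. deriv \<phi> z) = \<phi> x - \<phi> 0"
      by (rule set_integral_FTC) (use that c smooth_has_real_derivative[OF sm] in \<open>auto intro: DERIV_subset\<close>)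
    then show ?thesis by (simp add: z)
  qed
  have "(LBINT z:{0<..<T}. p z) * (LBINT z:{0<..<T}. deriv \<phi> z)
    = (LBINT x:{0<..<T}. p x * (LBINT z:{0<..<x}. deriv \<phi> z))
      + (LBINT x:{0<..<T}. deriv \<phi> x * (LBINT z:{0<..<x}. p z))"
    by (rule primitive_integration_by_parts[OF p set_integrable_continuous[OF c]])
  moreover have "(LBINT x:{0<..<T}. p x * (LBINT z:{0<..<x}. deriv \<phi> z)) = (LBINT x:{0<..<T}. p x * \<phi> x)"
    by (rule set_lebesgue_integral_cong) (auto simp: Q)
  ultimately show ?thesis using Q[of T] T z by (simp add: mult.commute)
qed

lemma ex_normalized_test_function:
  fixes T :: real
  assumes "0 < T"
  obtains \<psi> where "test_function {0<..<T} \<psi>" "(LBINT x:{0<..<T}. \<psi> x) = 1"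
proof -
  have "\<exists>\<phi>. test_function {0<..<T} \<phi> \<and> (LBINT x:{0<..<T}. \<phi> x) \<noteq> 0"
  proof (rule ccontr)
    assume "\<not> ?thesis"
    then have "(LBINT x:{0<..<T}. 1 * \<phi> x) = 0" if "test_function {0<..<T} \<phi>" for \<phi>
      using that by simp
    from zero_distribution_imp_AE_eq_0[OF set_integrable_continuous[OF continuous_on_const] assms this]
    have "AE x in lborel. x \<notin> {0<..<T}" by simp
    then have "{0<..<T} \<in> null_sets lborel" by (subst AE_iff_null_sets) auto
    then show False using assms by (simp add: null_sets_def)
  qed
  then obtain \<phi> where \<phi>: "test_function {0<..<T} \<phi>" "(LBINT x:{0<..<T}. \<phi> x) \<noteq> 0" by blast
  let ?m = "LBINT x:{0<..<T}. \<phi> x"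
  \<comment> \<open>The multiple \<open>\<phi> / m\<close>, written as the combination \<open>\<phi> + c \<phi>\<close>.\<close>
  have "test_function {0<..<T} (\<lambda>x. \<phi> x + (1 / ?m - 1) * \<phi> x)"
    by (rule test_function_lincomb[OF \<phi>(1) \<phi>(1) assms])
  moreover have "(LBINT x:{0<..<T}. \<phi> x + (1 / ?m - 1) * \<phi> x) = (LBINT x:{0<..<T}. (1 / ?m) * \<phi> x)"
    by (simp add: algebra_simps)
  moreover have "\<dots> = 1" using \<phi>(2) by (simp only: set_integral_mult_right) simp
  ultimately show ?thesis using that by simp
qed

text \<open>The algebraic core of the lemma of du Bois-Reymond: if \<open>\<psi>0\<close> has integral \<open>1\<close> and \<open>\<psi>\<close> has integral
\<open>m\<close>, then \<open>\<psi> - m \<psi>0\<close> is the derivative of a test function, so \<open>A \<psi> = m A \<psi>0\<close>.\<close>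

lemma functional_annihilating_derivatives:
  fixes A :: "(real \<Rightarrow> real) \<Rightarrow> real"
  assumes T: "0 < T"
    and lin: "\<And>\<phi> \<psi> c. test_function {0<..<T} \<phi> \<Longrightarrow> test_function {0<..<T} \<psi> \<Longrightarrow>
      A (\<lambda>x. \<phi> x + c * \<psi> x) = A \<phi> + c * A \<psi>"
    and zero: "\<And>\<phi>. test_function {0<..<T} \<phi> \<Longrightarrow> A (deriv \<phi>) = 0"
  obtains e where "\<And>\<psi>. test_function {0<..<T} \<psi> \<Longrightarrow> A \<psi> = e * (LBINT x:{0<..<T}. \<psi> x)"
proof -
  obtain \<psi>0 where \<psi>0: "test_function {0<..<T} \<psi>0" "(LBINT x:{0<..<T}. \<psi>0 x) = 1"
    using ex_normalized_test_function[OF T] by blast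
  have "A \<psi> = A \<psi>0 * (LBINT x:{0<..<T}. \<psi> x)" if \<psi>: "test_function {0<..<T} \<psi>" for \<psi>
  proof -
    let ?m = "LBINT x:{0<..<T}. \<psi> x"
    have i: "set_integrable lborel {0<..<T} \<psi>" "set_integrable lborel {0<..<T} \<psi>0"
      using smooth_continuous test_function_smooth \<psi> \<psi>0(1) by (auto intro!: set_integrable_continuous)
    have t: "test_function {0<..<T} (\<lambda>x. \<psi> x + (- ?m) * \<psi>0 x)"
      by (rule test_function_lincomb[OF \<psi> \<psi>0(1) T])
    have "(LBINT x:{0<..<T}. \<psi> x + (- ?m) * \<psi>0 x) = 0"
      using set_integral_add(2)[OF i(1) set_integrable_mult_right[where a = "- ?m", OF i(2)]] \<psi>0(2)
      by (simp only: set_integral_mult_right)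
    from test_function_primitive[OF t T this] obtain \<phi>
      where "test_function {0<..<T} \<phi>" "deriv \<phi> = (\<lambda>x. \<psi> x + (- ?m) * \<psi>0 x)" by blast
    then have "A \<psi> + (- ?m) * A \<psi>0 = 0" using zero lin[OF \<psi> \<psi>0(1)] by metis
    then show ?thesis by (simp add: mult.commute)
  qed
  then show ?thesis using that by blast
qed

text \<open>The difference of \<open>f\<close> and the primitive of \<open>g\<close> annihilates derivatives of test functions, so it is a
constant distribution and therefore a constant function.\<close>

lemma du_Bois_Reymond:
  fixes f g :: "real \<Rightarrow> real"
  assumes T: "0 < T" and f: "set_integrable lborel {0<..<T} f" and g: "set_integrable lborel {0<..<T} g"
    and w: "\<And>\<phi>. test_function {0<..<T} \<phi> \<Longrightarrow>
      (LBINT x:{0<..<T}. f x * deriv \<phi> x) = - (LBINT x:{0<..<T}. g x * \<phi> x)"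
  obtains c where "AE x\<in>{0<..<T} in lborel. f x = c + (LBINT z:{0<..<x}. g z)"
proof -
  define F where "F = (\<lambda>x. f x - (LBINT z:{0<..<x}. g z))"
  have G: "set_integrable lborel {0<..<T} (\<lambda>x. LBINT z:{0<..<x}. g z)"
    by (rule set_integrable_continuous[OF primitive_continuous[OF g]])
  have F: "set_integrable lborel {0<..<T} F" unfolding F_def by (rule set_integral_diff(1)[OF f G])
  obtain c where c: "\<And>\<psi>. test_function {0<..<T} \<psi> \<Longrightarrow>
      (LBINT x:{0<..<T}. F x * \<psi> x) = c * (LBINT x:{0<..<T}. \<psi> x)"
  proof (rule functional_annihilating_derivatives[OF T, where A = "\<lambda>\<psi>. LBINT x:{0<..<T}. F x * \<psi> x"])
    fix \<phi> \<psi> c assume "test_function {0<..<T} \<phi>" "test_function {0<..<T} \<psi>"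
    then have i: "set_integrable lborel {0<..<T} (\<lambda>x. F x * \<phi> x)" "set_integrable lborel {0<..<T} (\<lambda>x. F x * \<psi> x)"
      using set_integrable_mult_smooth[OF F] test_function_smooth by blast+
    have "(LBINT x:{0<..<T}. F x * (\<phi> x + c * \<psi> x)) = (LBINT x:{0<..<T}. F x * \<phi> x + c * (F x * \<psi> x))"
      by (simp add: algebra_simps)
    also have "\<dots> = (LBINT x:{0<..<T}. F x * \<phi> x) + c * (LBINT x:{0<..<T}. F x * \<psi> x)"
      using i by (subst set_integral_add(2)) auto
    finally show "(LBINT x:{0<..<T}. F x * (\<phi> x + c * \<psi> x))
      = (LBINT x:{0<..<T}. F x * \<phi> x) + c * (LBINT x:{0<..<T}. F x * \<psi> x)" .
  next
    fix \<phi> assume \<phi>: "test_function {0<..<T} \<phi>"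
    note sm = smooth_deriv[OF test_function_smooth[OF \<phi>]]
    have "(LBINT x:{0<..<T}. F x * deriv \<phi> x)
      = (LBINT x:{0<..<T}. f x * deriv \<phi> x) - (LBINT x:{0<..<T}. (LBINT z:{0<..<x}. g z) * deriv \<phi> x)"
      unfolding F_def left_diff_distrib
      by (rule set_integral_diff(2)[OF set_integrable_mult_smooth[OF f sm] set_integrable_mult_smooth[OF G sm]])
    then show "(LBINT x:{0<..<T}. F x * deriv \<phi> x) = 0"
      using w[OF \<phi>] test_function_integral_deriv_primitive[OF g T \<phi>] by simp
  qed blast
  have "AE x\<in>{0<..<T} in lborel. F x - c = 0"
  proof (rule zero_distribution_imp_AE_eq_0[OF _ T])
    show "set_integrable lborel {0<..<T} (\<lambda>x. F x - c)"
      by (intro set_integral_diff(1)[OF F] set_integrable_continuous continuous_on_const)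
    fix \<psi> assume \<psi>: "test_function {0<..<T} \<psi>"
    have "set_integrable lborel {0<..<T} \<psi>"
      by (intro set_integrable_continuous smooth_continuous test_function_smooth[OF \<psi>])
    then have "(LBINT x:{0<..<T}. (F x - c) * \<psi> x) = (LBINT x:{0<..<T}. F x * \<psi> x) - (LBINT x:{0<..<T}. c * \<psi> x)"
      unfolding left_diff_distrib
      by (intro set_integral_diff(2)[OF set_integrable_mult_smooth[OF F test_function_smooth[OF \<psi>]]]) simp
    then show "(LBINT x:{0<..<T}. (F x - c) * \<psi> x) = 0" using c[OF \<psi>] by simp
  qed
  then show ?thesis by (intro that[of c]) (auto simp: F_def algebra_simps elim: eventually_mono)
qed

text \<open>With \<open>G\<close> the primitive of \<open>g\<close>, the functional \<open>\<psi> \<mapsto> \<integral> G \<psi> + \<integral> f \<psi>'\<close> annihilates derivatives.  It is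
thus integration against a constant \<open>e\<close>, which says that \<open>f\<close> has the integrable weak derivative
\<open>G - e\<close>, and the first-order lemma applies.\<close>

lemma du_Bois_Reymond_second_order:
  fixes f g :: "real \<Rightarrow> real"
  assumes T: "0 < T" and f: "set_integrable lborel {0<..<T} f" and g: "set_integrable lborel {0<..<T} g"
    and w: "\<And>\<phi>. test_function {0<..<T} \<phi> \<Longrightarrow>
      (LBINT x:{0<..<T}. f x * deriv (deriv \<phi>) x) = (LBINT x:{0<..<T}. g x * \<phi> x)"
  obtains c e where "AE x\<in>{0<..<T} in lborel. f x = c + (LBINT z:{0<..<x}. e + (LBINT s:{0<..<z}. g s))"
proof -
  define G where "G = (\<lambda>x. LBINT z:{0<..<x}. g z)"
  have G: "set_integrable lborel {0<..<T} G"
    unfolding G_def by (rule set_integrable_continuous[OF primitive_continuous[OF g]])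
  let ?A = "\<lambda>\<psi>. (LBINT x:{0<..<T}. G x * \<psi> x) + (LBINT x:{0<..<T}. f x * deriv \<psi> x)"
  obtain e where e: "\<And>\<psi>. test_function {0<..<T} \<psi> \<Longrightarrow> ?A \<psi> = e * (LBINT x:{0<..<T}. \<psi> x)"
  proof (rule functional_annihilating_derivatives[OF T, where A = ?A])
    fix \<phi> \<psi> c assume t: "test_function {0<..<T} \<phi>" "test_function {0<..<T} \<psi>"
    then have sm: "smooth \<phi>" "smooth \<psi>" by (auto dest: test_function_smooth)
    have d: "deriv (\<lambda>x. \<phi> x + c * \<psi> x) x = deriv \<phi> x + c * deriv \<psi> x" for x
      by (rule DERIV_imp_deriv)
         (auto intro!: derivative_eq_intros smooth_has_real_derivative[OF sm(1)] smooth_has_real_derivative[OF sm(2)])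
    have 1: "(LBINT x:{0<..<T}. G x * \<phi> x + c * (G x * \<psi> x))
      = (LBINT x:{0<..<T}. G x * \<phi> x) + c * (LBINT x:{0<..<T}. G x * \<psi> x)"
      using set_integrable_mult_smooth[OF G] sm by (subst set_integral_add(2)) auto
    have 2: "(LBINT x:{0<..<T}. f x * deriv \<phi> x + c * (f x * deriv \<psi> x))
      = (LBINT x:{0<..<T}. f x * deriv \<phi> x) + c * (LBINT x:{0<..<T}. f x * deriv \<psi> x)"
      using set_integrable_mult_smooth[OF f] sm[THEN smooth_deriv] by (subst set_integral_add(2)) auto
    show "?A (\<lambda>x. \<phi> x + c * \<psi> x) = ?A \<phi> + c * ?A \<psi>"
      using 1 2 by (simp add: d algebra_simps)
  next
    fix \<phi> assume \<phi>: "test_function {0<..<T} \<phi>"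
    show "?A (deriv \<phi>) = 0"
      using w[OF \<phi>] test_function_integral_deriv_primitive[OF g T \<phi>] by (simp add: G_def)
  qed blast
  have eG: "set_integrable lborel {0<..<T} (\<lambda>x. - e + G x)"
    by (intro set_integral_add(1)[OF _ G] set_integrable_continuous continuous_on_const)
  have "(LBINT x:{0<..<T}. f x * deriv \<psi> x) = - (LBINT x:{0<..<T}. (- e + G x) * \<psi> x)"
    if \<psi>: "test_function {0<..<T} \<psi>" for \<psi>
  proof -
    have "set_integrable lborel {0<..<T} \<psi>"
      by (intro set_integrable_continuous smooth_continuous test_function_smooth[OF \<psi>])
    then have "(LBINT x:{0<..<T}. (- e) * \<psi> x + G x * \<psi> x)
      = (LBINT x:{0<..<T}. (- e) * \<psi> x) + (LBINT x:{0<..<T}. G x * \<psi> x)"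
      by (intro set_integral_add(2) set_integrable_mult_smooth[OF G test_function_smooth[OF \<psi>]]
          set_integrable_mult_right[where a = "- e"])
    moreover have "(LBINT x:{0<..<T}. (- e) * \<psi> x) = - (e * (LBINT x:{0<..<T}. \<psi> x))"
      using set_integral_mult_right[of lborel "{0<..<T}" "- e" \<psi>] by simp
    ultimately show ?thesis using e[OF \<psi>] unfolding distrib_right by linarith
  qed
  from du_Bois_Reymond[OF T f eG this] obtain c
    where "AE x\<in>{0<..<T} in lborel. f x = c + (LBINT z:{0<..<x}. - e + G z)" by blast
  then show ?thesis by (intro that[of c "- e"]) (simp add: G_def)
qed

lemma AE_eq_imp_eq_continuous:
  fixes f g :: "real \<Rightarrow> real"
  assumes ab: "a < b" and f: "continuous_on {a..b} f" and g: "continuous_on {a..b} g"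
    and e: "AE x\<in>{a<..<b} in lborel. f x = g x"
    and x: "x \<in> {a..b}"
  shows "f x = g x"
proof -
  let ?h = "\<lambda>x. f x - g x"
  have h: "continuous_on {a..b} ?h" using f g by (intro continuous_intros)
  have "?h y = 0" if y: "y \<in> {a<..<b}" for y
  proof (rule ccontr)
    assume "?h y \<noteq> 0"
    let ?S = "?h -` (- {0}) \<inter> {a<..<b}"
    have "open ?S"
      using continuous_open_preimage[of "{a<..<b}" ?h "- {0}"] continuous_on_subset[OF h, of "{a<..<b}"]
        open_Compl[OF closed_singleton[of "0::real"]]
      by (simp add: Int_commute greaterThanLessThan_subseteq_atLeastAtMost_iff)
    moreover have "?S \<noteq> {}" using y \<open>?h y \<noteq> 0\<close> by auto
    moreover have "AE x in lborel. x \<notin> ?S" using e by (rule eventually_mono) auto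
    then have "?S \<in> null_sets lborel" using \<open>open ?S\<close> by (subst AE_iff_null_sets) auto
    then have "negligible ?S" by (simp add: negligible_iff_null_sets null_sets_completionI)
    ultimately show False using open_not_negligible by blast
  qed
  moreover have "closure {a<..<b} = {a..b}" using ab by (simp add: closure_greaterThanLessThan)
  ultimately have "?h x = 0"
    using continuous_constant_on_closure[where S = "{a<..<b}" and f = ?h and a = 0 and x = x] h x by metis
  then show ?thesis by simp
qed

section \<open>Weak derivatives on an interval\<close>

lemma L2_deriv_spec:
  assumes "has_L2_deriv U bs f"
  shows "L2 U (L2_deriv U bs f)" "has_weak_deriv U bs f (L2_deriv U bs f)"
  using someI_ex[OF assms[unfolded has_L2_deriv_def]] unfolding L2_deriv_def by auto

lemma L2_interval_integrable:
  fixes f :: "real \<Rightarrow> real"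
  shows "L2 {a<..<b} f \<Longrightarrow> set_integrable lborel {a<..<b} f"
  by (rule L2_imp_integrable) (use interval_emeasure_finite in auto)

lemma L1_loc_of_integrable:
  fixes f :: "real \<Rightarrow> real"
  assumes "set_integrable lborel U f" shows "L1_loc U f"
  unfolding L1_loc_def using assms by (auto intro!: set_integrable_subset[OF assms] borel_compact)

lemma partials_real:
  fixes \<phi> :: "real \<Rightarrow> real"
  assumes "smooth \<phi>"
  shows "partials [1] \<phi> = deriv \<phi>" "partials [1, 1] \<phi> = deriv (deriv \<phi>)"
  using smooth_partial_real[OF assms] smooth_partial_real[OF smooth_deriv[OF assms]] by simp_all

lemma weak_deriv_D:
  fixes f g :: "real \<Rightarrow> real"
  assumes "has_weak_deriv {0<..<T} [1] f g" "test_function {0<..<T} \<phi>"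
  shows "(LBINT x:{0<..<T}. f x * deriv \<phi> x) = - (LBINT x:{0<..<T}. g x * \<phi> x)"
  using assms unfolding has_weak_deriv_def
  by (auto simp del: partials.simps simp: partials_real[OF test_function_smooth[OF assms(2)]] dest!: spec[of _ \<phi>])

lemma weak_deriv_second_D:
  fixes f g :: "real \<Rightarrow> real"
  assumes "has_weak_deriv {0<..<T} [1, 1] f g" "test_function {0<..<T} \<phi>"
  shows "(LBINT x:{0<..<T}. f x * deriv (deriv \<phi>) x) = (LBINT x:{0<..<T}. g x * \<phi> x)"
  using assms unfolding has_weak_deriv_def
  by (auto simp del: partials.simps simp: partials_real[OF test_function_smooth[OF assms(2)]] dest!: spec[of _ \<phi>])

lemma primitive_has_weak_deriv:
  fixes f g :: "real \<Rightarrow> real"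
  assumes T: "0 < T" and g: "set_integrable lborel {0<..<T} g"
    and f: "\<And>x. x \<in> {0<..<T} \<Longrightarrow> f x = c + (LBINT z:{0<..<x}. g z)"
  shows "has_weak_deriv {0<..<T} [1] f g"
proof -
  let ?G = "\<lambda>x. LBINT z:{0<..<x}. g z"
  have G: "set_integrable lborel {0<..<T} ?G"
    by (rule set_integrable_continuous[OF primitive_continuous[OF g]])
  have "set_integrable lborel {0<..<T} (\<lambda>x. c + ?G x)"
    by (intro set_integral_add(1)[OF _ G] set_integrable_continuous continuous_on_const)
  then have fi: "set_integrable lborel {0<..<T} f"
    using f by (subst set_integrable_cong[OF refl refl, where f' = "\<lambda>x. c + ?G x"]) auto
  have "(LBINT x:{0<..<T}. f x * deriv \<phi> x) = - (LBINT x:{0<..<T}. g x * \<phi> x)"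
    if \<phi>: "test_function {0<..<T} \<phi>" for \<phi>
  proof -
    note sm = test_function_smooth[OF \<phi>]
    have cd: "continuous_on S (deriv \<phi>)" for S by (rule smooth_continuous[OF smooth_deriv[OF sm]])
    have "(LBINT x:{0<..<T}. f x * deriv \<phi> x) = (LBINT x:{0<..<T}. c * deriv \<phi> x + ?G x * deriv \<phi> x)"
      by (rule set_lebesgue_integral_cong) (auto simp: f algebra_simps)
    also have "\<dots> = (LBINT x:{0<..<T}. c * deriv \<phi> x) + (LBINT x:{0<..<T}. ?G x * deriv \<phi> x)"
      by (intro set_integral_add(2) set_integrable_mult_smooth[OF G smooth_deriv[OF sm]]
          set_integrable_mult_right set_integrable_continuous cd)
    also have "(LBINT x:{0<..<T}. c * deriv \<phi> x) = c * (\<phi> T - \<phi> 0)"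
      using T cd smooth_has_real_derivative[OF sm] set_integral_FTC[of 0 T \<phi> "deriv \<phi>"]
      by (auto intro: DERIV_subset)
    finally show ?thesis
      using test_function_integral_deriv_primitive[OF g T \<phi>] test_function_outside[OF \<phi>] by simp
  qed
  then show ?thesis unfolding has_weak_deriv_def
    using L1_loc_of_integrable[OF fi] L1_loc_of_integrable[OF g] partials_real(1)[OF test_function_smooth]
    by (auto simp del: partials.simps)
qed

lemma weak_deriv_unique:
  fixes f g1 g2 :: "real \<Rightarrow> real"
  assumes T: "0 < T" and g1: "set_integrable lborel {0<..<T} g1" and g2: "set_integrable lborel {0<..<T} g2"
    and w: "has_weak_deriv {0<..<T} [1] f g1" "has_weak_deriv {0<..<T} [1] f g2"
  shows "AE x\<in>{0<..<T} in lborel. g1 x = g2 x"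
proof -
  have "AE x\<in>{0<..<T} in lborel. g1 x - g2 x = 0"
  proof (rule zero_distribution_imp_AE_eq_0[OF set_integral_diff(1)[OF g1 g2] T])
    fix \<phi> assume \<phi>: "test_function {0<..<T} \<phi>"
    note sm = test_function_smooth[OF \<phi>]
    show "(LBINT x:{0<..<T}. (g1 x - g2 x) * \<phi> x) = 0"
      unfolding left_diff_distrib
      using set_integral_diff(2)[OF set_integrable_mult_smooth[OF g1 sm] set_integrable_mult_smooth[OF g2 sm]]
        weak_deriv_D[OF w(1) \<phi>] weak_deriv_D[OF w(2) \<phi>] by simp
  qed
  then show ?thesis by (rule eventually_mono) auto
qed

lemma weak_deriv_continuous_primitive:
  fixes f g :: "real \<Rightarrow> real"
  assumes T: "0 < T" and f: "continuous_on {0..T} f" and g: "set_integrable lborel {0<..<T} g"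
    and w: "\<And>\<phi>. test_function {0<..<T} \<phi> \<Longrightarrow>
      (LBINT x:{0<..<T}. f x * deriv \<phi> x) = - (LBINT x:{0<..<T}. g x * \<phi> x)"
    and x: "x \<in> {0..T}"
  shows "f x = f 0 + (LBINT z:{0<..<x}. g z)"
proof -
  obtain c where c: "AE x\<in>{0<..<T} in lborel. f x = c + (LBINT z:{0<..<x}. g z)"
    using du_Bois_Reymond[OF T set_integrable_continuous[OF f] g w] by blast
  have cc: "continuous_on {0..T} (\<lambda>x. c + (LBINT z:{0<..<x}. g z))"
    by (intro continuous_intros primitive_continuous g)
  have *: "f y = c + (LBINT z:{0<..<y}. g z)" if "y \<in> {0..T}" for y
    by (rule AE_eq_imp_eq_continuous[OF T f cc c that])
  have "f 0 = c" using *[of 0] T by (simp add: set_lebesgue_integral_def)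
  then show ?thesis using *[OF x] by simp
qed

lemma V_space_D:
  assumes "u \<in> V_space \<Lambda>"
  shows "L2 {0<..<\<Lambda>} u" "continuous_on {0..\<Lambda>} u" "u \<Lambda> = 0"
    "L2 {0<..<\<Lambda>} (L2_deriv {0<..<\<Lambda>} [1] u)" "has_weak_deriv {0<..<\<Lambda>} [1] u (L2_deriv {0<..<\<Lambda>} [1] u)"
proof -
  have "has_L2_deriv {0<..<\<Lambda>} [1] u" using assms unfolding V_space_def sobolev_def by auto
  from L2_deriv_spec[OF this]
  show "L2 {0<..<\<Lambda>} (L2_deriv {0<..<\<Lambda>} [1] u)" "has_weak_deriv {0<..<\<Lambda>} [1] u (L2_deriv {0<..<\<Lambda>} [1] u)" .
qed (use assms in \<open>auto simp: V_space_def sobolev_def\<close>)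

lemma V_space_primitive:
  assumes u: "u \<in> V_space \<Lambda>" and \<Lambda>: "0 < \<Lambda>" and x: "x \<in> {0..\<Lambda>}"
  shows "u x = u 0 + (LBINT z:{0<..<x}. L2_deriv {0<..<\<Lambda>} [1] u z)"
  by (rule weak_deriv_continuous_primitive[OF \<Lambda> V_space_D(2)[OF u] L2_interval_integrable[OF V_space_D(4)[OF u]]
        weak_deriv_D[OF V_space_D(5)[OF u]] x])


section \<open>Piecewise affine functions\<close>

text \<open>The mesh points counted from \<open>0\<close>: \<open>mesh \<Lambda> N j\<close> is \<open>node \<Lambda> N (j + 1)\<close>.  Sums over the degrees of
freedom then run over \<open>j < N\<close>, and \<open>mesh \<Lambda> N N = \<Lambda>\<close> is the point where the functions vanish.\<close>

definition mesh :: "real \<Rightarrow> nat \<Rightarrow> nat \<Rightarrow> real" where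
  "mesh \<Lambda> N j = real j * (\<Lambda> / real N)"

lemma node_Suc: "node \<Lambda> N (Suc j) = mesh \<Lambda> N j"
  by (simp add: node_def mesh_def)

lemma mesh_0 [simp]: "mesh \<Lambda> N 0 = 0"
  by (simp add: mesh_def)

lemma mesh_N: "N \<ge> 1 \<Longrightarrow> mesh \<Lambda> N N = \<Lambda>"
  by (simp add: mesh_def)

lemma mesh_Suc: "mesh \<Lambda> N (Suc j) = mesh \<Lambda> N j + \<Lambda> / real N"
  by (simp add: mesh_def algebra_simps add_divide_distrib)

lemma mesh_mono: "0 < \<Lambda> \<Longrightarrow> i \<le> j \<Longrightarrow> mesh \<Lambda> N i \<le> mesh \<Lambda> N j"
  unfolding mesh_def by (intro mult_right_mono) auto

lemma mesh_bounds:
  assumes "0 < \<Lambda>" "N \<ge> 1" "j \<le> N"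
  shows "0 \<le> mesh \<Lambda> N j" "mesh \<Lambda> N j \<le> \<Lambda>"
  using mesh_mono[OF assms(1), of 0 j N] mesh_mono[OF assms(1,3), of N] mesh_N[OF assms(2)] by auto

lemma mesh_cell:
  assumes "0 < \<Lambda>" "N \<ge> 1" "y \<in> {0..\<Lambda>}"
  obtains j where "j < N" "y \<in> {mesh \<Lambda> N j..mesh \<Lambda> N (Suc j)}"
proof -
  have "\<exists>j<n. y \<in> {mesh \<Lambda> N j..mesh \<Lambda> N (Suc j)}" if "y \<le> mesh \<Lambda> N n" "n \<ge> 1" for n
    using that
  proof (induction n)
    case (Suc n)
    show ?case
    proof (cases "y \<le> mesh \<Lambda> N n \<and> n \<ge> 1")
      case True
      then show ?thesis using Suc.IH less_SucI by blast
    next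
      case False
      then have "mesh \<Lambda> N n \<le> y" using assms(3) by (cases "n = 0") auto
      then show ?thesis using Suc.prems by (intro exI[of _ n]) auto
    qed
  qed simp
  then show ?thesis using that assms mesh_N[OF assms(2)] by (metis atLeastAtMost_iff)
qed

lemma set_integral_mesh_split:
  fixes f :: "real \<Rightarrow> real"
  assumes "0 < \<Lambda>" "N \<ge> 1" and f: "set_integrable lborel {0<..<\<Lambda>} f"
  shows "(LBINT y:{0<..<\<Lambda>}. f y) = (\<Sum>j<N. LBINT y:{mesh \<Lambda> N j<..<mesh \<Lambda> N (Suc j)}. f y)"
proof -
  have "(LBINT y:{0<..<mesh \<Lambda> N n}. f y) = (\<Sum>j<n. LBINT y:{mesh \<Lambda> N j<..<mesh \<Lambda> N (Suc j)}. f y)"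
    if "n \<le> N" for n
    using that
  proof (induction n)
    case 0
    then show ?case by (simp add: set_lebesgue_integral_def)
  next
    case (Suc n)
    have "mesh \<Lambda> N (Suc n) \<le> \<Lambda>" using mesh_bounds[OF assms(1,2) Suc.prems] by simp
    then have i: "set_integrable lborel {0<..<mesh \<Lambda> N (Suc n)} f"
      by (intro set_integrable_subset[OF f]) auto
    have "(LBINT y:{0<..<mesh \<Lambda> N (Suc n)}. f y)
      = (LBINT y:{0<..<mesh \<Lambda> N n}. f y) + (LBINT y:{mesh \<Lambda> N n<..<mesh \<Lambda> N (Suc n)}. f y)"
      by (rule set_integral_split[OF i])
         (use mesh_mono[OF assms(1), of n "Suc n" N] mesh_mono[OF assms(1), of 0 n N] in auto)
    then show ?case using Suc by simp
  qed
  from this[of N] show ?thesis using mesh_N[OF assms(2)] by simp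
qed

lemma Vh_space_iff:
  "u \<in> Vh_space \<Lambda> N \<longleftrightarrow> continuous_on {0..\<Lambda>} u \<and>
     (\<forall>j<N. \<exists>a b. \<forall>y\<in>{mesh \<Lambda> N j..mesh \<Lambda> N (Suc j)}. u y = a * y + b) \<and> u \<Lambda> = 0"
proof -
  have "(\<forall>j\<in>{1..N}. P j) \<longleftrightarrow> (\<forall>j<N. P (Suc j))" for P
    by (metis Suc_le_eq atLeastAtMost_iff One_nat_def Suc_le_mono Suc_pred le_0_eq not_less_eq_eq zero_le gr0I)
  then show ?thesis by (simp add: Vh_space_def node_Suc)
qed

lemma Vh_space_cell:
  assumes "u \<in> Vh_space \<Lambda> N" "0 < \<Lambda>" "N \<ge> 1" "j < N" "y \<in> {mesh \<Lambda> N j..mesh \<Lambda> N (Suc j)}"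
  shows "u y = u (mesh \<Lambda> N j) + (u (mesh \<Lambda> N (Suc j)) - u (mesh \<Lambda> N j)) / (\<Lambda> / real N) * (y - mesh \<Lambda> N j)"
proof -
  obtain a b where ab: "\<forall>y\<in>{mesh \<Lambda> N j..mesh \<Lambda> N (Suc j)}. u y = a * y + b"
    using assms(1,4) unfolding Vh_space_iff by blast
  have h: "\<Lambda> / real N > 0" using assms by simp
  have "u y = a * y + b" "u (mesh \<Lambda> N j) = a * mesh \<Lambda> N j + b"
    "u (mesh \<Lambda> N (Suc j)) = a * mesh \<Lambda> N (Suc j) + b"
    using ab assms(5) h by (auto simp: mesh_Suc)
  moreover have "a * mesh \<Lambda> N (Suc j) + b - (a * mesh \<Lambda> N j + b) = a * (\<Lambda> / real N)"
    by (simp add: mesh_Suc algebra_simps)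
  ultimately have "u y = a * y + b" "u (mesh \<Lambda> N j) = a * mesh \<Lambda> N j + b"
    "(u (mesh \<Lambda> N (Suc j)) - u (mesh \<Lambda> N j)) / (\<Lambda> / real N) = a"
    using nonzero_mult_div_cancel_right[of "\<Lambda> / real N" a] assms(2,3) by simp_all
  then show ?thesis by (simp add: right_diff_distrib)
qed

lemma Vh_space_lincomb:
  assumes "u \<in> Vh_space \<Lambda> N" "v \<in> Vh_space \<Lambda> N"
  shows "(\<lambda>y. u y + c * v y) \<in> Vh_space \<Lambda> N"
  unfolding Vh_space_iff
proof (intro conjI allI impI)
  show "continuous_on {0..\<Lambda>} (\<lambda>y. u y + c * v y)"
    using assms unfolding Vh_space_iff by (intro continuous_intros) auto
  fix j assume "j < N"
  then obtain a b a' b' where "\<forall>y\<in>{mesh \<Lambda> N j..mesh \<Lambda> N (Suc j)}. u y = a * y + b"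
    "\<forall>y\<in>{mesh \<Lambda> N j..mesh \<Lambda> N (Suc j)}. v y = a' * y + b'"
    using assms unfolding Vh_space_iff by meson
  then have "\<forall>y\<in>{mesh \<Lambda> N j..mesh \<Lambda> N (Suc j)}. u y + c * v y = (a + c * a') * y + (b + c * b')"
    by (simp add: algebra_simps)
  then show "\<exists>a b. \<forall>y\<in>{mesh \<Lambda> N j..mesh \<Lambda> N (Suc j)}. u y + c * v y = a * y + b" by blast
qed (use assms in \<open>auto simp: Vh_space_iff\<close>)

lemma Vh_space_zero: "(\<lambda>y. 0) \<in> Vh_space \<Lambda> N"
  unfolding Vh_space_iff by (auto intro!: exI[of _ 0])

lemma Vh_space_sum:
  assumes "finite I" "\<And>i. i \<in> I \<Longrightarrow> \<phi> i \<in> Vh_space \<Lambda> N"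
  shows "(\<lambda>y. \<Sum>i\<in>I. v i * \<phi> i y) \<in> Vh_space \<Lambda> N"
  using assms
proof (induction I rule: finite_induct)
  case (insert i I)
  have "(\<lambda>y. (\<Sum>i\<in>I. v i * \<phi> i y) + v i * \<phi> i y) \<in> Vh_space \<Lambda> N"
    by (rule Vh_space_lincomb) (use insert in auto)
  then show ?case using insert by (simp add: add.commute)
qed (simp add: Vh_space_zero)

definition hat :: "real \<Rightarrow> nat \<Rightarrow> nat \<Rightarrow> real \<Rightarrow> real" where
  "hat \<Lambda> N i y = max 0 (1 - \<bar>y - mesh \<Lambda> N i\<bar> / (\<Lambda> / real N))"

lemma mesh_step:
  assumes "0 < \<Lambda>" "i < j" shows "mesh \<Lambda> N i + \<Lambda> / real N \<le> mesh \<Lambda> N j"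
  using mesh_mono[OF assms(1), of "Suc i" j N] assms(2) by (simp add: mesh_Suc)

lemma hat_eq_0:
  assumes "\<bar>y - mesh \<Lambda> N i\<bar> \<ge> \<Lambda> / real N" "0 < \<Lambda>" "N \<ge> 1"
  shows "hat \<Lambda> N i y = 0"
proof -
  have "\<Lambda> / real N > 0" using assms by simp
  then have "1 \<le> \<bar>y - mesh \<Lambda> N i\<bar> / (\<Lambda> / real N)" using assms(1) by (subst pos_le_divide_eq) auto
  then show ?thesis by (simp add: hat_def max_def)
qed

lemma hat_mesh:
  assumes "0 < \<Lambda>" "N \<ge> 1"
  shows "hat \<Lambda> N i (mesh \<Lambda> N j) = (if i = j then 1 else 0)"
proof (cases "i = j")
  case False
  have "\<Lambda> / real N \<le> \<bar>mesh \<Lambda> N j - mesh \<Lambda> N i\<bar>"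
    using mesh_step[OF assms(1), of i j N] mesh_step[OF assms(1), of j i N] False
    by (cases "i < j") auto
  then show ?thesis using False hat_eq_0[OF _ assms] by simp
qed (simp add: hat_def)

lemma hat_in_Vh_space:
  assumes "0 < \<Lambda>" "N \<ge> 1" "i < N"
  shows "hat \<Lambda> N i \<in> Vh_space \<Lambda> N"
  unfolding Vh_space_iff
proof (intro conjI allI impI)
  have h: "\<Lambda> / real N > 0" using assms by simp
  show "continuous_on {0..\<Lambda>} (hat \<Lambda> N i)" unfolding hat_def using assms by (intro continuous_intros) auto
  show "hat \<Lambda> N i \<Lambda> = 0" using hat_mesh[OF assms(1,2), of i N] mesh_N[OF assms(2)] assms(3) by simp
  fix j assume "j < N"
  let ?h = "\<Lambda> / real N"
  have aux1: "1 - (y - m) / k = (- 1 / k) * y + (1 + m / k)"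
    and aux2: "1 - (m - y) / k = (1 / k) * y + (1 - m / k)" for y m k :: real
    by (simp_all add: diff_divide_distrib)
  consider "j = i" | "Suc j = i" | "i < j" | "Suc j < i" by linarith
  then show "\<exists>a b. \<forall>y\<in>{mesh \<Lambda> N j..mesh \<Lambda> N (Suc j)}. hat \<Lambda> N i y = a * y + b"
  proof cases
    case 1
    have "hat \<Lambda> N i y = (- 1 / ?h) * y + (1 + mesh \<Lambda> N i / ?h)" if "y \<in> {mesh \<Lambda> N j..mesh \<Lambda> N (Suc j)}" for y
    proof -
      have "\<bar>y - mesh \<Lambda> N i\<bar> = y - mesh \<Lambda> N i" "\<bar>y - mesh \<Lambda> N i\<bar> \<le> ?h" using that 1 by (auto simp: mesh_Suc)
      moreover from this(2) have "\<bar>y - mesh \<Lambda> N i\<bar> / ?h \<le> 1" by (subst divide_le_eq_1_pos[OF h])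
      ultimately have "hat \<Lambda> N i y = 1 - (y - mesh \<Lambda> N i) / ?h" unfolding hat_def by (metis diff_ge_0_iff_ge max_absorb2)
      then show ?thesis using aux1 by metis
    qed
    then show ?thesis by blast
  next
    case 2
    have "hat \<Lambda> N i y = (1 / ?h) * y + (1 - mesh \<Lambda> N i / ?h)" if "y \<in> {mesh \<Lambda> N j..mesh \<Lambda> N (Suc j)}" for y
    proof -
      have "\<bar>y - mesh \<Lambda> N i\<bar> = mesh \<Lambda> N i - y" "\<bar>y - mesh \<Lambda> N i\<bar> \<le> ?h" using that 2 by (auto simp: mesh_Suc)
      moreover from this(2) have "\<bar>y - mesh \<Lambda> N i\<bar> / ?h \<le> 1" by (subst divide_le_eq_1_pos[OF h])
      ultimately have "hat \<Lambda> N i y = 1 - (mesh \<Lambda> N i - y) / ?h" unfolding hat_def by (metis diff_ge_0_iff_ge max_absorb2)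
      then show ?thesis using aux2 by metis
    qed
    then show ?thesis by blast
  next
    case 3
    have "hat \<Lambda> N i y = 0 * y + 0" if "y \<in> {mesh \<Lambda> N j..mesh \<Lambda> N (Suc j)}" for y
      using hat_eq_0[OF _ assms(1,2), of y i] mesh_step[OF assms(1) 3, of N] that by auto
    then show ?thesis by blast
  next
    case 4
    have "hat \<Lambda> N i y = 0 * y + 0" if "y \<in> {mesh \<Lambda> N j..mesh \<Lambda> N (Suc j)}" for y
      using hat_eq_0[OF _ assms(1,2), of y i] mesh_step[OF assms(1) 4, of N] that by auto
    then show ?thesis by blast
  qed
qed

definition interpolant :: "real \<Rightarrow> nat \<Rightarrow> (nat \<Rightarrow> real) \<Rightarrow> real \<Rightarrow> real" where
  "interpolant \<Lambda> N v y = (\<Sum>i<N. v i * hat \<Lambda> N i y)"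

lemma interpolant_in_Vh_space:
  "0 < \<Lambda> \<Longrightarrow> N \<ge> 1 \<Longrightarrow> interpolant \<Lambda> N v \<in> Vh_space \<Lambda> N"
  unfolding interpolant_def by (intro Vh_space_sum hat_in_Vh_space) auto

lemma interpolant_mesh:
  assumes "0 < \<Lambda>" "N \<ge> 1"
  shows "interpolant \<Lambda> N v (mesh \<Lambda> N j) = (if j < N then v j else 0)"
  by (simp add: interpolant_def hat_mesh[OF assms] if_distrib sum.delta cong: if_cong)

lemma Vh_space_end:
  "u \<in> Vh_space \<Lambda> N \<Longrightarrow> N \<ge> 1 \<Longrightarrow> u (mesh \<Lambda> N N) = 0"
  by (simp add: Vh_space_iff mesh_N)

lemma Vh_space_L2: "u \<in> Vh_space \<Lambda> N \<Longrightarrow> L2 {0<..<\<Lambda>} u"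
  by (simp add: continuous_imp_L2 Vh_space_iff)

lemma affine_square_integral:
  fixes a h p q :: real
  assumes "h > 0"
  shows "(LBINT y:{a<..<a + h}. (p + q / h * (y - a))\<^sup>2) = h * (p\<^sup>2 + p * (p + q) + (p + q)\<^sup>2) / 3"
proof -
  obtain k where k: "k = q / h" by simp
  have q: "q = k * h" using assms by (simp add: k)
  obtain c where c: "c * 3 = k\<^sup>2" by (metis divide_self_if nonzero_eq_divide_eq zero_neq_numeral)
  let ?F = "\<lambda>y. p\<^sup>2 * (y - a) + p * k * (y - a)\<^sup>2 + c * (y - a) ^ 3"
  have "(LBINT y:{a<..<a + h}. (p + k * (y - a))\<^sup>2) = ?F (a + h) - ?F a"
  proof (rule set_integral_FTC)
    fix x
    have "(?F has_real_derivative (p\<^sup>2 + p * k * (2 * (x - a)) + c * 3 * (x - a)\<^sup>2)) (at x within {a..a + h})"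
      by (auto intro!: derivative_eq_intros)
    then show "(?F has_real_derivative (p + k * (x - a))\<^sup>2) (at x within {a..a + h})"
      unfolding c by (simp add: algebra_simps power2_eq_square)
  qed (use assms in \<open>auto intro!: continuous_intros\<close>)
  also have "\<dots> = h * (p\<^sup>2 + p * (p + q) + (p + q)\<^sup>2) / 3"
  proof -
    have "?F (a + h) - ?F a = p\<^sup>2 * h + p * k * h\<^sup>2 + (c * 3) * h ^ 3 / 3" by simp
    then show ?thesis unfolding c q by (simp add: power2_eq_square power3_eq_cube algebra_simps)
  qed
  finally show ?thesis unfolding k .
qed

lemma Vh_space_square_integral:
  assumes "u \<in> Vh_space \<Lambda> N" "0 < \<Lambda>" "N \<ge> 1"
  shows "(LBINT y:{0<..<\<Lambda>}. (u y)\<^sup>2) = (\<Sum>j<N. \<Lambda> / real N *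
    ((u (mesh \<Lambda> N j))\<^sup>2 + u (mesh \<Lambda> N j) * u (mesh \<Lambda> N (Suc j)) + (u (mesh \<Lambda> N (Suc j)))\<^sup>2) / 3)"
proof -
  have h: "\<Lambda> / real N > 0" using assms by simp
  have "(LBINT y:{0<..<\<Lambda>}. (u y)\<^sup>2) = (\<Sum>j<N. LBINT y:{mesh \<Lambda> N j<..<mesh \<Lambda> N (Suc j)}. (u y)\<^sup>2)"
    using Vh_space_L2[OF assms(1)] by (intro set_integral_mesh_split assms(2,3)) (simp add: L2_def)
  also have "\<dots> = (\<Sum>j<N. \<Lambda> / real N *
    ((u (mesh \<Lambda> N j))\<^sup>2 + u (mesh \<Lambda> N j) * u (mesh \<Lambda> N (Suc j)) + (u (mesh \<Lambda> N (Suc j)))\<^sup>2) / 3)"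
  proof (rule sum.cong[OF refl])
    fix j assume "j \<in> {..<N}"
    then have j: "j < N" by simp
    let ?p = "u (mesh \<Lambda> N j)" and ?q = "u (mesh \<Lambda> N (Suc j)) - u (mesh \<Lambda> N j)"
    have "(LBINT y:{mesh \<Lambda> N j<..<mesh \<Lambda> N (Suc j)}. (u y)\<^sup>2)
      = (LBINT y:{mesh \<Lambda> N j<..<mesh \<Lambda> N (Suc j)}. (?p + ?q / (\<Lambda> / real N) * (y - mesh \<Lambda> N j))\<^sup>2)"
    proof (rule set_lebesgue_integral_cong)
      have "u y = ?p + ?q / (\<Lambda> / real N) * (y - mesh \<Lambda> N j)" if "y \<in> {mesh \<Lambda> N j<..<mesh \<Lambda> N (Suc j)}" for y
        by (rule Vh_space_cell[OF assms j]) (use that in auto)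
      then show "\<forall>y. y \<in> {mesh \<Lambda> N j<..<mesh \<Lambda> N (Suc j)} \<longrightarrow>
          (u y)\<^sup>2 = (?p + ?q / (\<Lambda> / real N) * (y - mesh \<Lambda> N j))\<^sup>2" by metis
    qed simp
    then show "(LBINT y:{mesh \<Lambda> N j<..<mesh \<Lambda> N (Suc j)}. (u y)\<^sup>2) = \<Lambda> / real N *
      ((u (mesh \<Lambda> N j))\<^sup>2 + u (mesh \<Lambda> N j) * u (mesh \<Lambda> N (Suc j)) + (u (mesh \<Lambda> N (Suc j)))\<^sup>2) / 3"
      unfolding mesh_Suc[of \<Lambda> N j] using affine_square_integral[OF h, of "mesh \<Lambda> N j" ?p ?q]
      by (simp add: mesh_Suc)
  qed
  finally show ?thesis .
qed

text \<open>On a cell with end values \<open>p\<close> and \<open>q\<close> the integral of the square is \<open>h (p^2 + p q + q^2) / 3\<close>.  It is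
at most \<open>h (p^2 + q^2) / 2\<close>, whose sum over the cells is at most \<open>S\<close> as the last end value is \<open>0\<close>,
and it is at least \<open>h p^2 / 6\<close>.\<close>

lemma Vh_space_norm_equivalence:
  assumes u: "u \<in> Vh_space \<Lambda> N" and \<Lambda>: "0 < \<Lambda>" and N: "N \<ge> 1"
  defines "S \<equiv> \<Lambda> / real N * (\<Sum>j<N. (u (mesh \<Lambda> N j))\<^sup>2)"
  shows "(LBINT y:{0<..<\<Lambda>}. (u y)\<^sup>2) \<le> S" "S \<le> 6 * (LBINT y:{0<..<\<Lambda>}. (u y)\<^sup>2)"
proof -
  let ?h = "\<Lambda> / real N" and ?u = "\<lambda>j. u (mesh \<Lambda> N j)"
  have h: "?h > 0" using \<Lambda> N by simp
  have tel: "(\<Sum>j<N. (?u (Suc j))\<^sup>2) = (\<Sum>j<N. (?u j)\<^sup>2) - (?u 0)\<^sup>2"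
    using sum_lessThan_telescope[of "\<lambda>j. (?u j)\<^sup>2" N] Vh_space_end[OF u N] by (simp add: sum_subtractf)
  have "(\<Sum>j<N. ?h * ((?u j)\<^sup>2 + ?u j * ?u (Suc j) + (?u (Suc j))\<^sup>2) / 3)
    \<le> (\<Sum>j<N. ?h * (((?u j)\<^sup>2 + (?u (Suc j))\<^sup>2) / 2))"
  proof (rule sum_mono)
    fix j
    have "((?u j)\<^sup>2 + ?u j * ?u (Suc j) + (?u (Suc j))\<^sup>2) / 3 \<le> ((?u j)\<^sup>2 + (?u (Suc j))\<^sup>2) / 2"
      using sum_squares_bound[of "?u j" "?u (Suc j)"] by simp
    from mult_left_mono[OF this, of ?h]
    show "?h * ((?u j)\<^sup>2 + ?u j * ?u (Suc j) + (?u (Suc j))\<^sup>2) / 3 \<le> ?h * (((?u j)\<^sup>2 + (?u (Suc j))\<^sup>2) / 2)"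
      using h by simp
  qed
  also have "\<dots> = ?h * (((\<Sum>j<N. (?u j)\<^sup>2) + (\<Sum>j<N. (?u (Suc j))\<^sup>2)) / 2)"
    by (simp only: sum_distrib_left[symmetric] sum_divide_distrib[symmetric] sum.distrib)
  also have "\<dots> \<le> S" unfolding S_def tel using h by (intro mult_left_mono) auto
  finally show "(LBINT y:{0<..<\<Lambda>}. (u y)\<^sup>2) \<le> S" using Vh_space_square_integral[OF u \<Lambda> N] by simp
  have "S = (\<Sum>j<N. ?h * (?u j)\<^sup>2)" unfolding S_def by (simp add: sum_distrib_left)
  also have "\<dots> \<le> (\<Sum>j<N. 6 * (?h * ((?u j)\<^sup>2 + ?u j * ?u (Suc j) + (?u (Suc j))\<^sup>2) / 3))"
  proof (rule sum_mono)
    fix j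
    have "0 \<le> (?u j + ?u (Suc j))\<^sup>2 + (?u (Suc j))\<^sup>2" by simp
    then have "(?u j)\<^sup>2 \<le> 2 * ((?u j)\<^sup>2 + ?u j * ?u (Suc j) + (?u (Suc j))\<^sup>2)"
      by (simp add: power2_sum)
    from mult_left_mono[OF this less_imp_le[OF h]]
    have "?h * (?u j)\<^sup>2 \<le> ?h * (2 * ((?u j)\<^sup>2 + ?u j * ?u (Suc j) + (?u (Suc j))\<^sup>2))" .
    moreover have "k * (2 * m) = 6 * (k * m / 3)" for k m :: real by simp
    ultimately show "?h * (?u j)\<^sup>2 \<le> 6 * (?h * ((?u j)\<^sup>2 + ?u j * ?u (Suc j) + (?u (Suc j))\<^sup>2) / 3)"
      by metis
  qed
  finally show "S \<le> 6 * (LBINT y:{0<..<\<Lambda>}. (u y)\<^sup>2)"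
    using Vh_space_square_integral[OF u \<Lambda> N] by (simp add: sum_distrib_left)
qed

text \<open>The piecewise constant derivative, with value \<open>0\<close> at the mesh points.\<close>

definition slope :: "real \<Rightarrow> nat \<Rightarrow> (real \<Rightarrow> real) \<Rightarrow> real \<Rightarrow> real" where
  "slope \<Lambda> N u y = (\<Sum>j<N. (u (mesh \<Lambda> N (Suc j)) - u (mesh \<Lambda> N j)) / (\<Lambda> / real N)
     * indicator {mesh \<Lambda> N j<..<mesh \<Lambda> N (Suc j)} y)"

lemma slope_cell:
  assumes "0 < \<Lambda>" "N \<ge> 1" "j < N" "y \<in> {mesh \<Lambda> N j<..<mesh \<Lambda> N (Suc j)}"
  shows "slope \<Lambda> N u y = (u (mesh \<Lambda> N (Suc j)) - u (mesh \<Lambda> N j)) / (\<Lambda> / real N)"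
proof -
  have "y \<notin> {mesh \<Lambda> N i<..<mesh \<Lambda> N (Suc i)}" if "i \<noteq> j" for i
    using that assms(4) mesh_mono[OF assms(1), of "Suc i" j N] mesh_mono[OF assms(1), of "Suc j" i N]
    by (cases "i < j") auto
  then have "slope \<Lambda> N u y = (\<Sum>i<N. if i = j then (u (mesh \<Lambda> N (Suc j)) - u (mesh \<Lambda> N j)) / (\<Lambda> / real N) else 0)"
    unfolding slope_def using assms(4) by (intro sum.cong) auto
  then show ?thesis using assms(3) by simp
qed

lemma slope_L2: "L2 {0<..<\<Lambda>} (slope \<Lambda> N u)"
proof -
  have c: "L2 {0<..<\<Lambda>} (\<lambda>y. c * indicator {a<..<b} y)" for a b c :: real
    unfolding L2_def
  proof
    show "set_borel_measurable lborel {0<..<\<Lambda>} (\<lambda>y. c * indicator {a<..<b} y)"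
      unfolding set_borel_measurable_def by measurable
    have "set_integrable lborel {0<..<\<Lambda>} (\<lambda>y. c\<^sup>2 * indicat_real {a<..<b} y)"
      by (rule set_integrable_mult_bounded[where C = 1])
         (auto intro!: set_integrable_continuous simp: set_borel_measurable_def indicator_def)
    moreover have "(\<lambda>y. c\<^sup>2 * indicat_real {a<..<b} y) = (\<lambda>y. (c * indicator {a<..<b} y)\<^sup>2)"
      by (auto simp: indicator_def)
    ultimately show "set_integrable lborel {0<..<\<Lambda>} (\<lambda>y. (c * indicator {a<..<b} y)\<^sup>2)" by simp
  qed
  have s: "L2 {0<..<\<Lambda>} (\<lambda>y. \<Sum>j\<in>J. c j * indicator {a j<..<b j} y)" if "finite J" for J :: "nat set" and a b c :: "nat \<Rightarrow> real"
    using that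
  proof (induction J rule: finite_induct)
    case empty
    show ?case using c[of 0 0 0] by simp
  next
    case (insert j J)
    show ?case unfolding sum.insert[OF insert.hyps] by (rule L2_add[OF c insert.IH])
  qed
  show ?thesis unfolding slope_def by (rule s[OF finite_lessThan])
qed

text \<open>The fundamental theorem of calculus for a continuous function that is differentiable off a finite
set.\<close>

lemma Vh_space_primitive:
  assumes u: "u \<in> Vh_space \<Lambda> N" and \<Lambda>: "0 < \<Lambda>" and N: "N \<ge> 1" and x: "x \<in> {0..\<Lambda>}"
  shows "u x = u 0 + (LBINT z:{0<..<x}. slope \<Lambda> N u z)"
proof -
  have cont: "continuous_on {0..\<Lambda>} u" using u by (simp add: Vh_space_iff)
  have i: "set_integrable lborel {0..x} (slope \<Lambda> N u)"
    unfolding set_integrable_open_interval[symmetric]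
    by (rule set_integrable_subset[OF L2_interval_integrable[OF slope_L2[of \<Lambda> N u]]]) (use x in auto)
  have "(slope \<Lambda> N u has_integral (u x - u 0)) {0..x}"
  proof (rule fundamental_theorem_of_calculus_interior_strong[where S = "mesh \<Lambda> N ` {..N}"])
    show "continuous_on {0..x} u" by (rule continuous_on_subset[OF cont]) (use x in auto)
    fix y assume y: "y \<in> {0<..<x} - mesh \<Lambda> N ` {..N}"
    obtain j where j: "j < N" "y \<in> {mesh \<Lambda> N j..mesh \<Lambda> N (Suc j)}"
      using mesh_cell[OF \<Lambda> N, of y] y x by auto
    then have jj: "y \<in> {mesh \<Lambda> N j<..<mesh \<Lambda> N (Suc j)}"
      using y by (auto simp: less_le Suc_le_eq image_iff)
    let ?s = "(u (mesh \<Lambda> N (Suc j)) - u (mesh \<Lambda> N j)) / (\<Lambda> / real N)"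
    have "((\<lambda>y. p + s * (y - m)) has_real_derivative s) (at y)" for p s m :: real
      by (auto intro!: derivative_eq_intros)
    then have "((\<lambda>y. u (mesh \<Lambda> N j) + ?s * (y - mesh \<Lambda> N j)) has_real_derivative ?s) (at y)" .
    then have "(u has_real_derivative ?s) (at y)"
      by (rule has_field_derivative_transform_within_open[where S = "{mesh \<Lambda> N j<..<mesh \<Lambda> N (Suc j)}"])
         (use jj Vh_space_cell[OF u \<Lambda> N j(1), symmetric] in \<open>simp_all only: open_greaterThanLessThan greaterThanLessThan_iff atLeastAtMost_iff less_imp_le\<close>)
    then show "(u has_vector_derivative slope \<Lambda> N u y) (at y)"
      using slope_cell[OF \<Lambda> N j(1) jj] by (simp add: has_real_derivative_iff_has_vector_derivative)
  qed (use x in auto)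
  then have "integral {0..x} (slope \<Lambda> N u) = u x - u 0" by (rule integral_unique)
  then show ?thesis
    using set_borel_integral_eq_integral(2)[OF i] by (simp add: set_integral_open_interval)
qed

lemma Vh_space_weak_deriv:
  assumes u: "u \<in> Vh_space \<Lambda> N" and \<Lambda>: "0 < \<Lambda>" and N: "N \<ge> 1"
  shows "has_weak_deriv {0<..<\<Lambda>} [1] u (slope \<Lambda> N u)"
  by (rule primitive_has_weak_deriv[OF \<Lambda> L2_interval_integrable[OF slope_L2]])
     (rule Vh_space_primitive[OF u \<Lambda> N], auto)

lemma Vh_space_subset_V_space:
  assumes u: "u \<in> Vh_space \<Lambda> N" and \<Lambda>: "0 < \<Lambda>" and N: "N \<ge> 1"
  shows "u \<in> V_space \<Lambda>"
proof -
  have "has_L2_deriv {0<..<\<Lambda>} bs u" if "bs \<in> lists Basis" "length bs \<le> 1" for bs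
  proof (cases bs)
    case Nil
    have "has_weak_deriv {0<..<\<Lambda>} [] u u"
      using L1_loc_of_integrable[OF L2_interval_integrable[OF Vh_space_L2[OF u]]] by (simp add: has_weak_deriv_def)
    then show ?thesis using Nil Vh_space_L2[OF u] unfolding has_L2_deriv_def by blast
  next
    case (Cons b cs)
    then have "bs = [1]" using that by auto
    then show ?thesis using Vh_space_weak_deriv[OF assms] slope_L2 unfolding has_L2_deriv_def by blast
  qed
  then show ?thesis using Vh_space_L2[OF u] u by (simp add: V_space_def sobolev_def Vh_space_iff)
qed

text \<open>The Dirichlet form of piecewise affine functions with nodal values \<open>a\<close> and \<open>b\<close>, up to the factor
\<open>1 / h\<close>.\<close>

definition mesh_form :: "nat \<Rightarrow> (nat \<Rightarrow> real) \<Rightarrow> (nat \<Rightarrow> real) \<Rightarrow> real" where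
  "mesh_form N a b = (\<Sum>j<N. (a (Suc j) - a j) * (b (Suc j) - b j))"

text \<open>As the derivative of \<open>\<psi>\<close> is constant on each cell, only the increments of \<open>u\<close> over the cells enter,
and these depend on the nodal values alone.  Nodal interpolation is therefore the elliptic
projection.\<close>

lemma V_inner_Vh_space:
  assumes u: "u \<in> V_space \<Lambda>" and \<psi>: "\<psi> \<in> Vh_space \<Lambda> N" and \<Lambda>: "0 < \<Lambda>" and N: "N \<ge> 1"
  shows "V_inner \<Lambda> u \<psi> = mesh_form N (\<lambda>j. u (mesh \<Lambda> N j)) (\<lambda>j. \<psi> (mesh \<Lambda> N j)) / (\<Lambda> / real N)"
proof -
  let ?du = "L2_deriv {0<..<\<Lambda>} [1] u" and ?d\<psi> = "L2_deriv {0<..<\<Lambda>} [1] \<psi>" and ?s = "slope \<Lambda> N \<psi>"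
  note \<psi>V = Vh_space_subset_V_space[OF \<psi> \<Lambda> N]
  note du = V_space_D(4)[OF u] and d\<psi> = V_space_D(4)[OF \<psi>V]
  have ae: "AE y\<in>{0<..<\<Lambda>} in lborel. ?d\<psi> y = ?s y"
    by (rule weak_deriv_unique[OF \<Lambda> L2_interval_integrable[OF d\<psi>] L2_interval_integrable[OF slope_L2]
          V_space_D(5)[OF \<psi>V] Vh_space_weak_deriv[OF \<psi> \<Lambda> N]])
  have i: "set_integrable lborel {0<..<\<Lambda>} (\<lambda>y. ?du y * ?s y)" by (rule L2_mult_integrable[OF du slope_L2])
  have "V_inner \<Lambda> u \<psi> = (LBINT y:{0<..<\<Lambda>}. ?du y * ?s y)"
    unfolding V_inner_def
    by (rule set_integral_cong_AE_restricted[OF set_integrable_imp_measurable[OF L2_mult_integrable[OF du d\<psi>]]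
          set_integrable_imp_measurable[OF i]])
       (use ae in \<open>auto elim: eventually_mono\<close>)
  also have "\<dots> = (\<Sum>j<N. LBINT y:{mesh \<Lambda> N j<..<mesh \<Lambda> N (Suc j)}. ?du y * ?s y)"
    by (rule set_integral_mesh_split[OF \<Lambda> N i])
  also have "\<dots> = (\<Sum>j<N. (u (mesh \<Lambda> N (Suc j)) - u (mesh \<Lambda> N j)) * (\<psi> (mesh \<Lambda> N (Suc j)) - \<psi> (mesh \<Lambda> N j)) / (\<Lambda> / real N))"
  proof (rule sum.cong[OF refl])
    fix j assume "j \<in> {..<N}"
    then have j: "j < N" by simp
    let ?c = "(\<psi> (mesh \<Lambda> N (Suc j)) - \<psi> (mesh \<Lambda> N j)) / (\<Lambda> / real N)"
    note b = mesh_bounds[OF \<Lambda> N, of j] mesh_bounds[OF \<Lambda> N, of "Suc j"] mesh_mono[OF \<Lambda>, of j "Suc j" N]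
    have "(LBINT y:{mesh \<Lambda> N j<..<mesh \<Lambda> N (Suc j)}. ?du y * ?s y)
      = (LBINT y:{mesh \<Lambda> N j<..<mesh \<Lambda> N (Suc j)}. ?du y * ?c)"
      by (rule set_lebesgue_integral_cong) (use slope_cell[OF \<Lambda> N j] in auto)
    also have "\<dots> = (LBINT y:{mesh \<Lambda> N j<..<mesh \<Lambda> N (Suc j)}. ?du y) * ?c" by simp
    also have "(LBINT y:{mesh \<Lambda> N j<..<mesh \<Lambda> N (Suc j)}. ?du y) = u (mesh \<Lambda> N (Suc j)) - u (mesh \<Lambda> N j)"
    proof -
      have "set_integrable lborel {0<..<mesh \<Lambda> N (Suc j)} ?du"
        by (rule set_integrable_subset[OF L2_interval_integrable[OF du]]) (use b j in auto)
      from set_integral_split[OF this, of "mesh \<Lambda> N j"]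
      show ?thesis
        using V_space_primitive[OF u \<Lambda>, of "mesh \<Lambda> N j"] V_space_primitive[OF u \<Lambda>, of "mesh \<Lambda> N (Suc j)"] b j
        by simp
    qed
    finally show "(LBINT y:{mesh \<Lambda> N j<..<mesh \<Lambda> N (Suc j)}. ?du y * ?s y)
      = (u (mesh \<Lambda> N (Suc j)) - u (mesh \<Lambda> N j)) * (\<psi> (mesh \<Lambda> N (Suc j)) - \<psi> (mesh \<Lambda> N j)) / (\<Lambda> / real N)"
      by simp
  qed
  finally show ?thesis by (simp only: mesh_form_def sum_divide_distrib)
qed


section \<open>Interpolation and quadrature\<close>

lemma set_integral_const_interval:
  "a \<le> b \<Longrightarrow> (LBINT x:{a<..<b::real}. (c::real)) = c * (b - a)"
  by (simp add: set_lebesgue_integral_def)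

lemma primitive_has_derivative:
  fixes g :: "real \<Rightarrow> real"
  assumes g: "continuous_on {a..b} g" and x: "x \<in> {a..b}"
  shows "((\<lambda>u. LBINT z:{a<..<u}. g z) has_real_derivative g x) (at x within {a..b})"
proof -
  have e: "(LBINT z:{a<..<u}. g z) = integral {a..u} g" if "u \<in> {a..b}" for u
    unfolding set_integral_open_interval
    by (rule set_borel_integral_eq_integral(2)[OF set_integrable_subset[OF borel_integrable_atLeastAtMost'[OF g]]])
       (use that in auto)
  have "((\<lambda>u. LBINT z:{a<..<u}. g z) has_vector_derivative g x) (at x within {a..b})"
    by (rule has_vector_derivative_transform[OF x e integral_has_vector_derivative[OF g x]])
  then show ?thesis by (simp add: has_real_derivative_iff_has_vector_derivative)
qed

lemma primitive_increment_le:
  fixes q :: "real \<Rightarrow> real"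
  assumes q: "set_integrable lborel {0<..<\<Lambda>} q" and ab: "0 \<le> a" "b \<le> \<Lambda>"
    and x: "x \<in> {a..b}" and y: "y \<in> {a..b}"
  shows "\<bar>(LBINT z:{0<..<x}. q z) - (LBINT z:{0<..<y}. q z)\<bar> \<le> (LBINT z:{a<..<b}. \<bar>q z\<bar>)"
proof -
  let ?Q = "\<lambda>x. LBINT z:{0<..<x}. q z"
  have *: "\<bar>?Q v - ?Q u\<bar> \<le> (LBINT z:{a<..<b}. \<bar>q z\<bar>)" if uv: "a \<le> u" "u \<le> v" "v \<le> b" for u v
  proof -
    have "set_integrable lborel {0<..<v} q" by (rule set_integrable_subset[OF q]) (use uv ab in auto)
    from set_integral_split[OF this, of u] have "?Q v - ?Q u = (LBINT z:{u<..<v}. q z)" using uv ab by simp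
    moreover have "\<bar>LBINT z:{u<..<v}. q z\<bar> \<le> (LBINT z:{u<..<v}. \<bar>q z\<bar>)" by (rule set_integral_abs_le)
    moreover have "(LBINT z:{u<..<v}. \<bar>q z\<bar>) \<le> (LBINT z:{a<..<b}. \<bar>q z\<bar>)"
    proof -
      have i: "set_integrable lborel {a<..<b} (\<lambda>z. \<bar>q z\<bar>)"
        by (rule set_integrable_abs[OF set_integrable_subset[OF q]]) (use ab in auto)
      have iv: "set_integrable lborel {a<..<v} (\<lambda>z. \<bar>q z\<bar>)"
        by (rule set_integrable_subset[OF i]) (use uv in auto)
      have "(LBINT z:{a<..<b}. \<bar>q z\<bar>) = (LBINT z:{a<..<v}. \<bar>q z\<bar>) + (LBINT z:{v<..<b}. \<bar>q z\<bar>)"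
        by (rule set_integral_split[OF i]) (use uv in auto)
      moreover have "(LBINT z:{a<..<v}. \<bar>q z\<bar>) = (LBINT z:{a<..<u}. \<bar>q z\<bar>) + (LBINT z:{u<..<v}. \<bar>q z\<bar>)"
        by (rule set_integral_split[OF iv]) (use uv in auto)
      moreover have "0 \<le> (LBINT z:{v<..<b}. \<bar>q z\<bar>)" "0 \<le> (LBINT z:{a<..<u}. \<bar>q z\<bar>)"
        by (simp_all add: set_lebesgue_integral_nonneg)
      ultimately show ?thesis by linarith
    qed
    ultimately show ?thesis by linarith
  qed
  show ?thesis
  proof (cases "x \<le> y")
    case True
    then show ?thesis using *[of x y] x y by (simp add: abs_minus_commute)
  next
    case False
    then show ?thesis using *[of y x] x y by simp
  qed
qed

lemma L2_subinterval:
  fixes f :: "real \<Rightarrow> real"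
  assumes "L2 {a<..<b} f" "a \<le> c" "d \<le> b"
  shows "L2 {c<..<d} f"
  using assms unfolding L2_def
  by (auto intro: set_integrable_subset set_borel_measurable_subset)

text \<open>The error vanishes at both end points, so by Rolle's theorem its derivative vanishes at some \<open>\<xi>\<close> in
the cell.  Hence the derivative is at most the integral \<open>m\<close> of \<open>|q|\<close> over the cell, the error is at
most \<open>(b - a) m\<close>, and \<open>m^2 \<le> (b - a) \<integral> q^2\<close>.\<close>

lemma cell_interpolation_error:
  fixes d :: "real \<Rightarrow> real"
  assumes ab: "0 \<le> a" "a < b" "b \<le> \<Lambda>" and q: "L2 {0<..<\<Lambda>} q"
    and d: "\<And>z. z \<in> {a..b} \<Longrightarrow> d z = e + (LBINT s:{0<..<z}. q s)"
    and f: "\<And>x. x \<in> {a..b} \<Longrightarrow> (f has_real_derivative d x) (at x within {a..b})"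
    and u: "\<And>x. x \<in> {a..b} \<Longrightarrow> u x = p + s * (x - a)" and ends: "u a = f a" "u b = f b"
  shows "(LBINT y:{a<..<b}. (u y - f y)\<^sup>2) \<le> (b - a) ^ 4 * (LBINT y:{a<..<b}. (q y)\<^sup>2)"
proof -
  let ?m = "LBINT z:{a<..<b}. \<bar>q z\<bar>"
  define E where "E = (\<lambda>y. p + s * (y - a) - f y)"
  have E: "(E has_real_derivative s - d x) (at x within {a..b})" if "x \<in> {a..b}" for x
    unfolding E_def by (auto intro!: derivative_eq_intros f[OF that])
  have E0: "E a = 0" "E b = 0" using u[of a] u[of b] ends ab by (auto simp: E_def)
  obtain \<xi> where \<xi>: "\<xi> \<in> {a<..<b}" "E b - E a = (s - d \<xi>) * (b - a)"
    using mvt_simple[OF ab(2), of E "\<lambda>x. (*) (s - d x)"] E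
    by (auto simp: has_field_derivative_def)
  then have s: "s = d \<xi>" using E0 ab by simp
  have bnd: "\<bar>u y - f y\<bar> \<le> ?m * (b - a)" if y: "y \<in> {a<..<b}" for y
  proof -
    have "\<exists>x\<in>{a<..<y}. E y - E a = (*) (s - d x) (y - a)"
    proof (rule mvt_simple)
      show "(E has_derivative (*) (s - d x)) (at x within {a..y})" if "a \<le> x" "x \<le> y" for x
        by (rule has_derivative_subset[OF E[of x, unfolded has_field_derivative_def]]) (use that y in auto)
    qed (use y in auto)
    then obtain \<eta> where \<eta>: "\<eta> \<in> {a<..<y}" "E y = (d \<xi> - d \<eta>) * (y - a)" using E0 s by auto
    have "\<bar>d \<xi> - d \<eta>\<bar> \<le> ?m"
      using primitive_increment_le[OF L2_interval_integrable[OF q] ab(1,3), of \<xi> \<eta>] d[of \<xi>] d[of \<eta>] \<xi> \<eta> y by simp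
    moreover have "0 \<le> ?m" by (simp add: set_lebesgue_integral_nonneg)
    ultimately have "\<bar>E y\<bar> \<le> ?m * (b - a)" unfolding \<eta>(2) abs_mult using y by (intro mult_mono) auto
    then show ?thesis using u[of y] y by (simp add: E_def)
  qed
  have m2: "?m\<^sup>2 \<le> (b - a) * (LBINT y:{a<..<b}. (q y)\<^sup>2)"
    using L2_integral_abs_squared_le[OF L2_subinterval[OF q ab(1,3)]] interval_emeasure_finite[of a b] ab by simp
  have cont: "continuous_on {a..b} E"
    using E DERIV_continuous continuous_on_eq_continuous_within by blast
  have "(LBINT y:{a<..<b}. (u y - f y)\<^sup>2) = (LBINT y:{a<..<b}. (E y)\<^sup>2)"
    by (rule set_lebesgue_integral_cong) (use u in \<open>auto simp: E_def\<close>)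
  also have "\<dots> \<le> (LBINT y:{a<..<b}. (?m * (b - a))\<^sup>2)"
  proof (rule set_integral_mono)
    show "set_integrable lborel {a<..<b} (\<lambda>y. (E y)\<^sup>2)"
      by (intro set_integrable_continuous continuous_intros cont)
    show "set_integrable lborel {a<..<b} (\<lambda>y. (?m * (b - a))\<^sup>2)"
      by (intro set_integrable_continuous continuous_intros)
    fix y assume y: "y \<in> {a<..<b}"
    have "\<bar>E y\<bar> \<le> ?m * (b - a)" using bnd[OF y] u[of y] y by (simp add: E_def)
    then show "(E y)\<^sup>2 \<le> (?m * (b - a))\<^sup>2" by (metis abs_ge_zero power2_abs power_mono)
  qed
  also have "\<dots> = ?m\<^sup>2 * (b - a) ^ 3"
    using ab by (simp add: set_integral_const_interval power2_eq_square power3_eq_cube)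
  also have "\<dots> \<le> ((b - a) * (LBINT y:{a<..<b}. (q y)\<^sup>2)) * (b - a) ^ 3"
    by (rule mult_right_mono[OF m2]) (use ab in auto)
  also have "\<dots> = (b - a) ^ 4 * (LBINT y:{a<..<b}. (q y)\<^sup>2)"
    by (simp add: power3_eq_cube power4_eq_xxxx)
  finally show ?thesis .
qed

lemma interpolation_error:
  assumes \<Lambda>: "0 < \<Lambda>" and N: "N \<ge> 1" and q: "L2 {0<..<\<Lambda>} q"
    and f: "\<And>x. x \<in> {0..\<Lambda>} \<Longrightarrow> f x = c + (LBINT z:{0<..<x}. e + (LBINT s:{0<..<z}. q s))"
    and f\<Lambda>: "f \<Lambda> = 0"
  defines "I \<equiv> interpolant \<Lambda> N (\<lambda>j. f (mesh \<Lambda> N j))"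
  shows "(LBINT y:{0<..<\<Lambda>}. (I y - f y)\<^sup>2) \<le> (\<Lambda> / real N) ^ 4 * (LBINT y:{0<..<\<Lambda>}. (q y)\<^sup>2)"
proof -
  define d where "d = (\<lambda>z. e + (LBINT s:{0<..<z}. q s))"
  have cd: "continuous_on {0..\<Lambda>} d"
    unfolding d_def by (intro continuous_intros primitive_continuous L2_interval_integrable q)
  have D0: "((\<lambda>x. c + (LBINT z:{0<..<x}. d z)) has_real_derivative d x) (at x within {0..\<Lambda>})"
    if "x \<in> {0..\<Lambda>}" for x
    using DERIV_add[OF DERIV_const primitive_has_derivative[OF cd that]] by simp
  have D: "(f has_real_derivative d x) (at x within {0..\<Lambda>})" if x: "x \<in> {0..\<Lambda>}" for x
    by (rule has_field_derivative_transform_within[OF D0[OF x] zero_less_one x]) (simp add: f d_def)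
  have cf: "continuous_on {0..\<Lambda>} f"
    using D DERIV_continuous continuous_on_eq_continuous_within by blast
  have I: "I \<in> Vh_space \<Lambda> N" unfolding I_def by (rule interpolant_in_Vh_space[OF \<Lambda> N])
  have If: "I (mesh \<Lambda> N j) = f (mesh \<Lambda> N j)" if "j \<le> N" for j
    using that f\<Lambda> interpolant_mesh[OF \<Lambda> N, of "\<lambda>j. f (mesh \<Lambda> N j)" j] mesh_N[OF N, of \<Lambda>]
    unfolding I_def by (cases "j = N") simp_all
  have cI: "continuous_on {0..\<Lambda>} I" using I by (simp add: Vh_space_iff)
  have "(LBINT y:{0<..<\<Lambda>}. (I y - f y)\<^sup>2)
    = (\<Sum>j<N. LBINT y:{mesh \<Lambda> N j<..<mesh \<Lambda> N (Suc j)}. (I y - f y)\<^sup>2)"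
    by (intro set_integral_mesh_split[OF \<Lambda> N] set_integrable_continuous continuous_intros cI cf)
  also have "\<dots> \<le> (\<Sum>j<N. (\<Lambda> / real N) ^ 4 * (LBINT y:{mesh \<Lambda> N j<..<mesh \<Lambda> N (Suc j)}. (q y)\<^sup>2))"
  proof (rule sum_mono)
    fix j assume "j \<in> {..<N}"
    then have j: "j < N" by simp
    let ?a = "mesh \<Lambda> N j" and ?b = "mesh \<Lambda> N (Suc j)"
    have h: "0 < \<Lambda> / real N" using \<Lambda> N by simp
    have b: "0 \<le> ?a" "?a < ?b" "?b \<le> \<Lambda>" using mesh_bounds[OF \<Lambda> N, of j] mesh_bounds[OF \<Lambda> N, of "Suc j"] j h by (simp_all add: mesh_Suc)
    have "(LBINT y:{?a<..<?b}. (I y - f y)\<^sup>2) \<le> (?b - ?a) ^ 4 * (LBINT y:{?a<..<?b}. (q y)\<^sup>2)"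
    proof (rule cell_interpolation_error[OF b q])
      show "(f has_real_derivative d x) (at x within {?a..?b})" if "x \<in> {?a..?b}" for x
        by (rule DERIV_subset[OF D]) (use that b in auto)
      show "I x = I ?a + (I ?b - I ?a) / (\<Lambda> / real N) * (x - ?a)" if "x \<in> {?a..?b}" for x
        by (rule Vh_space_cell[OF I \<Lambda> N j that])
    qed (use j If in \<open>simp_all add: d_def\<close>)
    then show "(LBINT y:{?a<..<?b}. (I y - f y)\<^sup>2) \<le> (\<Lambda> / real N) ^ 4 * (LBINT y:{?a<..<?b}. (q y)\<^sup>2)"
      by (simp add: mesh_Suc)
  qed
  also have "\<dots> = (\<Lambda> / real N) ^ 4 * (LBINT y:{0<..<\<Lambda>}. (q y)\<^sup>2)"
    using set_integral_mesh_split[OF \<Lambda> N, of "\<lambda>y. (q y)\<^sup>2"] q by (simp add: L2_def sum_distrib_left)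
  finally show ?thesis .
qed

lemma tail_integral_continuous:
  fixes g :: "real \<Rightarrow> real"
  assumes g: "set_integrable lborel {0<..<\<Lambda>} g" and y: "y \<in> {0..\<Lambda>}"
  shows "(LBINT z:{y<..<\<Lambda>}. g z) = (LBINT z:{0<..<\<Lambda>}. g z) - (LBINT z:{0<..<y}. g z)"
  using set_integral_split[OF g, of y] y by simp

text \<open>On the cell that starts at \<open>x_j\<close>,
\<open>W \<psi> - W x_j \<psi> x_j = (W - W x_j) \<psi> x_j + W (\<psi> - \<psi> x_j)\<close>.  As both \<open>W\<close> and \<open>\<psi>\<close> vanish at \<open>\<Lambda>\<close>, they
are bounded by their total variations \<open>\<integral> |g|\<close> and \<open>\<Sum> |\<psi> x_(j+1) - \<psi> x_j|\<close>, and their oscillations on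
the cells add up to the same quantities.\<close>

lemma quadrature_error:
  fixes g :: "real \<Rightarrow> real"
  assumes \<Lambda>: "0 < \<Lambda>" and N: "N \<ge> 1" and g: "set_integrable lborel {0<..<\<Lambda>} g"
    and \<psi>: "\<psi> \<in> Vh_space \<Lambda> N"
  defines "W \<equiv> \<lambda>y. - (LBINT z:{y<..<\<Lambda>}. g z)"
  shows "\<bar>(LBINT y:{0<..<\<Lambda>}. W y * \<psi> y) - \<Lambda> / real N * (\<Sum>j<N. W (mesh \<Lambda> N j) * \<psi> (mesh \<Lambda> N j))\<bar>
    \<le> 2 * (\<Lambda> / real N) * (LBINT z:{0<..<\<Lambda>}. \<bar>g z\<bar>) * (\<Sum>j<N. \<bar>\<psi> (mesh \<Lambda> N (Suc j)) - \<psi> (mesh \<Lambda> N j)\<bar>)"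
proof -
  obtain h where h: "h = \<Lambda> / real N" and h0: "0 < h" using \<Lambda> N by simp
  let ?x = "mesh \<Lambda> N"
  let ?\<gamma> = "LBINT z:{0<..<\<Lambda>}. \<bar>g z\<bar>" and ?\<gamma>j = "\<lambda>j. LBINT z:{?x j<..<?x (Suc j)}. \<bar>g z\<bar>"
  let ?\<sigma>j = "\<lambda>j. \<bar>\<psi> (?x (Suc j)) - \<psi> (?x j)\<bar>"
  let ?\<sigma> = "\<Sum>j<N. ?\<sigma>j j"
  have W: "W y = (LBINT z:{0<..<y}. g z) - (LBINT z:{0<..<\<Lambda>}. g z)" if "y \<in> {0..\<Lambda>}" for y
    unfolding W_def using tail_integral_continuous[OF g that] by simp
  have cW: "continuous_on {0..\<Lambda>} W"
    by (rule continuous_on_cong[THEN iffD2, OF refl W continuous_on_diff[OF primitive_continuous[OF g] continuous_on_const]])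
  have c\<psi>: "continuous_on {0..\<Lambda>} \<psi>" using \<psi> by (simp add: Vh_space_iff)
  have Wb: "\<bar>W y\<bar> \<le> ?\<gamma>" if "y \<in> {0..\<Lambda>}" for y
    using W[OF that] primitive_increment_le[OF g, of 0 \<Lambda> y \<Lambda>] that by simp
  have \<psi>b: "\<bar>\<psi> (?x k)\<bar> \<le> ?\<sigma>" if "k \<le> N" for k
  proof -
    have "\<psi> (?x N) - \<psi> (?x k) = (\<Sum>j=k..<N. \<psi> (?x (Suc j)) - \<psi> (?x j))"
      using sum_Suc_diff'[OF that, of "\<lambda>j. \<psi> (?x j)"] by simp
    then have "\<bar>\<psi> (?x k)\<bar> = \<bar>\<Sum>j=k..<N. \<psi> (?x (Suc j)) - \<psi> (?x j)\<bar>"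
      using Vh_space_end[OF \<psi> N] by simp
    also have "\<dots> \<le> (\<Sum>j=k..<N. ?\<sigma>j j)" by (rule sum_abs)
    also have "\<dots> \<le> ?\<sigma>" by (rule sum_mono2) auto
    finally show ?thesis .
  qed
  have cell: "\<bar>(LBINT y:{?x j<..<?x (Suc j)}. W y * \<psi> y) - h * (W (?x j) * \<psi> (?x j))\<bar>
    \<le> h * (?\<gamma>j j * ?\<sigma> + ?\<gamma> * ?\<sigma>j j)" if j: "j < N" for j
  proof -
    let ?I = "{?x j<..<?x (Suc j)}"
    have b: "0 \<le> ?x j" "?x j < ?x (Suc j)" "?x (Suc j) \<le> \<Lambda>"
      using mesh_bounds[OF \<Lambda> N, of j] mesh_bounds[OF \<Lambda> N, of "Suc j"] j h0 h by (simp_all add: mesh_Suc)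
    have cc: "continuous_on {?x j..?x (Suc j)} (\<lambda>y. W y * \<psi> y)"
      by (rule continuous_on_subset[OF continuous_on_mult[OF cW c\<psi>]]) (use b in auto)
    have i: "set_integrable lborel ?I (\<lambda>y. W y * \<psi> y - W (?x j) * \<psi> (?x j))"
      by (intro set_integrable_continuous continuous_intros cc)
    have "(LBINT y:?I. W y * \<psi> y) - h * (W (?x j) * \<psi> (?x j)) = (LBINT y:?I. W y * \<psi> y - W (?x j) * \<psi> (?x j))"
      using b h mesh_Suc[of \<Lambda> N j]
      by (subst set_integral_diff(2)[OF set_integrable_continuous[OF cc] set_integrable_continuous[OF continuous_on_const]])
         (simp add: set_integral_const_interval)
    also have "\<bar>\<dots>\<bar> \<le> (LBINT y:?I. \<bar>W y * \<psi> y - W (?x j) * \<psi> (?x j)\<bar>)" by (rule set_integral_abs_le)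
    also have "\<dots> \<le> (LBINT y:?I. ?\<gamma>j j * ?\<sigma> + ?\<gamma> * ?\<sigma>j j)"
    proof (rule set_integral_mono[OF set_integrable_abs[OF i] set_integrable_continuous[OF continuous_on_const]])
      fix y assume y: "y \<in> ?I"
      have 1: "\<bar>W y - W (?x j)\<bar> \<le> ?\<gamma>j j"
        using W[of y] W[of "?x j"] primitive_increment_le[OF g b(1,3), of y "?x j"] y b by simp
      have 2: "\<bar>\<psi> y - \<psi> (?x j)\<bar> \<le> ?\<sigma>j j"
      proof -
        have "\<psi> y - \<psi> (?x j) = (\<psi> (?x (Suc j)) - \<psi> (?x j)) * ((y - ?x j) / h)"
          using Vh_space_cell[OF \<psi> \<Lambda> N j, of y] y h by simp
        moreover have "\<bar>(y - ?x j) / h\<bar> \<le> 1"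
          using y h0 mesh_Suc[of \<Lambda> N j] unfolding h[symmetric] by simp
        ultimately show ?thesis
          using mult_left_mono[of "\<bar>(y - ?x j) / h\<bar>" 1 "?\<sigma>j j"] by (simp add: abs_mult)
      qed
      have "W y * \<psi> y - W (?x j) * \<psi> (?x j) = (W y - W (?x j)) * \<psi> (?x j) + W y * (\<psi> y - \<psi> (?x j))"
        by (simp add: algebra_simps)
      then have "\<bar>W y * \<psi> y - W (?x j) * \<psi> (?x j)\<bar>
        \<le> \<bar>W y - W (?x j)\<bar> * \<bar>\<psi> (?x j)\<bar> + \<bar>W y\<bar> * \<bar>\<psi> y - \<psi> (?x j)\<bar>"
        using abs_triangle_ineq by (metis abs_mult)
      also have "\<dots> \<le> ?\<gamma>j j * ?\<sigma> + ?\<gamma> * ?\<sigma>j j"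
        using 1 2 Wb[of y] \<psi>b[of j] j y b by (intro add_mono mult_mono) (auto intro: order_trans[OF abs_ge_zero])
      finally show "\<bar>W y * \<psi> y - W (?x j) * \<psi> (?x j)\<bar> \<le> ?\<gamma>j j * ?\<sigma> + ?\<gamma> * ?\<sigma>j j" .
    qed
    also have "\<dots> = h * (?\<gamma>j j * ?\<sigma> + ?\<gamma> * ?\<sigma>j j)"
      using b mesh_Suc[of \<Lambda> N j] h by (simp add: set_integral_const_interval mult.commute)
    finally show ?thesis .
  qed
  have "(LBINT y:{0<..<\<Lambda>}. W y * \<psi> y) = (\<Sum>j<N. LBINT y:{?x j<..<?x (Suc j)}. W y * \<psi> y)"
    by (intro set_integral_mesh_split[OF \<Lambda> N] set_integrable_continuous continuous_on_mult cW c\<psi>)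
  then have e: "(LBINT y:{0<..<\<Lambda>}. W y * \<psi> y) - h * (\<Sum>j<N. W (?x j) * \<psi> (?x j))
    = (\<Sum>j<N. (LBINT y:{?x j<..<?x (Suc j)}. W y * \<psi> y) - h * (W (?x j) * \<psi> (?x j)))"
    by (simp add: sum_subtractf sum_distrib_left)
  have "\<bar>(LBINT y:{0<..<\<Lambda>}. W y * \<psi> y) - h * (\<Sum>j<N. W (?x j) * \<psi> (?x j))\<bar>
    \<le> (\<Sum>j<N. h * (?\<gamma>j j * ?\<sigma> + ?\<gamma> * ?\<sigma>j j))"
    unfolding e by (rule order_trans[OF sum_abs sum_mono]) (use cell in auto)
  also have "\<dots> = h * ((\<Sum>j<N. ?\<gamma>j j) * ?\<sigma> + ?\<gamma> * ?\<sigma>)"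
    by (simp only: sum_distrib_left[symmetric] sum_distrib_right[symmetric] sum.distrib)
  also have "(\<Sum>j<N. ?\<gamma>j j) = ?\<gamma>" using set_integral_mesh_split[OF \<Lambda> N set_integrable_abs[OF g]] by simp
  finally show ?thesis unfolding h[symmetric] by (simp add: algebra_simps)
qed


section \<open>The mixed derivative\<close>

lemma set_integrable_mult_supported:
  fixes f \<phi> :: "'a \<Rightarrow> real"
  assumes "set_integrable M S f" "set_borel_measurable M S \<phi>" "\<And>x. x \<in> S \<Longrightarrow> \<bar>\<phi> x\<bar> \<le> C"
    and "S \<subseteq> U" "\<And>x. x \<notin> S \<Longrightarrow> \<phi> x = 0"
  shows "set_integrable M U (\<lambda>x. f x * \<phi> x)"
proof -
  have "indicator U x *\<^sub>R (f x * \<phi> x) = indicator S x *\<^sub>R (f x * \<phi> x)" for x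
    using assms(4) assms(5)[of x] by (auto simp: indicator_def)
  then show ?thesis
    using set_integrable_mult_bounded[OF assms(1-3)] unfolding set_integrable_def by (simp only:)
qed

lemma smooth_fst: "smooth \<alpha> \<Longrightarrow> smooth (\<lambda>p :: real \<times> real. \<alpha> (fst p))"
  using smooth_compose_affine[OF _ bounded_linear_fst, of \<alpha> 0] by simp

lemma smooth_snd: "smooth \<alpha> \<Longrightarrow> smooth (\<lambda>p :: real \<times> real. \<alpha> (snd p))"
  using smooth_compose_affine[OF _ bounded_linear_snd, of \<alpha> 0] by simp

lemma frechet_derivative_product:
  fixes \<alpha> \<beta> :: "real \<Rightarrow> real"
  assumes "smooth \<alpha>" "smooth \<beta>"
  shows "frechet_derivative (\<lambda>p. \<alpha> (fst p) * \<beta> (snd p)) (at p) v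
    = \<alpha> (fst p) * (snd v * deriv \<beta> (snd p)) + fst v * deriv \<alpha> (fst p) * \<beta> (snd p)"
proof -
  have "((\<lambda>p :: real \<times> real. \<alpha> (fst p)) has_derivative (\<lambda>v. fst v * deriv \<alpha> (fst p))) (at p)"
    using has_derivative_compose_affine[OF assms(1) bounded_linear_fst, of 1 0 p] by simp
  moreover have "((\<lambda>p :: real \<times> real. \<beta> (snd p)) has_derivative (\<lambda>v. snd v * deriv \<beta> (snd p))) (at p)"
    using has_derivative_compose_affine[OF assms(2) bounded_linear_snd, of 1 0 p] by simp
  ultimately have "((\<lambda>p. \<alpha> (fst p) * \<beta> (snd p)) has_derivative
      (\<lambda>v. \<alpha> (fst p) * (snd v * deriv \<beta> (snd p)) + fst v * deriv \<alpha> (fst p) * \<beta> (snd p))) (at p)"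
    by (rule has_derivative_mult)
  from fun_cong[OF frechet_derivative_at[OF this], of v] show ?thesis by (rule sym)
qed

lemma partials_product:
  fixes \<alpha> \<beta> :: "real \<Rightarrow> real"
  assumes "smooth \<alpha>" "smooth \<beta>"
  shows "partials [(1, 0), (0, 1)] (\<lambda>p. \<alpha> (fst p) * \<beta> (snd p)) = (\<lambda>p. deriv \<alpha> (fst p) * deriv \<beta> (snd p))"
  using frechet_derivative_product[OF assms] frechet_derivative_product[OF smooth_deriv[OF assms(1)] assms(2)]
  by simp

lemma test_function_product:
  assumes \<alpha>: "test_function {0<..<\<Lambda>} \<alpha>" and \<beta>: "test_function {0<..<t} \<beta>" and "0 < \<Lambda>" "0 < t"
  shows "test_function ({0<..<\<Lambda>} \<times> {0<..<t}) (\<lambda>p :: real \<times> real. \<alpha> (fst p) * \<beta> (snd p))"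
proof -
  obtain a b where ab: "0 < a" "b < \<Lambda>" "a \<le> b" "\<And>x. x \<notin> {a..b} \<Longrightarrow> \<alpha> x = 0"
    using interval_test_functionE[OF \<alpha> assms(3)] by blast
  obtain c d where cd: "0 < c" "d < t" "c \<le> d" "\<And>x. x \<notin> {c..d} \<Longrightarrow> \<beta> x = 0"
    using interval_test_functionE[OF \<beta> assms(4)] by blast
  let ?S = "{p :: real \<times> real. \<alpha> (fst p) * \<beta> (snd p) \<noteq> 0}"
  have c: "compact ({a..b} \<times> {c..d})" by (intro compact_Times compact_Icc)
  have "?S \<subseteq> {a..b} \<times> {c..d}"
  proof
    fix p assume "p \<in> ?S"
    then show "p \<in> {a..b} \<times> {c..d}" using ab(4)[of "fst p"] cd(4)[of "snd p"] by (cases p) fastforce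
  qed
  then have s: "closure ?S \<subseteq> {a..b} \<times> {c..d}" by (rule closure_minimal[OF _ compact_imp_closed[OF c]])
  then have "compact (closure ?S)"
    using bounded_subset[OF compact_imp_bounded[OF c]] by (simp add: compact_eq_bounded_closed)
  moreover have "closure ?S \<subseteq> {0<..<\<Lambda>} \<times> {0<..<t}" using s ab cd by fastforce
  moreover have "smooth (\<lambda>p :: real \<times> real. \<alpha> (fst p) * \<beta> (snd p))"
    by (intro smooth_mult smooth_fst smooth_snd test_function_smooth[OF \<alpha>] test_function_smooth[OF \<beta>])
  ultimately show ?thesis unfolding test_function_def by blast
qed

text \<open>The function \<open>u\<close> is only known to be locally integrable; its product with \<open>\<alpha>' \<beta>'\<close> is integrable on
the whole rectangle because \<open>\<alpha>' \<beta>'\<close> is supported in a compact subrectangle.\<close>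

lemma mixed_weak_deriv_product:
  fixes u g :: "real \<times> real \<Rightarrow> real"
  assumes w: "has_weak_deriv ({0<..<\<Lambda>} \<times> {0<..<t}) [(1, 0), (0, 1)] u g"
    and \<alpha>: "test_function {0<..<\<Lambda>} \<alpha>" and \<beta>: "test_function {0<..<t} \<beta>" and pos: "0 < \<Lambda>" "0 < t"
  shows "set_integrable lborel ({0<..<\<Lambda>} \<times> {0<..<t}) (\<lambda>(y, s). u (y, s) * (deriv \<alpha> y * deriv \<beta> s))"
    and "(LINT p:{0<..<\<Lambda>} \<times> {0<..<t}|lborel. (\<lambda>(y, s). u (y, s) * (deriv \<alpha> y * deriv \<beta> s)) p)
      = (LINT p:{0<..<\<Lambda>} \<times> {0<..<t}|lborel. (\<lambda>(y, s). g (y, s) * (\<alpha> y * \<beta> s)) p)"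
proof -
  have d\<alpha>: "test_function {0<..<\<Lambda>} (deriv \<alpha>)" and d\<beta>: "test_function {0<..<t} (deriv \<beta>)"
    using test_function_deriv \<alpha> \<beta> pos by blast+
  obtain a b where ab: "0 < a" "b < \<Lambda>" "a \<le> b" "\<And>x. x \<notin> {a..b} \<Longrightarrow> deriv \<alpha> x = 0"
    using interval_test_functionE[OF d\<alpha> pos(1)] by blast
  obtain c d where cd: "0 < c" "d < t" "c \<le> d" "\<And>x. x \<notin> {c..d} \<Longrightarrow> deriv \<beta> x = 0"
    using interval_test_functionE[OF d\<beta> pos(2)] by blast
  have cont: "continuous_on S (deriv \<alpha>)" "continuous_on S (deriv \<beta>)" for S
    using smooth_continuous test_function_smooth d\<alpha> d\<beta> by blast+
  have K: "compact ({a..b} \<times> {c..d})" by (intro compact_Times compact_Icc)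
  have c2: "continuous_on UNIV (\<lambda>p :: real \<times> real. deriv \<alpha> (fst p) * deriv \<beta> (snd p))"
    by (intro continuous_intros continuous_on_compose2[OF cont(1)[of UNIV]] continuous_on_compose2[OF cont(2)[of UNIV]]) auto
  obtain C where C: "\<And>p. p \<in> {a..b} \<times> {c..d} \<Longrightarrow> norm (deriv \<alpha> (fst p) * deriv \<beta> (snd p)) \<le> C"
    using compact_imp_bounded[OF compact_continuous_image[OF continuous_on_subset[OF c2] K]]
    unfolding bounded_iff by blast
  have "set_integrable lborel ({0<..<\<Lambda>} \<times> {0<..<t}) (\<lambda>p. u p * (deriv \<alpha> (fst p) * deriv \<beta> (snd p)))"
  proof (rule set_integrable_mult_supported)
    show "set_integrable lborel ({a..b} \<times> {c..d}) u"
      using w K ab cd unfolding has_weak_deriv_def L1_loc_def by fastforce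
    show "set_borel_measurable lborel ({a..b} \<times> {c..d}) (\<lambda>p. deriv \<alpha> (fst p) * deriv \<beta> (snd p))"
      unfolding set_borel_measurable_def
      using borel_measurable_continuous_onI[OF c2] borel_compact[OF K] by (auto intro!: borel_measurable_scaleR)
    show "\<bar>deriv \<alpha> (fst p) * deriv \<beta> (snd p)\<bar> \<le> C" if "p \<in> {a..b} \<times> {c..d}" for p using C[OF that] by simp
    show "{a..b} \<times> {c..d} \<subseteq> {0<..<\<Lambda>} \<times> {0<..<t}" using ab cd by auto
    show "deriv \<alpha> (fst p) * deriv \<beta> (snd p) = 0" if "p \<notin> {a..b} \<times> {c..d}" for p
      using that ab(4)[of "fst p"] cd(4)[of "snd p"] by (cases p) auto
  qed
  then show "set_integrable lborel ({0<..<\<Lambda>} \<times> {0<..<t}) (\<lambda>(y, s). u (y, s) * (deriv \<alpha> y * deriv \<beta> s))"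
    by (simp add: case_prod_unfold)
  have "(LINT p:{0<..<\<Lambda>} \<times> {0<..<t}|lborel. u p * partials [(1, 0), (0, 1)] (\<lambda>p. \<alpha> (fst p) * \<beta> (snd p)) p)
      = (- 1) ^ length [(1, 0), (0, 1) :: real \<times> real] * (LINT p:{0<..<\<Lambda>} \<times> {0<..<t}|lborel. g p * (\<alpha> (fst p) * \<beta> (snd p)))"
    using w test_function_product[OF \<alpha> \<beta> pos] unfolding has_weak_deriv_def by blast
  then show "(LINT p:{0<..<\<Lambda>} \<times> {0<..<t}|lborel. (\<lambda>(y, s). u (y, s) * (deriv \<alpha> y * deriv \<beta> s)) p)
      = (LINT p:{0<..<\<Lambda>} \<times> {0<..<t}|lborel. (\<lambda>(y, s). g (y, s) * (\<alpha> y * \<beta> s)) p)"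
    unfolding partials_product[OF test_function_smooth[OF \<alpha>] test_function_smooth[OF \<beta>]]
    by (simp add: case_prod_unfold)
qed

lemma L2_inner_continuous_in_time:
  fixes l :: "real \<Rightarrow> real \<Rightarrow> real"
  assumes L: "\<And>s. 0 \<le> s \<Longrightarrow> L2 U (l s)"
    and c: "\<And>s. 0 \<le> s \<Longrightarrow> ((\<lambda>r. L2_norm U (\<lambda>y. l r y - l s y)) \<longlongrightarrow> 0) (at s within {0..})"
    and v: "L2 U v"
  shows "continuous_on {0..} (\<lambda>s. LBINT y:U. l s y * v y)"
  unfolding continuous_on_def
proof
  fix s :: real assume "s \<in> {0..}"
  then have s: "0 \<le> s" by simp
  have "((\<lambda>r. (LBINT y:U. l r y * v y) - (LBINT y:U. l s y * v y)) \<longlongrightarrow> 0) (at s within {0..})"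
  proof (rule Lim_null_comparison)
    show "((\<lambda>r. L2_norm U (\<lambda>y. l r y - l s y) * L2_norm U v) \<longlongrightarrow> 0) (at s within {0..})"
      using tendsto_mult[OF c[OF s] tendsto_const] by simp
    have "\<bar>(LBINT y:U. l r y * v y) - (LBINT y:U. l s y * v y)\<bar> \<le> L2_norm U (\<lambda>y. l r y - l s y) * L2_norm U v"
      if r: "0 \<le> r" for r
    proof -
      have "(LBINT y:U. l r y * v y) - (LBINT y:U. l s y * v y) = L2_inner U (\<lambda>y. l r y - l s y) v"
        unfolding L2_inner_def left_diff_distrib
        by (rule set_integral_diff(2)[symmetric]; intro L2_mult_integrable L v r s)
      then show ?thesis using L2_inner_abs_le[OF L2_diff[OF L[OF r] L[OF s]] v] by simp
    qed
    then show "\<forall>\<^sub>F r in at s within {0..}. norm ((LBINT y:U. l r y * v y) - (LBINT y:U. l s y * v y))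
        \<le> L2_norm U (\<lambda>y. l r y - l s y) * L2_norm U v"
      by (auto simp: eventually_at_filter)
  qed
  then show "((\<lambda>s. LBINT y:U. l s y * v y) \<longlongrightarrow> (LBINT y:U. l s y * v y)) (at s within {0..})"
    by (simp add: LIM_zero_iff)
qed

text \<open>Moments of \<open>y \<mapsto> - \<integral>_y^\<Lambda> p\<close> are expressed by \<open>p\<close> itself.  This reduces questions on the
measurability and integrability of such moments in a further variable to Fubini's theorem for \<open>p\<close>.\<close>

lemma tail_integration_by_parts:
  fixes p \<psi> :: "real \<Rightarrow> real"
  assumes \<Lambda>: "0 < \<Lambda>" and p: "set_integrable lborel {0<..<\<Lambda>} p" and \<psi>: "continuous_on {0..\<Lambda>} \<psi>"
  shows "(LBINT y:{0<..<\<Lambda>}. - (LBINT z:{y<..<\<Lambda>}. p z) * \<psi> y)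
    = - (LBINT z:{0<..<\<Lambda>}. p z * (LBINT y:{0<..<z}. \<psi> y))"
proof -
  let ?P = "\<lambda>y. LBINT z:{0<..<y}. p z"
  note \<psi>i = set_integrable_continuous[OF \<psi>]
  have i: "set_integrable lborel {0<..<\<Lambda>} (\<lambda>y. \<psi> y * ?P y)"
    by (rule set_integrable_mult_continuous[OF \<psi>i primitive_continuous[OF p]])
  have "(LBINT y:{0<..<\<Lambda>}. - (LBINT z:{y<..<\<Lambda>}. p z) * \<psi> y)
    = (LBINT y:{0<..<\<Lambda>}. \<psi> y * ?P y - ?P \<Lambda> * \<psi> y)"
  proof (rule set_lebesgue_integral_cong, simp, intro allI impI)
    fix y assume "y \<in> {0<..<\<Lambda>}"
    then have e: "(LBINT z:{y<..<\<Lambda>}. p z) = ?P \<Lambda> - ?P y" by (intro tail_integral_continuous[OF p]) auto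
    show "- (LBINT z:{y<..<\<Lambda>}. p z) * \<psi> y = \<psi> y * ?P y - ?P \<Lambda> * \<psi> y"
      unfolding e by (simp add: algebra_simps)
  qed
  also have "\<dots> = (LBINT y:{0<..<\<Lambda>}. \<psi> y * ?P y) - ?P \<Lambda> * (LBINT y:{0<..<\<Lambda>}. \<psi> y)"
    by (subst set_integral_diff(2)[OF i set_integrable_mult_right[OF \<psi>i]]) simp
  finally show ?thesis using primitive_integration_by_parts[OF p \<psi>i] by simp
qed

lemma rectangle_emeasure_finite:
  "emeasure lborel ({a<..<b} \<times> {c<..<d::real}) < \<infinity>" for a b :: real
proof -
  have "emeasure lborel ({a<..<b} \<times> {c<..<d}) = emeasure lborel {a<..<b} * emeasure lborel {c<..<d}"
    unfolding lborel_prod[symmetric] by (rule lborel.emeasure_pair_measure_Times) auto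
  then show ?thesis using interval_emeasure_finite[of a b] interval_emeasure_finite[of c d]
    by (simp add: ennreal_mult_less_top)
qed

lemma set_integrable_rectangle_mult_fst:
  fixes g :: "real \<times> real \<Rightarrow> real"
  assumes g: "set_integrable lborel ({a<..<b} \<times> B) g" and \<phi>: "continuous_on {a..b} \<phi>" and B: "B \<in> sets borel"
  shows "set_integrable lborel ({a<..<b} \<times> B) (\<lambda>(z, r). g (z, r) * \<phi> z)"
proof -
  obtain C where C: "\<And>x. x \<in> {a..b} \<Longrightarrow> \<bar>\<phi> x\<bar> \<le> C"
    using continuous_interval_bounded[OF \<phi>] by blast
  have [measurable]: "(\<lambda>y. indicator {a<..<b} y * \<phi> y) \<in> borel_measurable borel"
    using set_borel_measurable_continuous[OF \<phi>] by (simp add: set_borel_measurable_def)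
  have "(\<lambda>p. indicator B (snd p) * (indicator {a<..<b} (fst p) * \<phi> (fst p))) \<in> borel_measurable (lborel \<Otimes>\<^sub>M lborel)"
    using B by measurable
  also have "(\<lambda>p. indicator B (snd p) * (indicator {a<..<b} (fst p) * \<phi> (fst p)))
    = (\<lambda>p. indicator ({a<..<b} \<times> B) p *\<^sub>R \<phi> (fst p))"
    by (auto simp: indicator_def fun_eq_iff)
  finally have "set_borel_measurable lborel ({a<..<b} \<times> B) (\<lambda>p. \<phi> (fst p))"
    unfolding set_borel_measurable_def lborel_prod .
  from set_integrable_mult_bounded[OF g this, of C] C
  have "set_integrable lborel ({a<..<b} \<times> B) (\<lambda>p. g p * \<phi> (fst p))" by fastforce
  then show ?thesis by (simp add: case_prod_unfold)
qed

text \<open>What the representation of the solution uses of the heat equation: continuity in time with values in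
\<open>L^2\<close>, the boundary condition at almost every time, and a square-integrable mixed derivative \<open>g\<close> up
to time \<open>t\<close>.  The function \<open>f0\<close> is the continuous representative of the initial value.\<close>

locale mixed_regular_evolution =
  fixes \<Lambda> t :: real and l :: "real \<Rightarrow> real \<Rightarrow> real" and f0 :: "real \<Rightarrow> real" and g :: "real \<times> real \<Rightarrow> real"
  assumes \<Lambda>: "0 < \<Lambda>" and t: "0 < t"
    and l_L2: "\<And>s. 0 \<le> s \<Longrightarrow> L2 {0<..<\<Lambda>} (l s)"
    and l_cont: "\<And>s. 0 \<le> s \<Longrightarrow> ((\<lambda>r. L2_norm {0<..<\<Lambda>} (\<lambda>y. l r y - l s y)) \<longlongrightarrow> 0) (at s within {0..})"
    and l_V: "AE s\<in>{0<..<t} in lborel. l s \<in> V_space \<Lambda>"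
    and f0_cont: "continuous_on {0..\<Lambda>} f0"
    and l_init: "AE y\<in>{0<..<\<Lambda>} in lborel. l 0 y = f0 y"
    and g_L2: "L2 ({0<..<\<Lambda>} \<times> {0<..<t}) g"
    and mixed: "has_weak_deriv ({0<..<\<Lambda>} \<times> {0<..<t}) [(1, 0), (0, 1)] (\<lambda>(y, s). l s y) g"
begin

text \<open>The time derivative of \<open>l\<close>, recovered from its space derivative \<open>g\<close> and its zero value at \<open>\<Lambda>\<close>.\<close>

definition time_deriv :: "real \<Rightarrow> real \<Rightarrow> real" where
  "time_deriv y r = - (LBINT z:{y<..<\<Lambda>}. g (z, r))"

definition increment :: "real \<Rightarrow> real \<Rightarrow> real" where
  "increment y s = (LBINT r:{0<..<s}. time_deriv y r)"

text \<open>The scalar product of the time derivative with \<open>\<psi>\<close> after an integration by parts in space (lemma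
\<open>moment_eq\<close>).  In this form it is integrable in time by Fubini's theorem on a rectangle.\<close>

definition moment :: "(real \<Rightarrow> real) \<Rightarrow> real \<Rightarrow> real" where
  "moment \<psi> r = - (LBINT z:{0<..<\<Lambda>}. g (z, r) * (LBINT y:{0<..<z}. \<psi> y))"

lemma g_int: "set_integrable lborel ({0<..<\<Lambda>} \<times> {0<..<t}) g"
  by (rule L2_imp_integrable[OF g_L2 _ rectangle_emeasure_finite]) (auto simp: borel_Times)

lemma g_rect:
  assumes "0 \<le> y" "s \<le> t"
  shows "set_integrable lborel ({y<..<\<Lambda>} \<times> {0<..<s}) (\<lambda>(z, r). g (z, r))"
proof -
  have "set_integrable lborel ({y<..<\<Lambda>} \<times> {0<..<s}) g"
    by (rule set_integrable_subset[OF g_int]) (use assms in \<open>auto simp: borel_Times\<close>)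
  then show ?thesis by simp
qed

lemma time_deriv_integrable: "0 \<le> y \<Longrightarrow> set_integrable lborel {0<..<t} (time_deriv y)"
  using rectangle_Fubini(4)[OF g_rect[of y t]] unfolding time_deriv_def
  by (metis (no_types, lifting) order_refl set_integrable_mult_right[where a = "-1"] mult_minus1 set_integrable_cong)

lemma increment_eq_tail:
  assumes "0 \<le> y" "s \<le> t"
  shows "increment y s = - (LBINT z:{y<..<\<Lambda>}. (LBINT r:{0<..<s}. g (z, r)))"
proof -
  have "set_integrable lborel {0<..<s} (\<lambda>r. LBINT z:{y<..<\<Lambda>}. g (z, r))"
    by (rule rectangle_Fubini(4)[OF g_rect[OF assms]])
  then have "increment y s = - (LBINT r:{0<..<s}. (LBINT z:{y<..<\<Lambda>}. g (z, r)))"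
    unfolding increment_def time_deriv_def by (rule set_integral_uminus)
  then show ?thesis using rectangle_Fubini(5,6)[OF g_rect[OF assms]] by simp
qed

lemma G_integrable: "s \<le> t \<Longrightarrow> set_integrable lborel {0<..<\<Lambda>} (\<lambda>z. LBINT r:{0<..<s}. g (z, r))"
  using rectangle_Fubini(2)[OF g_rect[of 0 s]] by simp

lemma increment_continuous: "s \<le> t \<Longrightarrow> continuous_on {0..\<Lambda>} (\<lambda>y. increment y s)"
proof -
  assume s: "s \<le> t"
  let ?G = "\<lambda>z. LBINT r:{0<..<s}. g (z, r)"
  have "continuous_on {0..\<Lambda>} (\<lambda>y. (LBINT z:{0<..<y}. ?G z) - (LBINT z:{0<..<\<Lambda>}. ?G z))"
    by (intro continuous_intros primitive_continuous G_integrable s)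
  moreover have "increment y s = (LBINT z:{0<..<y}. ?G z) - (LBINT z:{0<..<\<Lambda>}. ?G z)" if "y \<in> {0..\<Lambda>}" for y
    using increment_eq_tail[of y s] tail_integral_continuous[OF G_integrable[OF s] that] that s by simp
  ultimately show ?thesis by (subst continuous_on_cong[OF refl]) auto
qed

lemma increment_end: "increment \<Lambda> s = 0"
  by (simp add: increment_def time_deriv_def set_lebesgue_integral_def)

lemma increment_start: "increment y 0 = 0"
  by (simp add: increment_def set_lebesgue_integral_def)

lemma moment_rect:
  assumes "continuous_on {0..\<Lambda>} \<psi>" "s \<le> t"
  shows "set_integrable lborel ({0<..<\<Lambda>} \<times> {0<..<s}) (\<lambda>(z, r). g (z, r) * (LBINT y:{0<..<z}. \<psi> y))"
  by (rule set_integrable_rectangle_mult_fst[OF _ primitive_continuous[OF set_integrable_continuous[OF assms(1)]]])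
     (use g_rect[of 0 s] assms(2) in auto)

lemma moment_integrable:
  assumes "continuous_on {0..\<Lambda>} \<psi>"
  shows "set_integrable lborel {0<..<t} (moment \<psi>)"
  using rectangle_Fubini(4)[OF moment_rect[OF assms order_refl]] unfolding moment_def
  by (metis (no_types, lifting) set_integrable_mult_right[where a = "-1"] mult_minus1 set_integrable_cong)

lemma increment_moment:
  assumes \<psi>: "continuous_on {0..\<Lambda>} \<psi>" and s: "s \<le> t"
  shows "(LBINT y:{0<..<\<Lambda>}. increment y s * \<psi> y) = (LBINT r:{0<..<s}. moment \<psi> r)"
proof -
  let ?\<Psi> = "\<lambda>z. LBINT y:{0<..<z}. \<psi> y" and ?G = "\<lambda>z. LBINT r:{0<..<s}. g (z, r)"
  have "(LBINT y:{0<..<\<Lambda>}. increment y s * \<psi> y) = (LBINT y:{0<..<\<Lambda>}. - (LBINT z:{y<..<\<Lambda>}. ?G z) * \<psi> y)"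
    by (rule set_lebesgue_integral_cong) (auto simp: increment_eq_tail s)
  also have "\<dots> = - (LBINT z:{0<..<\<Lambda>}. ?G z * ?\<Psi> z)"
    by (rule tail_integration_by_parts[OF \<Lambda> G_integrable[OF s] \<psi>])
  also have "(LBINT z:{0<..<\<Lambda>}. ?G z * ?\<Psi> z) = (LBINT z:{0<..<\<Lambda>}. (LBINT r:{0<..<s}. g (z, r) * ?\<Psi> z))"
    by simp
  also have "\<dots> = (LBINT r:{0<..<s}. (LBINT z:{0<..<\<Lambda>}. g (z, r) * ?\<Psi> z))"
    using rectangle_Fubini(5,6)[OF moment_rect[OF \<psi> s]] by simp
  also have "- \<dots> = (LBINT r:{0<..<s}. moment \<psi> r)"
    unfolding moment_def
    by (rule set_integral_uminus[symmetric, OF rectangle_Fubini(4)[OF moment_rect[OF \<psi> s]]])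
  finally show ?thesis .
qed

lemma moment_eq:
  assumes \<psi>: "continuous_on {0..\<Lambda>} \<psi>" and r: "set_integrable lborel {0<..<\<Lambda>} (\<lambda>z. g (z, r))"
  shows "moment \<psi> r = (LBINT y:{0<..<\<Lambda>}. time_deriv y r * \<psi> y)"
  unfolding moment_def time_deriv_def using tail_integration_by_parts[OF \<Lambda> r \<psi>] by simp

text \<open>Testing the mixed derivative with \<open>\<alpha> y * \<beta> s\<close> and varying \<open>\<beta>\<close> shows that \<open>- \<integral> g \<alpha> dy\<close> is the weak
time derivative of the continuous function \<open>s \<mapsto> \<integral> l s \<alpha>' dy\<close>.\<close>

lemma time_increment_tested:
  assumes \<alpha>: "test_function {0<..<\<Lambda>} \<alpha>" and s: "s \<in> {0..t}"
  shows "(LBINT y:{0<..<\<Lambda>}. l s y * deriv \<alpha> y)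
    = (LBINT y:{0<..<\<Lambda>}. l 0 y * deriv \<alpha> y) + (LBINT r:{0<..<s}. - (LBINT y:{0<..<\<Lambda>}. g (y, r) * \<alpha> y))"
proof (rule weak_deriv_continuous_primitive[OF t _ _ _ s, where f = "\<lambda>s. LBINT y:{0<..<\<Lambda>}. l s y * deriv \<alpha> y"])
  have sm: "smooth \<alpha>" "smooth (deriv \<alpha>)"
    using \<alpha> by (auto intro: test_function_smooth smooth_deriv)
  have "L2 {0<..<\<Lambda>} (deriv \<alpha>)" by (rule continuous_imp_L2[OF smooth_continuous[OF sm(2)]])
  then show "continuous_on {0..t} (\<lambda>s. LBINT y:{0<..<\<Lambda>}. l s y * deriv \<alpha> y)"
    by (intro continuous_on_subset[OF L2_inner_continuous_in_time[OF l_L2 l_cont]]) auto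
  have ga: "set_integrable lborel ({0<..<\<Lambda>} \<times> {0<..<t}) (\<lambda>(y, r). g (y, r) * \<alpha> y)"
    by (rule set_integrable_rectangle_mult_fst[OF g_int smooth_continuous[OF sm(1)]]) auto
  note gi = rectangle_Fubini(4)[OF ga]
  show "set_integrable lborel {0<..<t} (\<lambda>r. - (LBINT y:{0<..<\<Lambda>}. g (y, r) * \<alpha> y))"
    using set_integrable_mult_right[OF gi, of "-1"] by simp
  fix \<beta> assume \<beta>: "test_function {0<..<t} \<beta>"
  note m = mixed_weak_deriv_product[OF mixed \<alpha> \<beta> \<Lambda> t]
  have c\<beta>: "continuous_on S \<beta>" for S by (rule smooth_continuous[OF test_function_smooth[OF \<beta>]])
  have gab: "set_integrable lborel ({0<..<\<Lambda>} \<times> {0<..<t}) (\<lambda>(y, r). g (y, r) * (\<alpha> y * \<beta> r))"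
  proof -
    obtain C where C: "\<And>x. x \<in> {0..t} \<Longrightarrow> \<bar>\<beta> x\<bar> \<le> C"
      using continuous_interval_bounded[OF c\<beta>] by blast
    have [measurable]: "\<beta> \<in> borel_measurable borel" by (rule borel_measurable_continuous_onI[OF c\<beta>])
    have "set_borel_measurable lborel ({0<..<\<Lambda>} \<times> {0<..<t}) (\<lambda>p. \<beta> (snd p))"
      unfolding set_borel_measurable_def lborel_prod[symmetric] by measurable
    from set_integrable_mult_bounded[OF ga this, of C] C
    show ?thesis by (fastforce simp: case_prod_unfold mult.assoc)
  qed
  have "(LBINT s:{0<..<t}. (LBINT y:{0<..<\<Lambda>}. l s y * deriv \<alpha> y) * deriv \<beta> s)
    = (LBINT s:{0<..<t}. (LBINT y:{0<..<\<Lambda>}. l s y * (deriv \<alpha> y * deriv \<beta> s)))"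
    by (simp flip: mult.assoc)
  also have "\<dots> = (LINT p:{0<..<\<Lambda>} \<times> {0<..<t}|lborel. (\<lambda>(y, s). l s y * (deriv \<alpha> y * deriv \<beta> s)) p)"
    using rectangle_Fubini(6)[of "{0<..<\<Lambda>}" "{0<..<t}" "\<lambda>y s. l s y * (deriv \<alpha> y * deriv \<beta> s)"] m(1) by simp
  also have "\<dots> = (LINT p:{0<..<\<Lambda>} \<times> {0<..<t}|lborel. (\<lambda>(y, s). g (y, s) * (\<alpha> y * \<beta> s)) p)"
    using m(2) by simp
  also have "\<dots> = (LBINT s:{0<..<t}. (LBINT y:{0<..<\<Lambda>}. g (y, s) * (\<alpha> y * \<beta> s)))"
    by (rule rectangle_Fubini(6)[OF gab, symmetric])
  also have "\<dots> = (LBINT s:{0<..<t}. (LBINT y:{0<..<\<Lambda>}. g (y, s) * \<alpha> y) * \<beta> s)"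
    by (simp flip: mult.assoc)
  also have "\<dots> = - (LBINT s:{0<..<t}. - (LBINT y:{0<..<\<Lambda>}. g (y, s) * \<alpha> y) * \<beta> s)"
    using set_integral_uminus[OF set_integrable_mult_smooth[OF gi test_function_smooth[OF \<beta>]]] by simp
  finally show "(LBINT s:{0<..<t}. (LBINT y:{0<..<\<Lambda>}. l s y * deriv \<alpha> y) * deriv \<beta> s)
    = - (LBINT s:{0<..<t}. - (LBINT y:{0<..<\<Lambda>}. g (y, s) * \<alpha> y) * \<beta> s)" .
qed

text \<open>By the tested identity \<open>\<integral>_0^s g\<close> is the weak space derivative of \<open>l s - l 0\<close>, and a weak derivative
determines the function up to a constant.\<close>

lemma time_increment_up_to_constant:
  assumes s: "s \<in> {0..t}"
  shows "\<exists>c. AE y\<in>{0<..<\<Lambda>} in lborel. l s y = f0 y + c + increment y s"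
proof -
  have s0: "0 \<le> s" "s \<le> t" using s by auto
  let ?G = "\<lambda>z. LBINT r:{0<..<s}. g (z, r)"
  have D: "set_integrable lborel {0<..<\<Lambda>} (\<lambda>y. l s y - l 0 y)"
    by (intro L2_interval_integrable L2_diff l_L2 s0) simp
  obtain c where c: "AE y\<in>{0<..<\<Lambda>} in lborel. l s y - l 0 y = c + (LBINT z:{0<..<y}. ?G z)"
  proof (rule du_Bois_Reymond[OF \<Lambda> D G_integrable[OF s0(2)]])
    fix \<alpha> assume \<alpha>: "test_function {0<..<\<Lambda>} \<alpha>"
    note sm = test_function_smooth[OF \<alpha>]
    have c\<alpha>: "continuous_on {0..\<Lambda>} \<alpha>" by (rule smooth_continuous[OF sm])
    have ga: "set_integrable lborel ({0<..<\<Lambda>} \<times> {0<..<s}) (\<lambda>(y, r). g (y, r) * \<alpha> y)"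
      by (rule set_integrable_rectangle_mult_fst[OF _ c\<alpha>]) (use g_rect[of 0 s] s0 in auto)
    have i: "set_integrable lborel {0<..<\<Lambda>} (\<lambda>y. l r y * deriv \<alpha> y)" if "0 \<le> r" for r
      by (rule set_integrable_mult_smooth[OF L2_interval_integrable[OF l_L2[OF that]] smooth_deriv[OF sm]])
    have "(LBINT y:{0<..<\<Lambda>}. (l s y - l 0 y) * deriv \<alpha> y)
      = (LBINT y:{0<..<\<Lambda>}. l s y * deriv \<alpha> y) - (LBINT y:{0<..<\<Lambda>}. l 0 y * deriv \<alpha> y)"
      unfolding left_diff_distrib by (rule set_integral_diff(2)[OF i[OF s0(1)] i[OF order_refl]])
    also have "\<dots> = (LBINT r:{0<..<s}. - (LBINT y:{0<..<\<Lambda>}. g (y, r) * \<alpha> y))"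
      using time_increment_tested[OF \<alpha> s] by simp
    also have "\<dots> = - (LBINT r:{0<..<s}. (LBINT y:{0<..<\<Lambda>}. g (y, r) * \<alpha> y))"
      by (rule set_integral_uminus[OF rectangle_Fubini(4)[OF ga]])
    also have "(LBINT r:{0<..<s}. (LBINT y:{0<..<\<Lambda>}. g (y, r) * \<alpha> y)) = (LBINT y:{0<..<\<Lambda>}. (LBINT r:{0<..<s}. g (y, r) * \<alpha> y))"
      using rectangle_Fubini(5,6)[OF ga] by simp
    finally show "(LBINT y:{0<..<\<Lambda>}. (l s y - l 0 y) * deriv \<alpha> y) = - (LBINT y:{0<..<\<Lambda>}. ?G y * \<alpha> y)" by simp
  qed
  have "AE y\<in>{0<..<\<Lambda>} in lborel. l s y = f0 y + (c + (LBINT z:{0<..<\<Lambda>}. ?G z)) + increment y s"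
    using c l_init
  proof eventually_elim
    case (elim y)
    show ?case
    proof
      assume y: "y \<in> {0<..<\<Lambda>}"
      then have "increment y s = - ((LBINT z:{0<..<\<Lambda>}. ?G z) - (LBINT z:{0<..<y}. ?G z))"
        using increment_eq_tail[of y s] tail_integral_continuous[OF G_integrable[OF s0(2)], of y] s0 by simp
      then show "l s y = f0 y + (c + (LBINT z:{0<..<\<Lambda>}. ?G z)) + increment y s" using elim y by simp
    qed
  qed
  then show ?thesis by blast
qed

lemma integral_AE_eq:
  assumes s: "s \<in> {0..t}" and \<psi>: "continuous_on {0..\<Lambda>} \<psi>"
    and e: "AE y\<in>{0<..<\<Lambda>} in lborel. l s y = f0 y + c + increment y s"
  shows "(LBINT y:{0<..<\<Lambda>}. l s y * \<psi> y) = (LBINT y:{0<..<\<Lambda>}. f0 y * \<psi> y)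
    + c * (LBINT y:{0<..<\<Lambda>}. \<psi> y) + (LBINT r:{0<..<s}. moment \<psi> r)"
proof -
  have s0: "0 \<le> s" "s \<le> t" using s by auto
  have i1: "set_integrable lborel {0<..<\<Lambda>} (\<lambda>y. f0 y * \<psi> y)"
    by (intro set_integrable_continuous continuous_on_mult f0_cont \<psi>)
  have i2: "set_integrable lborel {0<..<\<Lambda>} (\<lambda>y. c * \<psi> y)"
    by (intro set_integrable_continuous continuous_on_mult continuous_on_const \<psi>)
  have i3: "set_integrable lborel {0<..<\<Lambda>} (\<lambda>y. increment y s * \<psi> y)"
    by (intro set_integrable_continuous continuous_on_mult increment_continuous s0 \<psi>)
  note i12 = set_integral_add(1)[OF i1 i2]
  have "(LBINT y:{0<..<\<Lambda>}. l s y * \<psi> y) = (LBINT y:{0<..<\<Lambda>}. f0 y * \<psi> y + c * \<psi> y + increment y s * \<psi> y)"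
  proof (rule set_integral_cong_AE_restricted)
    show "set_borel_measurable lborel {0<..<\<Lambda>} (\<lambda>y. l s y * \<psi> y)"
      by (rule set_integrable_imp_measurable[OF set_integrable_mult_continuous[OF L2_interval_integrable[OF l_L2[OF s0(1)]] \<psi>]])
    show "set_borel_measurable lborel {0<..<\<Lambda>} (\<lambda>y. f0 y * \<psi> y + c * \<psi> y + increment y s * \<psi> y)"
      by (rule set_integrable_imp_measurable[OF set_integral_add(1)[OF i12 i3]])
    show "AE y\<in>{0<..<\<Lambda>} in lborel. l s y * \<psi> y = f0 y * \<psi> y + c * \<psi> y + increment y s * \<psi> y"
      using e by (rule eventually_mono) (auto simp: algebra_simps)
  qed
  also have "\<dots> = (LBINT y:{0<..<\<Lambda>}. f0 y * \<psi> y) + (LBINT y:{0<..<\<Lambda>}. c * \<psi> y) + (LBINT y:{0<..<\<Lambda>}. increment y s * \<psi> y)"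
    by (simp only: set_integral_add(2)[OF i12 i3] set_integral_add(2)[OF i1 i2])
  finally show ?thesis by (simp add: increment_moment[OF \<psi> s0(2)])
qed

text \<open>The constant \<open>C s\<close> in the increment is a continuous function of \<open>s\<close> because \<open>C s * \<Lambda>\<close>, the function
\<open>?k\<close> below, is composed of continuous moments.  For almost every \<open>s\<close> the trace of \<open>l s\<close> at \<open>\<Lambda>\<close> is
\<open>0\<close>, which forces \<open>C s = - f0 \<Lambda>\<close>.  So \<open>C\<close> is constant, and \<open>C 0 = 0\<close>.\<close>

lemma evolution_representation:
  shows "f0 \<Lambda> = 0" and "s \<in> {0..t} \<Longrightarrow> AE y\<in>{0<..<\<Lambda>} in lborel. l s y = f0 y + increment y s"
proof -
  obtain C where C: "\<And>s. s \<in> {0..t} \<Longrightarrow> AE y\<in>{0<..<\<Lambda>} in lborel. l s y = f0 y + C s + increment y s"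
    using time_increment_up_to_constant by metis
  have c1: "continuous_on {0..\<Lambda>} (\<lambda>y. 1 :: real)" by (rule continuous_on_const)
  have L1: "L2 {0<..<\<Lambda>} (\<lambda>y. 1)" by (rule L2_const) (use interval_emeasure_finite in auto)
  let ?k = "\<lambda>s. (LBINT y:{0<..<\<Lambda>}. l s y * 1) - (LBINT y:{0<..<\<Lambda>}. f0 y * 1) - (LBINT r:{0<..<s}. moment (\<lambda>y. 1) r)"
  have k: "?k s = C s * \<Lambda>" if "s \<in> {0..t}" for s
    using integral_AE_eq[OF that c1 C[OF that]] \<Lambda> set_integral_const_interval[of 0 \<Lambda> 1] by simp
  have kc: "continuous_on {0..t} ?k"
    by (intro continuous_on_diff continuous_on_const primitive_continuous moment_integrable c1
        continuous_on_subset[OF L2_inner_continuous_in_time[OF l_L2 l_cont L1]]) auto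
  have ae: "AE s\<in>{0<..<t} in lborel. ?k s = - f0 \<Lambda> * \<Lambda>"
    using l_V
  proof eventually_elim
    case (elim s)
    show ?case
    proof
      assume s: "s \<in> {0<..<t}"
      then have V: "l s \<in> V_space \<Lambda>" and s': "s \<in> {0..t}" "s \<le> t" using elim by auto
      have "l s \<Lambda> = f0 \<Lambda> + C s + increment \<Lambda> s"
        by (rule AE_eq_imp_eq_continuous[OF \<Lambda> V_space_D(2)[OF V] _ C[OF s'(1)]])
           (use \<Lambda> s' in \<open>auto intro!: continuous_intros f0_cont increment_continuous\<close>)
      then have "C s = - f0 \<Lambda>" using V_space_D(3)[OF V] increment_end by simp
      then show "?k s = - f0 \<Lambda> * \<Lambda>" using k[OF s'(1)] by simp
    qed
  qed
  have kk: "?k s = - f0 \<Lambda> * \<Lambda>" if "s \<in> {0..t}" for s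
    by (rule AE_eq_imp_eq_continuous[OF t kc continuous_on_const ae that])
  have "?k 0 = 0"
  proof -
    have "AE y\<in>{0<..<\<Lambda>} in lborel. l 0 y = f0 y + 0 + increment y 0" using l_init by (simp add: increment_start)
    from integral_AE_eq[OF _ c1 this] t show ?thesis by simp
  qed
  then show f0: "f0 \<Lambda> = 0" using kk[of 0] t \<Lambda> by simp
  show "AE y\<in>{0<..<\<Lambda>} in lborel. l s y = f0 y + increment y s" if s: "s \<in> {0..t}"
  proof -
    have "C s = 0" using k[OF s] kk[OF s] f0 \<Lambda> by simp
    then show ?thesis using C[OF s] by simp
  qed
qed

lemma evolution_representation_V:
  "AE s\<in>{0<..<t} in lborel. l s \<in> V_space \<Lambda> \<and> (\<forall>y\<in>{0..\<Lambda>}. l s y = f0 y + increment y s)"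
  using l_V
proof eventually_elim
  case (elim s)
  show ?case
  proof (intro impI conjI ballI)
    assume s: "s \<in> {0<..<t}"
    then show V: "l s \<in> V_space \<Lambda>" using elim by simp
    fix y assume y: "y \<in> {0..\<Lambda>}"
    show "l s y = f0 y + increment y s"
      by (rule AE_eq_imp_eq_continuous[OF \<Lambda> V_space_D(2)[OF V] _ evolution_representation(2) y])
         (use s in \<open>auto intro!: continuous_intros f0_cont increment_continuous\<close>)
  qed
qed

lemma evolution_representation_inner:
  assumes s: "s \<in> {0..t}" and \<psi>: "continuous_on {0..\<Lambda>} \<psi>"
  shows "(LBINT y:{0<..<\<Lambda>}. l s y * \<psi> y) = (LBINT y:{0<..<\<Lambda>}. l 0 y * \<psi> y) + (LBINT r:{0<..<s}. moment \<psi> r)"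
proof -
  have e: "AE y\<in>{0<..<\<Lambda>} in lborel. l r y = f0 y + 0 + increment y r" if "r \<in> {0..t}" for r
    using evolution_representation(2)[OF that] by simp
  have "(LBINT y:{0<..<\<Lambda>}. l r y * \<psi> y) = (LBINT y:{0<..<\<Lambda>}. f0 y * \<psi> y)
      + 0 * (LBINT y:{0<..<\<Lambda>}. \<psi> y) + (LBINT x:{0<..<r}. moment \<psi> x)" if "r \<in> {0..t}" for r
    by (rule integral_AE_eq[OF that \<psi> e[OF that]])
  from this[OF s] this[of 0] t
  show ?thesis by (simp add: set_lebesgue_integral_def)
qed

end


section \<open>Energy estimate\<close>

lemma set_integral_sum:
  fixes f :: "'i \<Rightarrow> 'a \<Rightarrow> real"
  assumes "finite I" "\<And>i. i \<in> I \<Longrightarrow> set_integrable M A (f i)"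
  shows "set_integrable M A (\<lambda>x. \<Sum>i\<in>I. f i x)"
    and "(LINT x:A|M. (\<Sum>i\<in>I. f i x)) = (\<Sum>i\<in>I. LINT x:A|M. f i x)"
proof -
  have i: "integrable M (\<lambda>x. indicator A x *\<^sub>R f i x)" if "i \<in> I" for i
    using assms(2)[OF that] by (simp only: set_integrable_def)
  show "set_integrable M A (\<lambda>x. \<Sum>i\<in>I. f i x)"
    unfolding set_integrable_def scaleR_sum_right by (rule Bochner_Integration.integrable_sum[OF i])
  show "(LINT x:A|M. (\<Sum>i\<in>I. f i x)) = (\<Sum>i\<in>I. LINT x:A|M. f i x)"
    unfolding set_lebesgue_integral_def scaleR_sum_right by (rule Bochner_Integration.integral_sum[OF i])
qed

text \<open>The energy identity \<open>(f^2)' = 2 f' f\<close> in integrated form.\<close>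

lemma square_of_primitive:
  fixes f p :: "real \<Rightarrow> real"
  assumes T: "0 \<le> T" and p: "set_integrable lborel {0<..<T} p"
    and f: "\<And>s. s \<in> {0..T} \<Longrightarrow> f s = f 0 + (LBINT r:{0<..<s}. p r)"
  shows "set_integrable lborel {0<..<T} (\<lambda>r. p r * f r)"
    and "(f T)\<^sup>2 = (f 0)\<^sup>2 + 2 * (LBINT r:{0<..<T}. p r * f r)"
proof -
  let ?P = "\<lambda>s. LBINT r:{0<..<s}. p r"
  have cP: "continuous_on {0..T} ?P" by (rule primitive_continuous[OF p])
  have cf: "continuous_on {0..T} f"
    by (rule continuous_on_cong[THEN iffD2, OF refl f continuous_on_add[OF continuous_on_const cP]])
  show "set_integrable lborel {0<..<T} (\<lambda>r. p r * f r)"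
    by (rule set_integrable_mult_continuous[OF p cf])
  have i: "set_integrable lborel {0<..<T} (\<lambda>r. p r * ?P r)"
    by (rule set_integrable_mult_continuous[OF p cP])
  have "(LBINT r:{0<..<T}. p r * f r) = (LBINT r:{0<..<T}. p r * ?P r + f 0 * p r)"
  proof (rule set_lebesgue_integral_cong, simp, intro allI impI)
    fix r assume "r \<in> {0<..<T}"
    then have e: "f r = f 0 + ?P r" by (intro f) auto
    show "p r * f r = p r * ?P r + f 0 * p r" unfolding e by (simp add: algebra_simps)
  qed
  also have "\<dots> = (LBINT r:{0<..<T}. p r * ?P r) + f 0 * ?P T"
    by (subst set_integral_add(2)[OF i set_integrable_mult_right[OF p]]) simp
  finally have 1: "(LBINT r:{0<..<T}. p r * f r) = (LBINT r:{0<..<T}. p r * ?P r) + f 0 * ?P T" .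
  have 2: "?P T * ?P T = 2 * (LBINT r:{0<..<T}. p r * ?P r)"
    using primitive_integration_by_parts[OF p p] by simp
  have "f T = f 0 + ?P T" using T by (intro f) auto
  then show "(f T)\<^sup>2 = (f 0)\<^sup>2 + 2 * (LBINT r:{0<..<T}. p r * f r)"
    using 1 2 by (simp add: power2_eq_square algebra_simps)
qed

lemma h_inner_eq_mesh_sum:
  "h_inner \<Lambda> N u v = \<Lambda> / real N * (\<Sum>j<N. u (mesh \<Lambda> N j) * v (mesh \<Lambda> N j))"
  by (simp add: h_inner_def sum.atLeast1_atMost_eq node_Suc)

text \<open>Agrees with \<open>kappa u v\<close> for every \<open>u\<close> in the energy space as soon as \<open>v\<close> lies in the discrete space; \<open>a\<close> and
\<open>b\<close> are the nodal values of \<open>u\<close> and \<open>v\<close>.\<close>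

definition mesh_kappa :: "real \<Rightarrow> real \<Rightarrow> real \<Rightarrow> real \<Rightarrow> nat \<Rightarrow> (nat \<Rightarrow> real) \<Rightarrow> (nat \<Rightarrow> real) \<Rightarrow> real" where
  "mesh_kappa \<Lambda> K atilde a1 N a b =
     \<Lambda>\<^sup>2 * K * (mesh_form N a b / (\<Lambda> / real N)) + \<Lambda> * K * atilde / (2 * a1) * a 0 * b 0"

lemma kappa_eq_mesh_kappa:
  assumes "u \<in> V_space \<Lambda>" "\<psi> \<in> Vh_space \<Lambda> N" "0 < \<Lambda>" "N \<ge> 1"
  shows "kappa \<Lambda> K atilde a1 u \<psi>
    = mesh_kappa \<Lambda> K atilde a1 N (\<lambda>j. u (mesh \<Lambda> N j)) (\<lambda>j. \<psi> (mesh \<Lambda> N j))"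
  unfolding kappa_def mesh_kappa_def V_inner_Vh_space[OF assms] by simp

lemma mesh_kappa_diff_left:
  "mesh_kappa \<Lambda> K atilde a1 N (\<lambda>j. a j - b j) c = mesh_kappa \<Lambda> K atilde a1 N a c - mesh_kappa \<Lambda> K atilde a1 N b c"
proof -
  have "mesh_form N (\<lambda>j. a j - b j) c = mesh_form N a c - mesh_form N b c"
    unfolding mesh_form_def sum_subtractf[symmetric] by (rule sum.cong) (auto simp: algebra_simps)
  moreover have "x * ((A - B) / k) + y * (p - q) * d = (x * (A / k) + y * p * d) - (x * (B / k) + y * q * d)"
    for x y A B k p q d :: real by (simp add: diff_divide_distrib algebra_simps)
  ultimately show ?thesis unfolding mesh_kappa_def by (simp only:)
qed

lemma mesh_kappa_sum_right:
  fixes n :: nat and b :: "nat \<Rightarrow> nat \<Rightarrow> real"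
  shows "mesh_kappa \<Lambda> K atilde a1 N a (\<lambda>j. \<Sum>i<n. v i * b i j) = (\<Sum>i<n. v i * mesh_kappa \<Lambda> K atilde a1 N a (b i))"
proof (induction n)
  case 0
  show ?case by (simp add: mesh_kappa_def mesh_form_def)
next
  case (Suc n)
  have "mesh_form N a (\<lambda>j. c j + x * d j) = mesh_form N a c + x * mesh_form N a d" for c d and x :: real
    unfolding mesh_form_def sum_distrib_left sum.distrib[symmetric] by (rule sum.cong) (auto simp: algebra_simps)
  moreover have "y * ((A + x * B) / k) + z * (p + x * q) = (y * (A / k) + z * p) + x * (y * (B / k) + z * q)"
    for x y A B k p q z :: real by (simp add: add_divide_distrib algebra_simps)
  ultimately have "mesh_kappa \<Lambda> K atilde a1 N a (\<lambda>j. c j + x * d j)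
    = mesh_kappa \<Lambda> K atilde a1 N a c + x * mesh_kappa \<Lambda> K atilde a1 N a d" for c d and x :: real
    unfolding mesh_kappa_def by (simp only:)
  then show ?case using Suc by simp
qed

lemma mesh_kappa_cong:
  assumes "\<And>j. j \<le> N \<Longrightarrow> b j = c j"
  shows "mesh_kappa \<Lambda> K atilde a1 N a b = mesh_kappa \<Lambda> K atilde a1 N a c"
proof -
  have "mesh_form N a b = mesh_form N a c"
    unfolding mesh_form_def by (rule sum.cong) (auto simp: assms)
  then show ?thesis unfolding mesh_kappa_def using assms[of 0] by simp
qed

lemma mesh_kappa_continuous:
  assumes "\<And>j. j \<le> N \<Longrightarrow> continuous_on S (\<lambda>r. a r j)"
  shows "continuous_on S (\<lambda>r. mesh_kappa \<Lambda> K atilde a1 N (a r) b)"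
  unfolding mesh_kappa_def mesh_form_def divide_inverse
  by (intro continuous_intros continuous_on_sum) (auto intro: assms)

lemma mesh_variation_squared_le:
  fixes \<theta> :: "nat \<Rightarrow> real"
  shows "(\<Sum>j<N. \<bar>\<theta> (Suc j) - \<theta> j\<bar>)\<^sup>2 \<le> real N * mesh_form N \<theta> \<theta>"
proof -
  have "(\<Sum>j<N. \<bar>\<theta> (Suc j) - \<theta> j\<bar> * 1)\<^sup>2 \<le> (\<Sum>j<N. \<bar>\<theta> (Suc j) - \<theta> j\<bar>\<^sup>2) * (\<Sum>j<N. 1\<^sup>2)"
    by (rule Cauchy_Schwarz_ineq_sum)
  then show ?thesis by (simp add: mesh_form_def power2_eq_square mult.commute)
qed

text \<open>Young's inequality \<open>2 (h \<gamma>) \<sigma> \<le> (h \<gamma>)^2 / c + c \<sigma>^2\<close> with \<open>c = \<Lambda> K\<close>: as \<open>h N = \<Lambda>\<close>, this is the value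
for which \<open>c N D\<close> equals the Dirichlet part \<open>\<Lambda>^2 K D / h\<close> of the form.\<close>

lemma defect_absorbed_by_coercivity:
  fixes h K \<Lambda> \<gamma> \<sigma> D b :: real
  assumes "0 < \<Lambda>" "0 < K" "N \<ge> 1" "\<sigma>\<^sup>2 \<le> real N * D" "\<gamma>\<^sup>2 \<le> \<Lambda> * G" "0 \<le> b"
  shows "2 * (\<Lambda> / real N) * \<gamma> * \<sigma> - (\<Lambda>\<^sup>2 * K * (D / (\<Lambda> / real N)) + b) \<le> (\<Lambda> / real N)\<^sup>2 / K * G"
proof -
  obtain h where h: "h = \<Lambda> / real N" "0 < h" using assms(1,3) by simp
  have hN: "h * real N = \<Lambda>" using h assms by simp
  let ?c = "\<Lambda> * K"
  have c: "0 < ?c" using assms by simp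
  have "0 \<le> (h * \<gamma> - ?c * \<sigma>)\<^sup>2 / ?c" using c by simp
  also have "\<dots> = (h * \<gamma>)\<^sup>2 / ?c - 2 * h * \<gamma> * \<sigma> + ?c * \<sigma>\<^sup>2"
  proof -
    have "(h * \<gamma> - c * \<sigma>)\<^sup>2 / c = (h * \<gamma>)\<^sup>2 / c - 2 * h * \<gamma> * \<sigma> + c * \<sigma>\<^sup>2" if "0 < c" for c
      using that by (simp add: power2_eq_square field_simps)
    from this[OF c] show ?thesis .
  qed
  finally have "2 * h * \<gamma> * \<sigma> \<le> (h * \<gamma>)\<^sup>2 / ?c + ?c * \<sigma>\<^sup>2" by simp
  also have "?c * \<sigma>\<^sup>2 \<le> ?c * (real N * D)" by (rule mult_left_mono[OF assms(4)]) (use c in auto)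
  also have "?c * (real N * D) = \<Lambda>\<^sup>2 * K * (D / h)"
    using h(2) unfolding hN[symmetric] by (simp add: power2_eq_square)
  also have "(h * \<gamma>)\<^sup>2 / ?c = h\<^sup>2 / ?c * \<gamma>\<^sup>2" by (simp add: power_mult_distrib)
  also have "h\<^sup>2 / ?c * \<gamma>\<^sup>2 \<le> h\<^sup>2 / ?c * (\<Lambda> * G)" by (rule mult_left_mono[OF assms(5)]) (use c in auto)
  also have "h\<^sup>2 / ?c * (\<Lambda> * G) = h\<^sup>2 / K * G" using assms by simp
  finally show ?thesis unfolding h(1)[symmetric] using assms(6) by linarith
qed

context mixed_regular_evolution
begin

lemma g_slice_L2:
  "AE r\<in>{0<..<t} in lborel. L2 {0<..<\<Lambda>} (\<lambda>z. g (z, r))"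
proof -
  have "set_integrable lborel ({0<..<\<Lambda>} \<times> {0<..<t}) (\<lambda>(z, r). (g (z, r))\<^sup>2)"
    using g_L2 by (simp add: L2_def case_prod_unfold)
  from rectangle_Fubini(3)[OF this] rectangle_Fubini(3)[OF g_rect[of 0 t, OF order_refl order_refl]]
  show ?thesis by eventually_elim (auto simp: L2_def intro: set_integrable_imp_measurable)
qed

lemma g_square_iterated:
  shows "set_integrable lborel {0<..<t} (\<lambda>r. LBINT z:{0<..<\<Lambda>}. (g (z, r))\<^sup>2)"
    and "(LBINT r:{0<..<t}. (LBINT z:{0<..<\<Lambda>}. (g (z, r))\<^sup>2)) = (L2_norm ({0<..<\<Lambda>} \<times> {0<..<t}) g)\<^sup>2"
proof -
  have i: "set_integrable lborel ({0<..<\<Lambda>} \<times> {0<..<t}) (\<lambda>(z, r). (g (z, r))\<^sup>2)"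
    using g_L2 by (simp add: L2_def case_prod_unfold)
  show "set_integrable lborel {0<..<t} (\<lambda>r. LBINT z:{0<..<\<Lambda>}. (g (z, r))\<^sup>2)" by (rule rectangle_Fubini(4)[OF i])
  show "(LBINT r:{0<..<t}. (LBINT z:{0<..<\<Lambda>}. (g (z, r))\<^sup>2)) = (L2_norm ({0<..<\<Lambda>} \<times> {0<..<t}) g)\<^sup>2"
    using rectangle_Fubini(6)[OF i] by (simp add: L2_norm_squared case_prod_unfold)
qed

lemma increment_continuous_in_time: "0 \<le> y \<Longrightarrow> continuous_on {0..t} (increment y)"
  using primitive_continuous[OF time_deriv_integrable] by (simp add: increment_def[abs_def])

text \<open>For almost every time the form \<open>kappa\<close> sees only the nodal values of the solution, which are
continuous in time.  So the weak time derivative of \<open>(l s, \<psi>)\<close> is almost everywhere equal to a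
continuous function and can be integrated from time \<open>0\<close> on.\<close>

lemma weak_equation_integrated:
  fixes F :: "real \<Rightarrow> real"
  assumes \<psi>: "\<psi> \<in> Vh_space \<Lambda> N" and N: "N \<ge> 1" and F: "continuous_on {0..t} F"
    and w: "has_weak_deriv {0<..<t} [1] (\<lambda>s. L2_inner {0<..<\<Lambda>} (l s) \<psi>)
      (\<lambda>s. F s * \<psi> 0 - kappa \<Lambda> K atilde a1 (l s) \<psi>)"
    and s: "s \<in> {0..t}"
  shows "(LBINT r:{0<..<s}. moment \<psi> r) = (LBINT r:{0<..<s}. F r * \<psi> 0 -
    mesh_kappa \<Lambda> K atilde a1 N (\<lambda>j. f0 (mesh \<Lambda> N j) + increment (mesh \<Lambda> N j) r) (\<lambda>j. \<psi> (mesh \<Lambda> N j)))"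
proof -
  define R where "R = (\<lambda>r. F r * \<psi> 0 -
    mesh_kappa \<Lambda> K atilde a1 N (\<lambda>j. f0 (mesh \<Lambda> N j) + increment (mesh \<Lambda> N j) r) (\<lambda>j. \<psi> (mesh \<Lambda> N j)))"
  let ?R = "\<lambda>s. F s * \<psi> 0 - kappa \<Lambda> K atilde a1 (l s) \<psi>"
  have c\<psi>: "continuous_on {0..\<Lambda>} \<psi>" using \<psi> by (simp add: Vh_space_iff)
  have cR: "continuous_on {0..t} R"
    unfolding R_def using mesh_bounds(1)[OF \<Lambda> N]
    by (intro continuous_intros mesh_kappa_continuous F increment_continuous_in_time) auto
  have ae: "AE r\<in>{0<..<t} in lborel. ?R r = R r"
    using evolution_representation_V
  proof eventually_elim
    case (elim r)
    show ?case
    proof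
      assume "r \<in> {0<..<t}"
      then have V: "l r \<in> V_space \<Lambda>" and e: "\<And>y. y \<in> {0..\<Lambda>} \<Longrightarrow> l r y = f0 y + increment y r" using elim by auto
      have "mesh_form N (\<lambda>j. l r (mesh \<Lambda> N j)) b = mesh_form N (\<lambda>j. f0 (mesh \<Lambda> N j) + increment (mesh \<Lambda> N j) r) b" for b
        unfolding mesh_form_def
        by (rule sum.cong) (use mesh_bounds[OF \<Lambda> N] in \<open>auto simp: e\<close>)
      moreover have "l r 0 = f0 0 + increment 0 r" using \<Lambda> by (intro e) auto
      ultimately show "?R r = R r"
        unfolding R_def kappa_eq_mesh_kappa[OF V \<psi> \<Lambda> N] mesh_kappa_def by simp
    qed
  qed
  have "L2_inner {0<..<\<Lambda>} (l s) \<psi> = L2_inner {0<..<\<Lambda>} (l 0) \<psi> + (LBINT r:{0<..<s}. R r)"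
  proof (rule weak_deriv_continuous_primitive[OF t _ set_integrable_continuous[OF cR] _ s])
    show "continuous_on {0..t} (\<lambda>s. L2_inner {0<..<\<Lambda>} (l s) \<psi>)"
      unfolding L2_inner_def
      by (rule continuous_on_subset[OF L2_inner_continuous_in_time[OF l_L2 l_cont Vh_space_L2[OF \<psi>]]]) auto
    fix \<phi> assume \<phi>: "test_function {0<..<t} \<phi>"
    have c\<phi>: "continuous_on S \<phi>" for S by (rule smooth_continuous[OF test_function_smooth[OF \<phi>]])
    obtain a b where ab: "0 < a" "b < t" "a \<le> b" "\<And>x. x \<notin> {a..b} \<Longrightarrow> \<phi> x = 0"
      using interval_test_functionE[OF \<phi> t] by blast
    obtain C where C: "\<And>x. x \<in> {a..b} \<Longrightarrow> \<bar>\<phi> x\<bar> \<le> C"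
      using continuous_interval_bounded[OF c\<phi>] by blast
    have i: "set_integrable lborel {0<..<t} (\<lambda>r. ?R r * \<phi> r)"
    proof (rule set_integrable_mult_supported)
      show "set_integrable lborel {a..b} ?R"
      proof -
        have "L1_loc {0<..<t} ?R" using w unfolding has_weak_deriv_def by blast
        moreover have "{a..b} \<subseteq> {0<..<t}" using ab by auto
        ultimately show ?thesis unfolding L1_loc_def using compact_Icc by blast
      qed
      show "set_borel_measurable lborel {a..b} \<phi>"
        by (rule set_integrable_imp_measurable[OF borel_integrable_atLeastAtMost'[OF c\<phi>]])
    qed (use C ab in auto)
    have "(LBINT r:{0<..<t}. ?R r * \<phi> r) = (LBINT r:{0<..<t}. R r * \<phi> r)"
      by (rule set_integral_cong_AE_restricted[OF set_integrable_imp_measurable[OF i]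
            set_integrable_imp_measurable[OF set_integrable_mult_continuous[OF set_integrable_continuous[OF cR] c\<phi>]]])
         (use ae in \<open>auto elim: eventually_mono\<close>)
    then show "(LBINT s:{0<..<t}. L2_inner {0<..<\<Lambda>} (l s) \<psi> * deriv \<phi> s) = - (LBINT r:{0<..<t}. R r * \<phi> r)"
      using weak_deriv_D[OF w \<phi>] by simp
  qed
  then show ?thesis using evolution_representation_inner[OF s c\<psi>] by (simp add: L2_inner_def R_def)
qed

text \<open>The nodal errors \<open>\<theta> s j\<close> are primitives of integrable functions \<open>p j\<close>, obtained by testing the
discrete and the continuous equation with the hat functions and subtracting.  In
\<open>\<Sum> h p_j \<theta>_j\<close> the hat functions recombine to the interpolant of \<open>\<theta>\<close>; what remains is the
quadrature error for the time derivative minus \<open>kappa\<close> on the diagonal.\<close>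

lemma energy_estimate:
  fixes F :: "real \<Rightarrow> real" and lh dl :: "real \<Rightarrow> real \<Rightarrow> real"
  assumes N: "N \<ge> 1" and pos: "0 < K" "0 < atilde" "0 < a1" and F: "continuous_on {0..t} F"
    and w: "\<And>\<psi>. \<psi> \<in> Vh_space \<Lambda> N \<Longrightarrow> has_weak_deriv {0<..<t} [1] (\<lambda>s. L2_inner {0<..<\<Lambda>} (l s) \<psi>)
      (\<lambda>s. F s * \<psi> 0 - kappa \<Lambda> K atilde a1 (l s) \<psi>)"
    and lh: "\<And>s. 0 \<le> s \<Longrightarrow> lh s \<in> Vh_space \<Lambda> N"
    and dl: "\<And>y s. y \<in> {0..\<Lambda>} \<Longrightarrow> 0 \<le> s \<Longrightarrow> ((\<lambda>s. lh s y) has_real_derivative dl s y) (at s within {0..})"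
    and dl_cont: "\<And>y. y \<in> {0..\<Lambda>} \<Longrightarrow> continuous_on {0..} (\<lambda>s. dl s y)"
    and eq: "\<And>\<psi> s. \<psi> \<in> Vh_space \<Lambda> N \<Longrightarrow> 0 \<le> s \<Longrightarrow>
      h_inner \<Lambda> N (dl s) \<psi> + kappa \<Lambda> K atilde a1 (lh s) \<psi> = F s * \<psi> 0"
  defines "\<theta> \<equiv> \<lambda>s j. lh s (mesh \<Lambda> N j) - (f0 (mesh \<Lambda> N j) + increment (mesh \<Lambda> N j) s)"
  shows "\<Lambda> / real N * (\<Sum>j<N. (\<theta> t j)\<^sup>2) \<le> \<Lambda> / real N * (\<Sum>j<N. (\<theta> 0 j)\<^sup>2)
    + 2 * (\<Lambda> / real N)\<^sup>2 / K * (L2_norm ({0<..<\<Lambda>} \<times> {0<..<t}) g)\<^sup>2"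
proof -
  obtain h where h: "h = \<Lambda> / real N" and h0: "0 < h" using \<Lambda> N by simp
  let ?x = "mesh \<Lambda> N" and ?k = "mesh_kappa \<Lambda> K atilde a1 N"
  let ?U = "\<lambda>r j. f0 (?x j) + increment (?x j) r" and ?e = "\<lambda>i j. hat \<Lambda> N i (?x j)"
  have x: "?x j \<in> {0..\<Lambda>}" if "j \<le> N" for j using mesh_bounds[OF \<Lambda> N that] by simp
  have c_lh: "continuous_on {0..t} (\<lambda>s. lh s y)" if "y \<in> {0..\<Lambda>}" for y
  proof (rule continuous_on_subset)
    show "continuous_on {0..} (\<lambda>s. lh s y)"
      unfolding continuous_on_eq_continuous_within by (intro ballI DERIV_continuous[OF dl[OF that]]) simp
  qed auto
  have c_U: "continuous_on {0..t} (\<lambda>s. ?U s j)" if "j \<le> N" for j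
    using x[OF that] by (intro continuous_intros increment_continuous_in_time) auto
  have c_\<theta>: "continuous_on {0..t} (\<lambda>s. \<theta> s j)" if "j \<le> N" for j
    unfolding \<theta>_def by (intro continuous_on_diff c_lh x c_U that)
  have chat: "continuous_on {0..\<Lambda>} (hat \<Lambda> N i)" if "i < N" for i
    using hat_in_Vh_space[OF \<Lambda> N that] by (simp add: Vh_space_iff)
  define p where "p = (\<lambda>i r. (1 / h) * moment (hat \<Lambda> N i) r - time_deriv (?x i) r - (1 / h) * ?k (\<theta> r) (?e i))"
  have mi: "set_integrable lborel {0<..<s} (moment (hat \<Lambda> N i))" if "i < N" "s \<le> t" for i s
    by (rule set_integrable_subset[OF moment_integrable[OF chat[OF that(1)]]]) (use that in auto)
  have Wi: "set_integrable lborel {0<..<s} (time_deriv (?x i))" if "i < N" "s \<le> t" for i s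
    by (rule set_integrable_subset[OF time_deriv_integrable]) (use x[of i] that in auto)
  have ki: "set_integrable lborel {0<..<s} (\<lambda>r. ?k (a r) (?e i))"
    if "s \<le> t" "\<And>j. j \<le> N \<Longrightarrow> continuous_on {0..t} (\<lambda>r. a r j)" for i s a
    by (rule set_integrable_subset[OF set_integrable_continuous[OF mesh_kappa_continuous[of N "{0..t}" a]]])
       (use that in auto)
  have p_int: "set_integrable lborel {0<..<s} (p i)" if "i < N" "s \<le> t" for i s
    unfolding p_def by (intro set_integral_diff(1) set_integrable_mult_right mi Wi ki that c_\<theta>)
  have \<theta>_prim: "\<theta> s i = \<theta> 0 i + (LBINT r:{0<..<s}. p i r)" if i: "i < N" and s: "s \<in> {0..t}" for i s
  proof -
    have s0: "0 \<le> s" "s \<le> t" using s by auto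
    note E = hat_in_Vh_space[OF \<Lambda> N i]
    have xi: "?x i \<in> {0..\<Lambda>}" using x i by simp
    have d: "h * dl r (?x i) = F r * hat \<Lambda> N i 0 - ?k (\<lambda>j. lh r (?x j)) (?e i)" if "0 \<le> r" for r
    proof -
      have "(\<Sum>j<N. dl r (?x j) * ?e i j) = (\<Sum>j<N. if i = j then dl r (?x j) else 0)"
        by (rule sum.cong) (auto simp: hat_mesh[OF \<Lambda> N])
      also have "\<dots> = dl r (?x i)" using i by simp
      finally have "(\<Sum>j<N. dl r (?x j) * ?e i j) = dl r (?x i)" .
      then have "h_inner \<Lambda> N (dl r) (hat \<Lambda> N i) = h * dl r (?x i)"
        unfolding h_inner_eq_mesh_sum h by simp
      then show ?thesis
        using eq[OF E that] kappa_eq_mesh_kappa[OF Vh_space_subset_V_space[OF lh[OF that] \<Lambda> N] E \<Lambda> N]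
        by simp
    qed
    have dc: "continuous_on {0..s} (\<lambda>r. dl r (?x i))"
      by (rule continuous_on_subset[OF dl_cont[OF xi]]) auto
    have ih: "set_integrable lborel {0<..<s} (\<lambda>r. ?k (\<lambda>j. lh r (?x j)) (?e i))"
      by (rule ki[OF s0(2)]) (intro c_lh x)
    have iU: "set_integrable lborel {0<..<s} (\<lambda>r. ?k (?U r) (?e i))"
      by (rule ki[OF s0(2) c_U])
    have iF: "set_integrable lborel {0<..<s} (\<lambda>r. F r * hat \<Lambda> N i 0)"
      by (rule set_integrable_continuous) (intro continuous_intros continuous_on_subset[OF F], use s0 in auto)
    have 1: "lh s (?x i) - lh 0 (?x i) = (LBINT r:{0<..<s}. dl r (?x i))"
    proof (rule set_integral_FTC[OF s0(1) _ dc, symmetric])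
      show "((\<lambda>s. lh s (?x i)) has_real_derivative dl r (?x i)) (at r within {0..s})" if "r \<in> {0..s}" for r
        by (rule DERIV_subset[OF dl[OF xi]]) (use that in auto)
    qed
    have "h * (LBINT r:{0<..<s}. dl r (?x i)) = (LBINT r:{0<..<s}. h * dl r (?x i))" by simp
    also have "\<dots> = (LBINT r:{0<..<s}. F r * hat \<Lambda> N i 0 - ?k (\<lambda>j. lh r (?x j)) (?e i))"
      by (rule set_lebesgue_integral_cong) (auto simp: d)
    also have "\<dots> = (LBINT r:{0<..<s}. F r * hat \<Lambda> N i 0) - (LBINT r:{0<..<s}. ?k (\<lambda>j. lh r (?x j)) (?e i))"
      by (rule set_integral_diff(2)[OF iF ih])
    finally have 2: "h * (LBINT r:{0<..<s}. dl r (?x i))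
      = (LBINT r:{0<..<s}. F r * hat \<Lambda> N i 0) - (LBINT r:{0<..<s}. ?k (\<lambda>j. lh r (?x j)) (?e i))" .
    have 3: "(LBINT r:{0<..<s}. moment (hat \<Lambda> N i) r)
      = (LBINT r:{0<..<s}. F r * hat \<Lambda> N i 0) - (LBINT r:{0<..<s}. ?k (?U r) (?e i))"
      using weak_equation_integrated[OF E N F w[OF E] s] set_integral_diff(2)[OF iF iU] by simp
    have 4: "(LBINT r:{0<..<s}. ?k (\<theta> r) (?e i))
      = (LBINT r:{0<..<s}. ?k (\<lambda>j. lh r (?x j)) (?e i)) - (LBINT r:{0<..<s}. ?k (?U r) (?e i))"
      unfolding \<theta>_def mesh_kappa_diff_left by (rule set_integral_diff(2)[OF ih iU])
    have m': "set_integrable lborel {0<..<s} (\<lambda>r. (1 / h) * moment (hat \<Lambda> N i) r)"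
      and k': "set_integrable lborel {0<..<s} (\<lambda>r. (1 / h) * ?k (\<theta> r) (?e i))"
      by (intro set_integrable_mult_right mi[OF i s0(2)] ki[OF s0(2) c_\<theta>])+
    have "(LBINT r:{0<..<s}. p i r) = (LBINT r:{0<..<s}. (1 / h) * moment (hat \<Lambda> N i) r) - (LBINT r:{0<..<s}. time_deriv (?x i) r)
      - (LBINT r:{0<..<s}. (1 / h) * ?k (\<theta> r) (?e i))"
      unfolding p_def
      by (subst set_integral_diff(2)[OF set_integral_diff(1)[OF m' Wi[OF i s0(2)]] k'],
          subst set_integral_diff(2)[OF m' Wi[OF i s0(2)]], rule refl)
    then have "(LBINT r:{0<..<s}. p i r) = (1 / h) * (LBINT r:{0<..<s}. moment (hat \<Lambda> N i) r) - increment (?x i) s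
      - (1 / h) * (LBINT r:{0<..<s}. ?k (\<theta> r) (?e i))"
      by (simp only: set_integral_mult_right increment_def)
    also have "\<dots> = (1 / h) * (h * (LBINT r:{0<..<s}. dl r (?x i))) - increment (?x i) s"
      unfolding 2 3 4 by (simp add: algebra_simps diff_divide_distrib)
    also have "\<dots> = (lh s (?x i) - lh 0 (?x i)) - increment (?x i) s" using 1 h0 by simp
    finally show ?thesis by (simp add: \<theta>_def increment_start)
  qed
  have sq: "(\<theta> t i)\<^sup>2 = (\<theta> 0 i)\<^sup>2 + 2 * (LBINT r:{0<..<t}. p i r * \<theta> r i)"
    and sqi: "set_integrable lborel {0<..<t} (\<lambda>r. p i r * \<theta> r i)" if "i < N" for i
    using square_of_primitive[of t "p i" "\<lambda>s. \<theta> s i", OF _ p_int[OF that order_refl] \<theta>_prim[OF that]] t by auto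
  let ?R = "\<lambda>r. \<Sum>i<N. h * (p i r * \<theta> r i)"
  have Ri: "set_integrable lborel {0<..<t} ?R"
    by (rule set_integral_sum(1)) (use sqi in auto)
  have "h * (\<Sum>i<N. (\<theta> t i)\<^sup>2) = h * (\<Sum>i<N. (\<theta> 0 i)\<^sup>2) + 2 * (\<Sum>i<N. h * (LBINT r:{0<..<t}. p i r * \<theta> r i))"
    by (simp add: sq sum.distrib sum_distrib_left algebra_simps)
  also have "(\<Sum>i<N. h * (LBINT r:{0<..<t}. p i r * \<theta> r i)) = (LBINT r:{0<..<t}. ?R r)"
    by (subst set_integral_sum(2)) (use sqi in auto)
  finally have energy: "h * (\<Sum>i<N. (\<theta> t i)\<^sup>2) = h * (\<Sum>i<N. (\<theta> 0 i)\<^sup>2) + 2 * (LBINT r:{0<..<t}. ?R r)" .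
  have "(LBINT r:{0<..<t}. ?R r) \<le> (LBINT r:{0<..<t}. h\<^sup>2 / K * (LBINT z:{0<..<\<Lambda>}. (g (z, r))\<^sup>2))"
  proof (rule set_integral_mono_AE[OF Ri set_integrable_mult_right[OF g_square_iterated(1)]])
    show "AE r\<in>{0<..<t} in lborel. ?R r \<le> h\<^sup>2 / K * (LBINT z:{0<..<\<Lambda>}. (g (z, r))\<^sup>2)"
      using g_slice_L2
    proof eventually_elim
      case (elim r)
      show ?case
      proof
        assume r: "r \<in> {0<..<t}"
        then have g2: "L2 {0<..<\<Lambda>} (\<lambda>z. g (z, r))" using elim by simp
        note gi = L2_interval_integrable[OF g2]
        let ?I = "interpolant \<Lambda> N (\<theta> r)"
        note IV = interpolant_in_Vh_space[OF \<Lambda> N, of "\<theta> r"]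
        have f0\<Lambda>: "f0 \<Lambda> = 0" by (rule evolution_representation(1))
        have \<theta>N: "\<theta> r N = 0"
          using Vh_space_end[OF lh N, of r] r f0\<Lambda> increment_end mesh_N[OF N, of \<Lambda>] by (simp add: \<theta>_def)
        have Ix: "?I (?x j) = \<theta> r j" if "j \<le> N" for j
          using interpolant_mesh[OF \<Lambda> N, of "\<theta> r" j] that \<theta>N by (cases "j = N") auto
        have cW: "continuous_on {0..\<Lambda>} (\<lambda>y. time_deriv y r)"
          unfolding time_deriv_def
          by (rule continuous_on_cong[THEN iffD2, OF refl _ continuous_on_minus[OF continuous_on_diff[OF continuous_on_const primitive_continuous[OF gi]]]])
             (rule arg_cong[where f = uminus, OF tail_integral_continuous[OF gi]])
        have "(\<Sum>i<N. \<theta> r i * moment (hat \<Lambda> N i) r) = (\<Sum>i<N. LBINT y:{0<..<\<Lambda>}. time_deriv y r * (\<theta> r i * hat \<Lambda> N i y))"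
          by (rule sum.cong) (simp_all add: moment_eq[OF chat gi] mult.left_commute)
        also have "\<dots> = (LBINT y:{0<..<\<Lambda>}. (\<Sum>i<N. time_deriv y r * (\<theta> r i * hat \<Lambda> N i y)))"
          by (rule set_integral_sum(2)[symmetric])
             (auto intro!: set_integrable_continuous continuous_intros cW chat)
        also have "\<dots> = (LBINT y:{0<..<\<Lambda>}. time_deriv y r * ?I y)" by (simp add: interpolant_def sum_distrib_left)
        finally have m: "(\<Sum>i<N. \<theta> r i * moment (hat \<Lambda> N i) r) = (LBINT y:{0<..<\<Lambda>}. time_deriv y r * ?I y)" .
        have "(\<Sum>i<N. \<theta> r i * ?k (\<theta> r) (?e i)) = ?k (\<theta> r) (\<lambda>j. ?I (?x j))"
          unfolding interpolant_def by (rule mesh_kappa_sum_right[symmetric])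
        also have "\<dots> = ?k (\<theta> r) (\<theta> r)" by (rule mesh_kappa_cong) (rule Ix)
        finally have k: "(\<Sum>i<N. \<theta> r i * ?k (\<theta> r) (?e i)) = ?k (\<theta> r) (\<theta> r)" .
        have "h * (p i r * \<theta> r i) = \<theta> r i * moment (hat \<Lambda> N i) r - h * (time_deriv (?x i) r * \<theta> r i) - \<theta> r i * ?k (\<theta> r) (?e i)" for i
          unfolding p_def using h0 by (simp add: field_simps)
        then have "?R r = (\<Sum>i<N. \<theta> r i * moment (hat \<Lambda> N i) r) - h * (\<Sum>i<N. time_deriv (?x i) r * \<theta> r i)
            - (\<Sum>i<N. \<theta> r i * ?k (\<theta> r) (?e i))"
          by (simp only: sum_subtractf sum_distrib_left)
        moreover have "(\<Sum>i<N. time_deriv (?x i) r * \<theta> r i) = (\<Sum>i<N. time_deriv (?x i) r * ?I (?x i))"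
          by (rule sum.cong) (auto simp: Ix)
        ultimately have R: "?R r = (LBINT y:{0<..<\<Lambda>}. time_deriv y r * ?I y) - h * (\<Sum>i<N. time_deriv (?x i) r * ?I (?x i)) - ?k (\<theta> r) (\<theta> r)"
          unfolding m k by simp
        have "(\<Sum>j<N. \<bar>?I (?x (Suc j)) - ?I (?x j)\<bar>) = (\<Sum>j<N. \<bar>\<theta> r (Suc j) - \<theta> r j\<bar>)"
          by (rule sum.cong) (auto simp: Ix)
        then have Q: "(LBINT y:{0<..<\<Lambda>}. time_deriv y r * ?I y) - h * (\<Sum>i<N. time_deriv (?x i) r * ?I (?x i))
          \<le> 2 * h * (LBINT z:{0<..<\<Lambda>}. \<bar>g (z, r)\<bar>) * (\<Sum>j<N. \<bar>\<theta> r (Suc j) - \<theta> r j\<bar>)"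
          using quadrature_error[OF \<Lambda> N gi IV] unfolding time_deriv_def h by simp
        have "2 * h * (LBINT z:{0<..<\<Lambda>}. \<bar>g (z, r)\<bar>) * (\<Sum>j<N. \<bar>\<theta> r (Suc j) - \<theta> r j\<bar>) - ?k (\<theta> r) (\<theta> r)
          \<le> h\<^sup>2 / K * (LBINT z:{0<..<\<Lambda>}. (g (z, r))\<^sup>2)"
          unfolding mesh_kappa_def h
        proof (rule defect_absorbed_by_coercivity[OF \<Lambda> pos(1) N mesh_variation_squared_le])
          show "(LBINT z:{0<..<\<Lambda>}. \<bar>g (z, r)\<bar>)\<^sup>2 \<le> \<Lambda> * (LBINT z:{0<..<\<Lambda>}. (g (z, r))\<^sup>2)"
            using L2_integral_abs_squared_le[OF g2] interval_emeasure_finite[of 0 \<Lambda>] \<Lambda> by simp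
          show "0 \<le> \<Lambda> * K * atilde / (2 * a1) * \<theta> r 0 * \<theta> r 0"
            using \<Lambda> pos by (simp add: mult.assoc)
        qed
        then show "?R r \<le> h\<^sup>2 / K * (LBINT z:{0<..<\<Lambda>}. (g (z, r))\<^sup>2)" using R Q by linarith
      qed
    qed
  qed
  also have "\<dots> = h\<^sup>2 / K * (L2_norm ({0<..<\<Lambda>} \<times> {0<..<t}) g)\<^sup>2"
    by (simp only: set_integral_mult_right g_square_iterated(2))
  finally show ?thesis unfolding h[symmetric] using energy by simp
qed

end


section \<open>The error estimate\<close>

lemma L2_norm_cong_AE:
  assumes "L2 U f" "L2 U g" "AE x in lborel. x \<in> U \<longrightarrow> f x = g x"
  shows "L2_norm U f = L2_norm U g"
proof -
  have "(LBINT x:U. f x * f x) = (LBINT x:U. g x * g x)"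
    by (rule set_integral_cong_AE_restricted[OF set_integrable_imp_measurable[OF L2_mult_integrable[OF assms(1,1)]]
          set_integrable_imp_measurable[OF L2_mult_integrable[OF assms(2,2)]]])
       (use assms(3) in \<open>auto elim: eventually_mono\<close>)
  then show ?thesis by (simp add: L2_norm_def L2_inner_def)
qed

text \<open>With \<open>(p + q)^2 \<le> 2 p^2 + 2 q^2\<close> the estimates can be combined at the level of squared norms, at the
price of a larger constant.\<close>

lemma L2_norm_squared_triangle:
  assumes "L2 U a" "L2 U b" "L2 U c"
  shows "(L2_norm U (\<lambda>x. a x - c x))\<^sup>2 \<le> 2 * (L2_norm U (\<lambda>x. a x - b x))\<^sup>2 + 2 * (L2_norm U (\<lambda>x. b x - c x))\<^sup>2"
proof -
  have i: "set_integrable lborel U (\<lambda>x. (f x - g x)\<^sup>2)" if "L2 U f" "L2 U g" for f g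
    using L2_diff[OF that] by (simp add: L2_def)
  note j = set_integrable_mult_right[where a = "2 :: real"]
  have "(LBINT x:U. (a x - c x)\<^sup>2) \<le> (LBINT x:U. 2 * (a x - b x)\<^sup>2 + 2 * (b x - c x)\<^sup>2)"
  proof (rule set_integral_mono)
    show "set_integrable lborel U (\<lambda>x. (a x - c x)\<^sup>2)" by (rule i[OF assms(1,3)])
    show "set_integrable lborel U (\<lambda>x. 2 * (a x - b x)\<^sup>2 + 2 * (b x - c x)\<^sup>2)"
      by (rule set_integral_add(1)[OF j[OF i[OF assms(1,2)]] j[OF i[OF assms(2,3)]]])
    fix x
    have "(p - r)\<^sup>2 \<le> 2 * (p - q)\<^sup>2 + 2 * (q - r)\<^sup>2" for p q r :: real
    proof -
      have "0 \<le> ((p - q) - (q - r))\<^sup>2" by simp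
      then show ?thesis by (simp add: power2_eq_square algebra_simps)
    qed
    then show "(a x - c x)\<^sup>2 \<le> 2 * (a x - b x)\<^sup>2 + 2 * (b x - c x)\<^sup>2" .
  qed
  also have "\<dots> = 2 * (LBINT x:U. (a x - b x)\<^sup>2) + 2 * (LBINT x:U. (b x - c x)\<^sup>2)"
    by (subst set_integral_add(2)[OF j[OF i[OF assms(1,2)]] j[OF i[OF assms(2,3)]]]) simp
  finally show ?thesis by (simp add: L2_norm_squared)
qed

lemma L2_second_deriv_primitive:
  fixes f :: "real \<Rightarrow> real"
  assumes "0 < \<Lambda>" "L2 {0<..<\<Lambda>} f" "has_L2_deriv {0<..<\<Lambda>} [1, 1] f"
  obtains c e where "AE x in lborel. x \<in> {0<..<\<Lambda>} \<longrightarrow>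
    f x = c + (LBINT z:{0<..<x}. e + (LBINT s:{0<..<z}. L2_deriv {0<..<\<Lambda>} [1, 1] f s))"
  using du_Bois_Reymond_second_order[OF assms(1) L2_interval_integrable[OF assms(2)]
      L2_interval_integrable[OF L2_deriv_spec(1)[OF assms(3)]] weak_deriv_second_D[OF L2_deriv_spec(2)[OF assms(3)]]]
  by blast

lemma double_primitive_continuous:
  fixes q :: "real \<Rightarrow> real"
  assumes "set_integrable lborel {0<..<\<Lambda>} q"
  shows "continuous_on {0..\<Lambda>} (\<lambda>x. c + (LBINT z:{0<..<x}. e + (LBINT s:{0<..<z}. q s)))"
  by (intro continuous_intros primitive_continuous set_integrable_continuous assms)

lemma root_sum_squares_le:
  fixes A x y z w :: real
  assumes "A\<^sup>2 \<le> x\<^sup>2 + y\<^sup>2 + z\<^sup>2 + w\<^sup>2" "0 \<le> x" "0 \<le> y" "0 \<le> z" "0 \<le> w"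
  shows "A \<le> x + y + z + w"
proof (rule power2_le_imp_le)
  have "0 \<le> x * y + x * z + x * w + y * z + y * w + z * w" using assms by simp
  then have "x\<^sup>2 + y\<^sup>2 + z\<^sup>2 + w\<^sup>2 \<le> (x + y + z + w)\<^sup>2" by (simp add: power2_eq_square algebra_simps)
  then show "A\<^sup>2 \<le> (x + y + z + w)\<^sup>2" using assms(1) by linarith
qed (use assms in simp)

lemma deriv_L0: "deriv (L0 L \<omega> \<epsilon>) s = - (L * \<epsilon> * \<omega> * sin (\<omega> * s))"
  by (rule DERIV_imp_deriv) (auto simp: L0_def[abs_def] intro!: derivative_eq_intros)

text \<open>The error is split at the interpolants of the exact solution at the times \<open>0\<close> and \<open>t\<close>.  In terms of
the squares of the four norms on the right-hand side the constants are \<open>24\<close>, \<open>24 h^4\<close>, \<open>2 h^4\<close> and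
\<open>4 h^2 / K\<close>, where \<open>24 = 2 * 6 * 2\<close> comes from the splitting at time \<open>t\<close>, the norm equivalence and the
splitting at time \<open>0\<close>; and \<open>5\<close> is at least \<open>sqrt 24\<close>.\<close>

lemma error_estimate_positive_time:
  assumes pos: "0 < \<Lambda>" "0 < K" "0 < atilde" "0 < a1" and N: "N \<ge> 1" and h: "h = \<Lambda> / real N" and t: "0 < t"
    and l0: "L2 {0<..<\<Lambda>} l0" "has_L2_deriv {0<..<\<Lambda>} [1, 1] l0"
    and sol: "weak_solution \<Lambda> K atilde a1 L \<omega> \<epsilon> l0 l"
    and l0h: "l0h \<in> Vh_space \<Lambda> N"
    and disc: "discrete_solution \<Lambda> K atilde a1 L \<omega> \<epsilon> N l0h lh"
    and lt: "has_L2_deriv {0<..<\<Lambda>} [1, 1] (l t)"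
    and lyt: "has_L2_deriv ({0<..<\<Lambda>} \<times> {0<..<t}) [(1, 0), (0, 1)] (\<lambda>(y, s). l s y)"
  shows "L2_norm {0<..<\<Lambda>} (\<lambda>y. lh t y - l t y) \<le> 5 * L2_norm {0<..<\<Lambda>} (\<lambda>y. l0h y - l0 y)
    + 5 * h\<^sup>2 * (L2_norm {0<..<\<Lambda>} (L2_deriv {0<..<\<Lambda>} [1, 1] l0) + L2_norm {0<..<\<Lambda>} (L2_deriv {0<..<\<Lambda>} [1, 1] (l t)))
    + 2 / sqrt K * h * L2_norm ({0<..<\<Lambda>} \<times> {0<..<t}) (L2_deriv ({0<..<\<Lambda>} \<times> {0<..<t}) [(1, 0), (0, 1)] (\<lambda>(y, s). l s y))"
proof -
  let ?I = "{0<..<\<Lambda>}" and ?Q = "{0<..<\<Lambda>} \<times> {0<..<t}"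
  let ?qi = "L2_deriv ?I [1, 1] l0" and ?qt = "L2_deriv ?I [1, 1] (l t)"
    and ?g = "L2_deriv ?Q [(1, 0), (0, 1)] (\<lambda>(y, s). l s y)"
  let ?x = "mesh \<Lambda> N"
  have h0: "0 < h" using h pos N by simp
  have l_L2: "\<And>s. 0 \<le> s \<Longrightarrow> L2 ?I (l s)"
    and l_cont: "\<And>s. 0 \<le> s \<Longrightarrow> ((\<lambda>r. L2_norm ?I (\<lambda>y. l r y - l s y)) \<longlongrightarrow> 0) (at s within {0..})"
    and l_V: "AE s\<in>{0<..<t} in lborel. l s \<in> V_space \<Lambda>"
    and l_init: "AE y\<in>?I in lborel. l 0 y = l0 y"
    and l_eq: "\<And>v. v \<in> V_space \<Lambda> \<Longrightarrow> has_weak_deriv {0<..<t} [1] (\<lambda>s. L2_inner ?I (l s) v)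
      (\<lambda>s. - (\<Lambda> / 2) * deriv (L0 L \<omega> \<epsilon>) s * v 0 - kappa \<Lambda> K atilde a1 (l s) v)"
    using sol t unfolding weak_solution_def by blast+
  obtain dl where lh: "\<And>s. 0 \<le> s \<Longrightarrow> lh s \<in> Vh_space \<Lambda> N" "\<And>y. y \<in> {0..\<Lambda>} \<Longrightarrow> lh 0 y = l0h y"
    and dl: "\<And>y s. y \<in> {0..\<Lambda>} \<Longrightarrow> 0 \<le> s \<Longrightarrow> ((\<lambda>s. lh s y) has_real_derivative dl s y) (at s within {0..})"
      "\<And>y. y \<in> {0..\<Lambda>} \<Longrightarrow> continuous_on {0..} (\<lambda>s. dl s y)"
      "\<And>w s. w \<in> Vh_space \<Lambda> N \<Longrightarrow> 0 \<le> s \<Longrightarrow> h_inner \<Lambda> N (dl s) w + kappa \<Lambda> K atilde a1 (lh s) w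
        = - (\<Lambda> / 2) * deriv (L0 L \<omega> \<epsilon>) s * w 0"
    using disc unfolding discrete_solution_def by blast
  note q0 = L2_deriv_spec(1)[OF l0(2)] and qt = L2_deriv_spec(1)[OF lt]
  obtain c0 e0 where ae0: "AE x\<in>?I in lborel. l0 x = c0 + (LBINT z:{0<..<x}. e0 + (LBINT s:{0<..<z}. ?qi s))"
    using L2_second_deriv_primitive[OF pos(1) l0] by blast
  define f0 where "f0 = (\<lambda>x. c0 + (LBINT z:{0<..<x}. e0 + (LBINT s:{0<..<z}. ?qi s)))"
  have f0c: "continuous_on {0..\<Lambda>} f0"
    unfolding f0_def by (rule double_primitive_continuous[OF L2_interval_integrable[OF q0]])
  interpret mixed_regular_evolution \<Lambda> t l f0 ?g
  proof
    show "AE y\<in>?I in lborel. l 0 y = f0 y"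
      using l_init ae0 by eventually_elim (simp add: f0_def)
  qed (use pos t l_L2 l_cont l_V f0c L2_deriv_spec[OF lyt] in auto)
  let ?U = "\<lambda>y. f0 y + increment y t"
  \<comment> \<open>At time \<open>t\<close> both the representation by \<open>g\<close> and the second weak derivative give a continuous representative; they agree.\<close>
  obtain ct et where aet: "AE x\<in>?I in lborel. l t x = ct + (LBINT z:{0<..<x}. et + (LBINT s:{0<..<z}. ?qt s))"
    using L2_second_deriv_primitive[OF pos(1) l_L2 lt] t by auto
  have aeU: "AE y\<in>?I in lborel. l t y = ?U y" using evolution_representation(2)[of t] t by simp
  have cU: "continuous_on {0..\<Lambda>} ?U" by (intro continuous_intros f0c increment_continuous) simp
  have U: "?U x = ct + (LBINT z:{0<..<x}. et + (LBINT s:{0<..<z}. ?qt s))" if "x \<in> {0..\<Lambda>}" for x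
  proof (rule AE_eq_imp_eq_continuous[OF pos(1) cU double_primitive_continuous[OF L2_interval_integrable[OF qt]] _ that])
    show "AE x\<in>?I in lborel. ?U x = ct + (LBINT z:{0<..<x}. et + (LBINT s:{0<..<z}. ?qt s))"
      using aeU aet by eventually_elim auto
  qed
  have f0\<Lambda>: "f0 \<Lambda> = 0" by (rule evolution_representation(1))
  let ?Ji = "interpolant \<Lambda> N (\<lambda>j. f0 (?x j))" and ?Jt = "interpolant \<Lambda> N (\<lambda>j. ?U (?x j))"
  note I0V = interpolant_in_Vh_space[OF pos(1) N, of "\<lambda>j. f0 (?x j)"]
    and ItV = interpolant_in_Vh_space[OF pos(1) N, of "\<lambda>j. ?U (?x j)"]
  have int0: "(L2_norm ?I (\<lambda>y. ?Ji y - f0 y))\<^sup>2 \<le> h ^ 4 * (L2_norm ?I ?qi)\<^sup>2"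
    unfolding L2_norm_squared h
    by (rule interpolation_error[where c = c0 and e = e0, OF pos(1) N q0]) (simp_all add: f0_def[symmetric] f0\<Lambda>, simp add: f0_def)
  have intt: "(L2_norm ?I (\<lambda>y. ?Jt y - ?U y))\<^sup>2 \<le> h ^ 4 * (L2_norm ?I ?qt)\<^sup>2"
    unfolding L2_norm_squared h
  proof (rule interpolation_error[OF pos(1) N qt])
    show "?U x = ct + (LBINT z:{0<..<x}. et + (LBINT s:{0<..<z}. ?qt s))" if "x \<in> {0..\<Lambda>}" for x by (rule U[OF that])
  qed (use f0\<Lambda> increment_end in auto)
  define \<theta> where "\<theta> = (\<lambda>s j. lh s (?x j) - (f0 (?x j) + increment (?x j) s))"
  have energy: "h * (\<Sum>j<N. (\<theta> t j)\<^sup>2) \<le> h * (\<Sum>j<N. (\<theta> 0 j)\<^sup>2) + 2 * h\<^sup>2 / K * (L2_norm ?Q ?g)\<^sup>2"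
    unfolding \<theta>_def h
  proof (rule energy_estimate[where F = "\<lambda>s. - (\<Lambda> / 2) * deriv (L0 L \<omega> \<epsilon>) s" and dl = dl, OF N pos(2-4)])
    show "continuous_on {0..t} (\<lambda>s. - (\<Lambda> / 2) * deriv (L0 L \<omega> \<epsilon>) s)"
      unfolding deriv_L0 by (intro continuous_intros)
    show "has_weak_deriv {0<..<t} [1] (\<lambda>s. L2_inner ?I (l s) \<psi>)
        (\<lambda>s. - (\<Lambda> / 2) * deriv (L0 L \<omega> \<epsilon>) s * \<psi> 0 - kappa \<Lambda> K atilde a1 (l s) \<psi>)"
      if "\<psi> \<in> Vh_space \<Lambda> N" for \<psi>
      by (rule l_eq[OF Vh_space_subset_V_space[OF that pos(1) N]])
  qed (use lh dl in auto)
  have mesh_diff: "u (?x j) - interpolant \<Lambda> N v (?x j) = u (?x j) - v j" if "j < N" for u v j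
    using interpolant_mesh[OF pos(1) N, of v j] that by simp
  have VtV: "(\<lambda>y. lh t y - ?Jt y) \<in> Vh_space \<Lambda> N"
    using Vh_space_lincomb[OF lh(1)[of t] ItV, of "-1"] t by simp
  have "(\<Sum>j<N. (\<theta> t j)\<^sup>2) = (\<Sum>j<N. (lh t (?x j) - ?Jt (?x j))\<^sup>2)"
    by (rule sum.cong) (auto simp: \<theta>_def mesh_diff)
  then have Vt: "(L2_norm ?I (\<lambda>y. lh t y - ?Jt y))\<^sup>2 \<le> h * (\<Sum>j<N. (\<theta> t j)\<^sup>2)"
    using Vh_space_norm_equivalence(1)[OF VtV pos(1) N] by (simp add: L2_norm_squared h)
  have V0V: "(\<lambda>y. l0h y - ?Ji y) \<in> Vh_space \<Lambda> N"
    using Vh_space_lincomb[OF l0h I0V, of "-1"] by simp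
  have "(\<Sum>j<N. (\<theta> 0 j)\<^sup>2) = (\<Sum>j<N. (l0h (?x j) - ?Ji (?x j))\<^sup>2)"
    by (rule sum.cong) (use mesh_bounds[OF pos(1) N] in \<open>auto simp: \<theta>_def mesh_diff increment_start lh(2)\<close>)
  then have V0: "h * (\<Sum>j<N. (\<theta> 0 j)\<^sup>2) \<le> 6 * (L2_norm ?I (\<lambda>y. l0h y - ?Ji y))\<^sup>2"
    using Vh_space_norm_equivalence(2)[OF V0V pos(1) N] by (simp add: L2_norm_squared h)
  have L0: "L2 ?I f0" and LU: "L2 ?I ?U" by (intro continuous_imp_L2 f0c cU)+
  note Llh = Vh_space_L2[OF lh(1)[OF less_imp_le[OF t]]]
  have At: "L2_norm ?I (\<lambda>y. lh t y - l t y) = L2_norm ?I (\<lambda>y. lh t y - ?U y)"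
    by (rule L2_norm_cong_AE[OF L2_diff[OF Llh l_L2[OF less_imp_le[OF t]]] L2_diff[OF Llh LU]])
       (use aeU in \<open>auto elim: eventually_mono\<close>)
  have B0: "L2_norm ?I (\<lambda>y. f0 y - l0h y) = L2_norm ?I (\<lambda>y. l0h y - l0 y)"
  proof -
    have "L2_norm ?I (\<lambda>y. l0h y - l0 y) = L2_norm ?I (\<lambda>y. l0h y - f0 y)"
      by (rule L2_norm_cong_AE[OF L2_diff[OF Vh_space_L2[OF l0h] l0(1)] L2_diff[OF Vh_space_L2[OF l0h] L0]])
         (use ae0 in \<open>auto simp: f0_def elim: eventually_mono\<close>)
    also have "\<dots> = L2_norm ?I (\<lambda>y. f0 y - l0h y)"
      by (simp add: L2_norm_def L2_inner_def algebra_simps)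
    finally show ?thesis ..
  qed
  let ?A = "L2_norm ?I (\<lambda>y. lh t y - l t y)" and ?B = "L2_norm ?I (\<lambda>y. l0h y - l0 y)"
    and ?Ni = "L2_norm ?I ?qi" and ?Nt = "L2_norm ?I ?qt" and ?G = "L2_norm ?Q ?g"
  have sym: "L2_norm ?I (\<lambda>y. l0h y - ?Ji y) = L2_norm ?I (\<lambda>y. ?Ji y - l0h y)"
    by (simp add: L2_norm_def L2_inner_def algebra_simps)
  have 1: "?A\<^sup>2 \<le> 2 * (L2_norm ?I (\<lambda>y. lh t y - ?Jt y))\<^sup>2 + 2 * (L2_norm ?I (\<lambda>y. ?Jt y - ?U y))\<^sup>2"
    unfolding At by (rule L2_norm_squared_triangle[OF Llh Vh_space_L2[OF ItV] LU])
  have 2: "(L2_norm ?I (\<lambda>y. ?Ji y - l0h y))\<^sup>2 \<le> 2 * (L2_norm ?I (\<lambda>y. ?Ji y - f0 y))\<^sup>2 + 2 * ?B\<^sup>2"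
    using L2_norm_squared_triangle[OF Vh_space_L2[OF I0V] L0 Vh_space_L2[OF l0h]] unfolding B0 .
  have "?A\<^sup>2 \<le> 24 * ?B\<^sup>2 + 24 * (h ^ 4 * ?Ni\<^sup>2) + 2 * (h ^ 4 * ?Nt\<^sup>2) + 2 * (2 * h\<^sup>2 / K * ?G\<^sup>2)"
    using 1 2 Vt energy V0 int0 intt unfolding sym by linarith
  also have "\<dots> \<le> (5 * ?B)\<^sup>2 + (5 * h\<^sup>2 * ?Ni)\<^sup>2 + (5 * h\<^sup>2 * ?Nt)\<^sup>2 + (2 / sqrt K * h * ?G)\<^sup>2"
  proof -
    have h4: "(h\<^sup>2)\<^sup>2 = h ^ 4" by simp
    have "0 \<le> h ^ 4 * ?Ni\<^sup>2" "0 \<le> h ^ 4 * ?Nt\<^sup>2" "0 \<le> ?B\<^sup>2" by simp_all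
    moreover have "(2 / sqrt K * h * ?G)\<^sup>2 = 2 * (2 * h\<^sup>2 / K * ?G\<^sup>2)"
      using pos(2) by (simp add: power_mult_distrib power_divide)
    moreover have "(5 * ?B)\<^sup>2 = 25 * ?B\<^sup>2" "(5 * h\<^sup>2 * ?Ni)\<^sup>2 = 25 * (h ^ 4 * ?Ni\<^sup>2)"
      "(5 * h\<^sup>2 * ?Nt)\<^sup>2 = 25 * (h ^ 4 * ?Nt\<^sup>2)"
      by (simp_all add: power_mult_distrib h4)
    ultimately show ?thesis by linarith
  qed
  finally have "?A \<le> 5 * ?B + 5 * h\<^sup>2 * ?Ni + 5 * h\<^sup>2 * ?Nt + 2 / sqrt K * h * ?G"
    by (rule root_sum_squares_le) (use h0 pos in \<open>auto intro!: mult_nonneg_nonneg divide_nonneg_nonneg L2_norm_nonneg\<close>)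
  then show ?thesis by (simp add: algebra_simps)
qed

lemma error_at_time_zero:
  assumes "L2 {0<..<\<Lambda>} l0" "weak_solution \<Lambda> K atilde a1 L \<omega> \<epsilon> l0 l" "l0h \<in> Vh_space \<Lambda> N"
    and "discrete_solution \<Lambda> K atilde a1 L \<omega> \<epsilon> N l0h lh"
  shows "L2_norm {0<..<\<Lambda>} (\<lambda>y. lh 0 y - l 0 y) = L2_norm {0<..<\<Lambda>} (\<lambda>y. l0h y - l0 y)"
proof (rule L2_norm_cong_AE)
  have l: "L2 {0<..<\<Lambda>} (l 0)" "AE y\<in>{0<..<\<Lambda>} in lborel. l 0 y = l0 y"
    using assms(2) unfolding weak_solution_def by auto
  have lh: "lh 0 \<in> Vh_space \<Lambda> N" "\<forall>y\<in>{0..\<Lambda>}. lh 0 y = l0h y"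
    using assms(4) unfolding discrete_solution_def by auto
  show "L2 {0<..<\<Lambda>} (\<lambda>y. lh 0 y - l 0 y)" by (rule L2_diff[OF Vh_space_L2[OF lh(1)] l(1)])
  show "L2 {0<..<\<Lambda>} (\<lambda>y. l0h y - l0 y)" by (rule L2_diff[OF Vh_space_L2[OF assms(3)] assms(1)])
  show "AE y\<in>{0<..<\<Lambda>} in lborel. lh 0 y - l 0 y = l0h y - l0 y"
    using l(2) by (rule eventually_mono) (use lh(2) in auto)
qed

theorem theorem3p1:
  fixes \<Lambda> K atilde a1 :: real
  assumes "\<Lambda> > 0" and "K > 0" and "atilde > 0" and "a1 > 0"
  shows "\<exists>C>0. \<forall>L \<omega> \<epsilon> :: real. \<forall>l0 :: real \<Rightarrow> real. \<forall>l :: real \<Rightarrow> real \<Rightarrow> real.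
           \<forall>N :: nat. \<forall>l0h :: real \<Rightarrow> real. \<forall>lh :: real \<Rightarrow> real \<Rightarrow> real. \<forall>t :: real. \<forall>h :: real.
           L > 0 \<and> \<omega> > 0 \<and> 0 \<le> \<epsilon> \<and> \<epsilon> < 1 \<and>
           sobolev 2 {0<..<\<Lambda>} l0 \<and>
           weak_solution \<Lambda> K atilde a1 L \<omega> \<epsilon> l0 l \<and>
           N \<ge> 1 \<and> h = \<Lambda> / real N \<and>
           l0h \<in> Vh_space \<Lambda> N \<and>
           discrete_solution \<Lambda> K atilde a1 L \<omega> \<epsilon> N l0h lh \<and>
           t \<ge> 0 \<longrightarrow>
           ennreal (L2_norm {0<..<\<Lambda>} (\<lambda>y. lh t y - l t y))
             \<le> ennreal (C * L2_norm {0<..<\<Lambda>} (\<lambda>y. l0h y - l0 y))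
               + ennreal (C * h\<^sup>2)
                   * (deriv_norm {0<..<\<Lambda>} [1, 1] l0 + deriv_norm {0<..<\<Lambda>} [1, 1] (l t))
               + ennreal (C * h)
                   * deriv_norm ({0<..<\<Lambda>} \<times> {0<..<t}) [(1, 0), (0, 1)] (\<lambda>(y, s). l s y)"
proof (intro exI conjI allI impI)
  let ?C = "5 + 2 / sqrt K"
  show C: "?C > 0" using assms by (simp add: add_pos_nonneg)
  fix L \<omega> \<epsilon> :: real and l0 :: "real \<Rightarrow> real" and l :: "real \<Rightarrow> real \<Rightarrow> real" and N :: nat
    and l0h :: "real \<Rightarrow> real" and lh :: "real \<Rightarrow> real \<Rightarrow> real" and t h :: real
  let ?I = "{0<..<\<Lambda>}" and ?Q = "{0<..<\<Lambda>} \<times> {0<..<t}"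
  let ?A = "L2_norm ?I (\<lambda>y. lh t y - l t y)" and ?B = "L2_norm ?I (\<lambda>y. l0h y - l0 y)"
  let ?g = "\<lambda>(y, s). l s y"
  assume hyps: "L > 0 \<and> \<omega> > 0 \<and> 0 \<le> \<epsilon> \<and> \<epsilon> < 1 \<and> sobolev 2 {0<..<\<Lambda>} l0 \<and>
    weak_solution \<Lambda> K atilde a1 L \<omega> \<epsilon> l0 l \<and> N \<ge> 1 \<and> h = \<Lambda> / real N \<and> l0h \<in> Vh_space \<Lambda> N \<and>
    discrete_solution \<Lambda> K atilde a1 L \<omega> \<epsilon> N l0h lh \<and> t \<ge> 0"
  then have l0: "L2 ?I l0" "has_L2_deriv ?I [1, 1] l0" and h: "0 < h"
    using assms by (auto simp: sobolev_def)
  show "ennreal ?A \<le> ennreal (?C * ?B)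
    + ennreal (?C * h\<^sup>2) * (deriv_norm ?I [1, 1] l0 + deriv_norm ?I [1, 1] (l t))
    + ennreal (?C * h) * deriv_norm ?Q [(1, 0), (0, 1)] ?g"
  proof (cases "t = 0")
    case True
    have "?A = ?B" unfolding True by (rule error_at_time_zero) (use l0 hyps in auto)
    also have "?B \<le> ?C * ?B"
      using mult_right_mono[of 1 ?C ?B, OF _ L2_norm_nonneg] assms(2) by simp
    finally have "ennreal ?A \<le> ennreal (?C * ?B)" by (rule ennreal_leI)
    then show ?thesis by (simp add: add_increasing2 add.assoc)
  next
    case False
    show ?thesis
    proof (cases "has_L2_deriv ?I [1, 1] (l t) \<and> has_L2_deriv ?Q [(1, 0), (0, 1)] ?g")
      case True
      let ?Ni = "L2_norm ?I (L2_deriv ?I [1, 1] l0)" and ?Nt = "L2_norm ?I (L2_deriv ?I [1, 1] (l t))"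
        and ?G = "L2_norm ?Q (L2_deriv ?Q [(1, 0), (0, 1)] ?g)"
      have "?A \<le> 5 * ?B + 5 * h\<^sup>2 * (?Ni + ?Nt) + 2 / sqrt K * h * ?G"
        by (rule error_estimate_positive_time[OF assms]) (use hyps l0 True False in auto)
      also have "\<dots> \<le> ?C * ?B + ?C * h\<^sup>2 * (?Ni + ?Nt) + ?C * h * ?G"
        using h assms(2) by (intro add_mono mult_right_mono) (auto simp: L2_norm_nonneg)
      finally have "ennreal ?A \<le> ennreal (?C * ?B + ?C * h\<^sup>2 * (?Ni + ?Nt) + ?C * h * ?G)" by (rule ennreal_leI)
      also have "\<dots> = ennreal (?C * ?B) + ennreal (?C * h\<^sup>2) * (ennreal ?Ni + ennreal ?Nt) + ennreal (?C * h) * ennreal ?G"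
      proof -
        have e: "ennreal (a + b * (c + d) + e * f) = ennreal a + ennreal b * (ennreal c + ennreal d) + ennreal e * ennreal f"
          if "0 \<le> a" "0 \<le> b" "0 \<le> c" "0 \<le> d" "0 \<le> e" "0 \<le> f" for a b c d e f
          using that by (simp add: ennreal_plus ennreal_mult)
        show ?thesis by (rule e) (use C h in \<open>auto intro!: mult_nonneg_nonneg L2_norm_nonneg\<close>)
      qed
      finally show ?thesis using True l0(2) by (simp add: deriv_norm_def)
    next
      case False
      \<comment> \<open>If a derivative is not square integrable, the right-hand side is infinite.\<close>
      have "0 < ?C * h\<^sup>2" "0 < ?C * h" using C h by auto
      then have "ennreal (?C * h\<^sup>2) * \<infinity> = \<infinity>" "ennreal (?C * h) * \<infinity> = \<infinity>" by (auto simp: ennreal_mult_eq_top_iff)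
      then show ?thesis using False by (auto simp: deriv_norm_def)
    qed
  qed
qed


end
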